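(* Let $\mathcal{H}$ be a separable infinite-dimensional Hilbert space and let $\mathrm{Tr}_\omega$ be a Dixmier trace on the ideal $\mathcal{L}^{(1,\infty)}$ of $B(\mathcal{H})$. Let $\sigma$ be any finite positive measure having bounded support in the real line. Then there are (commuting) diagonal operators $H_0=H_0^*\in B(\mathcal{H})$ and $V=V^*\in\mathcal{L}^{(1,\infty)}$ such that $\mu_{H_0,V}=\sigma$, where $\mu_{H_0,V}$ is the unique complex measure on $\Omega=\operatorname{conv}(\sigma(H_0)\cup\sigma(H_0+V))$ (regarded as a measure on $\mathbb{R}$ supported in $\Omega$) satisfying $$\mathrm{Tr}_\omega\big(f(H_0+V)-f(H_0)\big)=\int_\Omega f'(\lambda)\,\mu_{H_0,V}(d\lambda)\qquad\text{for all } f\in C^3(\mathbb{R}).$$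
   Context: For $A\in B(\mathcal{H})$ let $s_1(A)\ge s_2(A)\ge\cdots$ be its singular numbers. The dual Macaev ideal is $\mathcal{L}^{(1,\infty)}=\{A\in B(\mathcal{H}):\ \sup_{n\in\mathbb{N}}\frac{1}{\log(n+1)}\sum_{k=1}^n s_k(A)<\infty\}$, where this supremum is the ideal norm of $A$. Let $\omega$ be a dilation invariant state on $\ell^\infty(\mathbb{N})$ (invariant under $(x_1,x_2,\ldots)\mapsto(x_1,x_1,x_2,x_2,\ldots)$ and the analogous $m$-fold repetitions) that vanishes on sequences converging to $0$. The Dixmier trace $\mathrm{Tr}_\omega$ is the linear functional on $\mathcal{L}^{(1,\infty)}$ given for $A\ge 0$ by $\mathrm{Tr}_\omega(A)=\omega\big(\big(\frac{1}{\log(n+1)}\sum_{k=1}^n s_k(A)\big)_{n\ge1}\big)$; it is a positive trace on $\mathcal{L}^{(1,\infty)}$, bounded with respect to the ideal norm, and vanishes on finite rank operators. "Diagonal" means diagonal with respect to a common orthonormal basis of $\mathcal{H}$. For bounded self-adjoint $H_0$ and $V=V^*\in\mathcal{L}^{(1,\infty)}$, existence and uniqueness of $\mu_{H_0,V}$ is a theorem of the same paper. *)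

theory Defs
  imports "HOL-Analysis.Analysis"
begin

section \<open>Complex Hilbert spaces\<close>

text \<open>The inner product is linear in its first argument. The real scalar multiplication,
  norm and metric of the superclass are those induced by the complex structure.\<close>

class chilbert_space = banach +
  fixes scaleC :: "complex \<Rightarrow> 'a \<Rightarrow> 'a" (infixr \<open>*\<^sub>C\<close> 75)
    and cinner :: "'a \<Rightarrow> 'a \<Rightarrow> complex"
  assumes scaleR_scaleC: "r *\<^sub>R x = complex_of_real r *\<^sub>C x"
    and scaleC_add_right: "c *\<^sub>C (x + y) = c *\<^sub>C x + c *\<^sub>C y"
    and scaleC_add_left: "(c + d) *\<^sub>C x = c *\<^sub>C x + d *\<^sub>C x"
    and scaleC_scaleC: "c *\<^sub>C (d *\<^sub>C x) = (c * d) *\<^sub>C x"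
    and cinner_commute: "cinner x y = cnj (cinner y x)"
    and cinner_add_left: "cinner (x + y) z = cinner x z + cinner y z"
    and cinner_scaleC_left: "cinner (c *\<^sub>C x) y = c * cinner x y"
    and cinner_self: "cinner x x = complex_of_real ((norm x)\<^sup>2)"

lemma scaleC_one: "1 *\<^sub>C x = (x :: 'a :: chilbert_space)"
  by (metis of_real_1 scaleR_one scaleR_scaleC)

global_interpretation complex_vector: vector_space "scaleC :: complex \<Rightarrow> 'a \<Rightarrow> 'a :: chilbert_space"
  by unfold_locales (simp_all add: scaleC_add_right scaleC_add_left scaleC_scaleC scaleC_one)

definition infinite_dimensional :: "'a :: chilbert_space itself \<Rightarrow> bool" where
  "infinite_dimensional _ \<longleftrightarrow> \<not> (\<exists>B :: 'a set. finite B \<and> complex_vector.span B = UNIV)"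

definition orthonormal_basis :: "'a :: chilbert_space set \<Rightarrow> bool" where
  "orthonormal_basis E \<longleftrightarrow> (\<forall>e\<in>E. norm e = 1) \<and> pairwise (\<lambda>e e'. cinner e e' = 0) E \<and>
     closure (complex_vector.span E) = UNIV"


section \<open>Bounded operators\<close>

text \<open>The type \<open>'a \<Rightarrow>\<^sub>L 'a\<close> of the library consists of the bounded \<^emph>\<open>real\<close>-linear operators;
  \<open>B(H)\<close> is the set of the complex-linear ones among them.\<close>

definition bounded_operators :: "('a :: chilbert_space \<Rightarrow>\<^sub>L 'a) set" where
  "bounded_operators = {A. \<forall>c x. blinfun_apply A (c *\<^sub>C x) = c *\<^sub>C blinfun_apply A x}"

definition op_scaleC :: "complex \<Rightarrow> ('a :: chilbert_space \<Rightarrow>\<^sub>L 'a) \<Rightarrow> ('a \<Rightarrow>\<^sub>L 'a)" where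
  "op_scaleC c A = Blinfun (\<lambda>x. c *\<^sub>C blinfun_apply A x)"

definition self_adjoint :: "('a :: chilbert_space \<Rightarrow>\<^sub>L 'a) \<Rightarrow> bool" where
  "self_adjoint A \<longleftrightarrow> (\<forall>x y. cinner (blinfun_apply A x) y = cinner x (blinfun_apply A y))"

definition positive_op :: "('a :: chilbert_space \<Rightarrow>\<^sub>L 'a) \<Rightarrow> bool" where
  "positive_op A \<longleftrightarrow> (\<forall>x. cinner (blinfun_apply A x) x \<in> \<real>\<^sub>\<ge>\<^sub>0)"

definition diagonal_wrt :: "'a :: chilbert_space set \<Rightarrow> ('a \<Rightarrow>\<^sub>L 'a) \<Rightarrow> bool" where
  "diagonal_wrt E A \<longleftrightarrow> (\<forall>e\<in>E. \<exists>c. blinfun_apply A e = c *\<^sub>C e)"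

definition spectrum :: "('a :: chilbert_space \<Rightarrow>\<^sub>L 'a) \<Rightarrow> complex set" where
  "spectrum A = {z. \<not> (\<exists>B\<in>bounded_operators.
      (A - op_scaleC z id_blinfun) o\<^sub>L B = id_blinfun \<and>
      B o\<^sub>L (A - op_scaleC z id_blinfun) = id_blinfun)}"

definition op_poly :: "complex poly \<Rightarrow> ('a :: chilbert_space \<Rightarrow>\<^sub>L 'a) \<Rightarrow> ('a \<Rightarrow>\<^sub>L 'a)" where
  "op_poly p A = Blinfun (\<lambda>x. \<Sum>i\<le>degree p. coeff p i *\<^sub>C (blinfun_apply A ^^ i) x)"

text \<open>Continuous functional calculus \<open>f(A)\<close> for self-adjoint \<open>A\<close>: the operator-norm limit of
  \<open>p(A)\<close> as the polynomial \<open>p\<close> tends to \<open>f\<close> uniformly on the (real) spectrum of \<open>A\<close>.\<close>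

definition fun_calc :: "(real \<Rightarrow> complex) \<Rightarrow> ('a :: chilbert_space \<Rightarrow>\<^sub>L 'a) \<Rightarrow> ('a \<Rightarrow>\<^sub>L 'a)" where
  "fun_calc f A = (THE B. \<forall>\<epsilon>>0. \<exists>p.
      (\<forall>t. complex_of_real t \<in> spectrum A \<longrightarrow> norm (poly p (complex_of_real t) - f t) < \<epsilon>) \<and>
      norm (op_poly p A - B) < \<epsilon>)"


section \<open>The dual Macaev ideal and Dixmier traces\<close>

text \<open>Singular numbers of an arbitrary bounded operator, indexed from \<open>k = 1\<close>: the distance
  in operator norm to the operators of rank less than \<open>k\<close>. For compact \<open>A\<close> these are the
  eigenvalues of \<open>|A|\<close> in decreasing order, counted with multiplicity.\<close>

definition rank_less :: "('a :: chilbert_space \<Rightarrow>\<^sub>L 'a) \<Rightarrow> nat \<Rightarrow> bool" where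
  "rank_less F k \<longleftrightarrow>
     (\<exists>B. finite B \<and> card B < k \<and> range (blinfun_apply F) \<subseteq> complex_vector.span B)"

definition singular_number :: "('a :: chilbert_space \<Rightarrow>\<^sub>L 'a) \<Rightarrow> nat \<Rightarrow> real" where
  "singular_number A k = Inf {norm (A - F) | F. F \<in> bounded_operators \<and> rank_less F k}"

definition log_average :: "('a :: chilbert_space \<Rightarrow>\<^sub>L 'a) \<Rightarrow> nat \<Rightarrow> real" where
  "log_average A n = (\<Sum>k=1..n. singular_number A k) / ln (real n + 1)"

definition dual_macaev_ideal :: "('a :: chilbert_space \<Rightarrow>\<^sub>L 'a) set" where
  "dual_macaev_ideal = {A \<in> bounded_operators. bdd_above (log_average A ` {1..})}"

text \<open>Elements of \<open>\<ell>\<^sup>\<infinity>\<close> are bounded functions on \<open>nat\<close>; the value at \<open>i\<close> is the entry with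
  number \<open>i + 1\<close> of the sequence. Hence the \<open>m\<close>-fold repetition of \<open>x\<close> is \<open>\<lambda>i. x (i div m)\<close>.\<close>

definition dilation_invariant_state :: "((nat \<Rightarrow> complex) \<Rightarrow> complex) \<Rightarrow> bool" where
  "dilation_invariant_state \<omega> \<longleftrightarrow>
     (\<forall>x y. Bseq x \<longrightarrow> Bseq y \<longrightarrow> \<omega> (\<lambda>i. x i + y i) = \<omega> x + \<omega> y) \<and>
     (\<forall>c x. Bseq x \<longrightarrow> \<omega> (\<lambda>i. c * x i) = c * \<omega> x) \<and>
     (\<forall>x. Bseq x \<longrightarrow> (\<forall>i. x i \<in> \<real>\<^sub>\<ge>\<^sub>0) \<longrightarrow> \<omega> x \<in> \<real>\<^sub>\<ge>\<^sub>0) \<and>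
     \<omega> (\<lambda>i. 1) = 1 \<and>
     (\<forall>m\<ge>1. \<forall>x. Bseq x \<longrightarrow> \<omega> (\<lambda>i. x (i div m)) = \<omega> x)"

definition vanishes_on_null_sequences :: "((nat \<Rightarrow> complex) \<Rightarrow> complex) \<Rightarrow> bool" where
  "vanishes_on_null_sequences \<omega> \<longleftrightarrow> (\<forall>x. x \<longlonglongrightarrow> 0 \<longrightarrow> \<omega> x = 0)"

text \<open>\<open>Tr\<close> is the Dixmier trace of \<open>\<omega>\<close>. Only its values on the ideal matter, and there it is
  determined by the formula for positive operators, since these span the ideal.\<close>

definition is_dixmier_trace ::
  "((nat \<Rightarrow> complex) \<Rightarrow> complex) \<Rightarrow> (('a :: chilbert_space \<Rightarrow>\<^sub>L 'a) \<Rightarrow> complex) \<Rightarrow> bool" where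
  "is_dixmier_trace \<omega> Tr \<longleftrightarrow>
     (\<forall>A\<in>dual_macaev_ideal. \<forall>B\<in>dual_macaev_ideal. Tr (A + B) = Tr A + Tr B) \<and>
     (\<forall>c. \<forall>A\<in>dual_macaev_ideal. Tr (op_scaleC c A) = c * Tr A) \<and>
     (\<forall>A\<in>dual_macaev_ideal. positive_op A \<longrightarrow>
        Tr A = \<omega> (\<lambda>i. complex_of_real (log_average A (Suc i))))"


section \<open>Complex measures on the real line\<close>

text \<open>A complex Borel measure is a countably additive complex function on the Borel sets;
  as a function on all sets it is normalized to be \<open>0\<close> elsewhere, like \<^const>\<open>measure\<close>.\<close>

definition complex_measure :: "(real set \<Rightarrow> complex) \<Rightarrow> bool" where
  "complex_measure \<nu> \<longleftrightarrow>
     (\<forall>B. B \<notin> sets borel \<longrightarrow> \<nu> B = 0) \<and>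
     (\<forall>A :: nat \<Rightarrow> real set. range A \<subseteq> sets borel \<longrightarrow> disjoint_family A \<longrightarrow>
        (\<lambda>i. \<nu> (A i)) sums \<nu> (\<Union>i. A i))"

text \<open>Positive variation of a real-valued measure; the negative variation of \<open>\<rho>\<close> is the
  positive variation of \<open>-\<rho>\<close>, and the difference of the two is the Jordan decomposition.\<close>

definition pos_variation :: "(real set \<Rightarrow> real) \<Rightarrow> real measure" where
  "pos_variation \<rho> = measure_of UNIV (sets borel)
     (\<lambda>B. SUP C\<in>{C \<in> sets borel. C \<subseteq> B}. ennreal (\<rho> C))"

definition complex_measure_integral ::
  "(real set \<Rightarrow> complex) \<Rightarrow> real set \<Rightarrow> (real \<Rightarrow> complex) \<Rightarrow> complex" where
  "complex_measure_integral \<nu> S g =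
     set_lebesgue_integral (pos_variation (\<lambda>B. Re (\<nu> B))) S g -
     set_lebesgue_integral (pos_variation (\<lambda>B. - Re (\<nu> B))) S g +
     \<i> * (set_lebesgue_integral (pos_variation (\<lambda>B. Im (\<nu> B))) S g -
          set_lebesgue_integral (pos_variation (\<lambda>B. - Im (\<nu> B))) S g)"

definition measure_support :: "real measure \<Rightarrow> real set" where
  "measure_support M = {x. \<forall>U. open U \<longrightarrow> x \<in> U \<longrightarrow> emeasure M U > 0}"


section \<open>The trace formula\<close>

primrec Ck :: "nat \<Rightarrow> (real \<Rightarrow> complex) \<Rightarrow> bool" where
  "Ck 0 f \<longleftrightarrow> continuous_on UNIV f"
| "Ck (Suc k) f \<longleftrightarrow>
     (\<forall>x. f differentiable (at x)) \<and> Ck k (\<lambda>x. vector_derivative f (at x))"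

definition spectral_hull :: "('a :: chilbert_space \<Rightarrow>\<^sub>L 'a) \<Rightarrow> ('a \<Rightarrow>\<^sub>L 'a) \<Rightarrow> real set" where
  "spectral_hull H\<^sub>0 V =
     {t. complex_of_real t \<in> convex hull (spectrum H\<^sub>0 \<union> spectrum (H\<^sub>0 + V))}"

definition trace_formula_measure ::
  "(('a :: chilbert_space \<Rightarrow>\<^sub>L 'a) \<Rightarrow> complex) \<Rightarrow> ('a \<Rightarrow>\<^sub>L 'a) \<Rightarrow> ('a \<Rightarrow>\<^sub>L 'a) \<Rightarrow>
     (real set \<Rightarrow> complex) \<Rightarrow> bool" where
  "trace_formula_measure Tr H\<^sub>0 V \<nu> \<longleftrightarrow>
     complex_measure \<nu> \<and>
     (\<forall>B\<in>sets borel. B \<inter> spectral_hull H\<^sub>0 V = {} \<longrightarrow> \<nu> B = 0) \<and>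
     (\<forall>f. Ck 3 f \<longrightarrow>
        fun_calc f (H\<^sub>0 + V) - fun_calc f H\<^sub>0 \<in> dual_macaev_ideal \<and>
        Tr (fun_calc f (H\<^sub>0 + V) - fun_calc f H\<^sub>0) =
          complex_measure_integral \<nu> (spectral_hull H\<^sub>0 V) (\<lambda>x. vector_derivative f (at x)))"

definition spectral_shift_measure ::
  "(('a :: chilbert_space \<Rightarrow>\<^sub>L 'a) \<Rightarrow> complex) \<Rightarrow> ('a \<Rightarrow>\<^sub>L 'a) \<Rightarrow> ('a \<Rightarrow>\<^sub>L 'a) \<Rightarrow>
     (real set \<Rightarrow> complex)" where
  "spectral_shift_measure Tr H\<^sub>0 V = (THE \<nu>. trace_formula_measure Tr H\<^sub>0 V \<nu>)"

end

theory Submission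
  imports Defs "HOL-Probability.Weak_Convergence" "HOL-Library.Discrete_Functions"
begin

text \<open>Fix an orthonormal basis \<open>e 0, e 1, \<dots>\<close> and look for \<open>H\<^sub>0\<close> and \<open>V\<close> with eigenvalues \<open>h n\<close> and
\<open>v n \<ge> 0\<close>, where \<open>v n = O(1/n)\<close>. Then \<open>f(H\<^sub>0 + V) - f(H\<^sub>0)\<close> is diagonal with entries
\<open>f(h n + v n) - f(h n) = f'(h n) v n + O(1/n\<^sup>2)\<close>. The Dixmier trace of such an operator can be read off
its entries in the given order: sorting a sequence that is \<open>O(1/n)\<close> into decreasing order changes its
partial sums only by a bounded amount (\<open>sum_singular_numbers_diag_approx\<close>), so if the partial sums of
the entries are \<open>L ln n + O(1)\<close>, then the logarithmic averages converge and every Dixmier trace takes the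
value \<open>L\<close> (\<open>dixmier_trace_diag\<close>). It remains to choose the eigenvalues such that the partial sums
are \<open>(\<integral> f' d\<sigma>) ln n + O(1)\<close>.

Let \<open>m\<close> be the total mass of \<open>\<sigma>\<close> and \<open>Q\<close> the quantile function of \<open>\<sigma> / m\<close>, so that
\<open>\<integral> g d\<sigma> = m \<integral> g(Q u) du\<close> with \<open>u\<close> running over \<open>[0,1]\<close>. On the dyadic block
\<open>2\<^sup>k \<le> n < 2\<^sup>k\<^sup>+\<^sup>1\<close> let \<open>h\<close> run through the \<open>2\<^sup>k\<close> values
\<open>Q(j/2\<^sup>k)\<close> and let \<open>v\<close> be constantly \<open>ln 2 m / 2\<^sup>k\<close>. The entries of the block then add up to a
Riemann sum for \<open>ln 2 \<integral> f' d\<sigma>\<close>. Since \<open>Q\<close> is monotone and \<open>f'\<close> is Lipschitz on bounded sets, the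
errors over the subintervals telescope, and the Riemann sum is off by only \<open>O(1/2\<^sup>k)\<close>
(\<open>Riemann_sum_error_telescopes\<close>). There are about \<open>ln n / ln 2\<close> blocks below \<open>n\<close>, which gives
the required growth (\<open>dyadic_blocks_logarithmic\<close>, \<open>eigenvalue_sequences\<close>).

The end points of an interval containing the support of \<open>\<sigma>\<close> are among the eigenvalues of \<open>H\<^sub>0\<close>, so
\<open>\<sigma>\<close> is carried by the spectral hull and satisfies the trace formula. For uniqueness, let \<open>\<nu>\<close>
satisfy it too. Inserting polynomials \<open>f\<close> shows that \<open>\<nu>\<close> and \<open>\<sigma>\<close> have the same moments on the
compact hull. The Jordan decomposition of the real and imaginary part of \<open>\<nu>\<close> into finite measures
makes these integrals accessible to uniform approximation and dominated convergence, so that first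
continuous functions, then half-lines and finally all Borel sets are treated alike
(\<open>complex_measure_determined_by_polynomials\<close>).\<close>

section \<open>Elementary geometry of complex Hilbert spaces\<close>

lemma cinner_add_right: "cinner x (y + z) = cinner x y + cinner x (z :: 'a :: chilbert_space)"
  by (metis cinner_add_left cinner_commute complex_cnj_add)

lemma cinner_scaleC_right: "cinner x (c *\<^sub>C y) = cnj c * cinner x (y :: 'a :: chilbert_space)"
  by (metis cinner_commute cinner_scaleC_left complex_cnj_mult)

lemma cinner_zero_left [simp]: "cinner 0 (x :: 'a :: chilbert_space) = 0"
  using cinner_add_left[of 0 0 x] by simp

lemma cinner_zero_right [simp]: "cinner (x :: 'a :: chilbert_space) 0 = 0"
  using cinner_add_right[of x 0 0] by simp

lemma cinner_diff_left: "cinner (x - y) z = cinner x z - cinner y (z :: 'a :: chilbert_space)"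
  using cinner_add_left[of "x - y" y z] by simp

lemma cinner_diff_right: "cinner x (y - z) = cinner x y - cinner x (z :: 'a :: chilbert_space)"
  using cinner_add_right[of x "y - z" z] by simp

lemma cinner_sum_left: "cinner (\<Sum>i\<in>F. f i) (x :: 'a :: chilbert_space) = (\<Sum>i\<in>F. cinner (f i) x)"
  by (induction F rule: infinite_finite_induct) (simp_all add: cinner_add_left)

lemma cinner_sum_right: "cinner (x :: 'a :: chilbert_space) (\<Sum>i\<in>F. f i) = (\<Sum>i\<in>F. cinner x (f i))"
  by (induction F rule: infinite_finite_induct) (simp_all add: cinner_add_right)

lemma norm_scaleC: "norm (c *\<^sub>C x) = cmod c * norm (x :: 'a :: chilbert_space)"
proof -
  have "complex_of_real ((norm (c *\<^sub>C x))\<^sup>2) = (c * cnj c) * cinner x x"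
    unfolding cinner_self[symmetric] by (simp add: cinner_scaleC_left cinner_scaleC_right)
  also have "\<dots> = complex_of_real ((cmod c * norm x)\<^sup>2)"
    by (simp only: cinner_self complex_norm_square[symmetric] power_mult_distrib of_real_mult)
  finally show ?thesis
    by (metis mult_nonneg_nonneg norm_ge_zero of_real_eq_iff power2_eq_iff_nonneg)
qed

text \<open>Pythagoras, in the form in which it serves for Cauchy-Schwarz and for Bessel's inequality.\<close>

lemma norm_diff_orthogonal_component:
  fixes x s :: "'a :: chilbert_space"
  assumes "cinner (x - s) s = 0"
  shows "(norm x)\<^sup>2 = (norm (x - s))\<^sup>2 + (norm s)\<^sup>2"
proof -
  have "cinner s (x - s) = 0"
    using assms by (metis cinner_commute complex_cnj_zero)
  then have "cinner x x = cinner (x - s) (x - s) + cinner s s"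
    using assms by (simp add: cinner_diff_left cinner_diff_right)
  then show ?thesis
    by (simp only: cinner_self of_real_add[symmetric] of_real_eq_iff)
qed

lemma cinner_Cauchy_Schwarz: "cmod (cinner x y) \<le> norm x * norm (y :: 'a :: chilbert_space)"
proof (cases "y = 0")
  case False
  define c where "c = cinner x y / complex_of_real ((norm y)\<^sup>2)"
  have *: "cinner (x - c *\<^sub>C y) y = 0"
    using False by (simp add: cinner_diff_left cinner_scaleC_left c_def cinner_self)
  then have "cinner (x - c *\<^sub>C y) (c *\<^sub>C y) = 0"
    by (simp add: cinner_scaleC_right)
  from norm_diff_orthogonal_component[OF this] have "(norm (c *\<^sub>C y))\<^sup>2 \<le> (norm x)\<^sup>2"
    by simp
  then have "cmod c * norm y \<le> norm x"
    by (simp add: norm_scaleC power2_le_iff_abs_le)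
  moreover have "cmod c * norm y = cmod (cinner x y) / norm y"
    using False by (simp add: c_def norm_divide power2_eq_square norm_mult)
  ultimately show ?thesis
    using False by (simp add: divide_le_eq)
qed simp

lemma bounded_linear_cinner_left: "bounded_linear (\<lambda>x. cinner x (y :: 'a :: chilbert_space))"
proof (rule bounded_linear_intro[where K = "norm y"])
  show "cinner (r *\<^sub>R x) y = r *\<^sub>R cinner x y" for r x
    by (simp add: scaleR_scaleC cinner_scaleC_left scaleR_conv_of_real)
qed (simp_all add: cinner_add_left cinner_Cauchy_Schwarz)

lemma bounded_linear_cinner_right: "bounded_linear (\<lambda>x. cinner (y :: 'a :: chilbert_space) x)"
proof (rule bounded_linear_intro[where K = "norm y"])
  show "cinner y (r *\<^sub>R x) = r *\<^sub>R cinner y x" for r x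
    by (simp add: scaleR_scaleC cinner_scaleC_right scaleR_conv_of_real)
  show "norm (cinner y x) \<le> norm x * norm y" for x
    using cinner_Cauchy_Schwarz[of y x] by (simp add: mult.commute)
qed (simp_all add: cinner_add_right)

lemma bounded_linear_scaleC: "bounded_linear (\<lambda>x :: 'a :: chilbert_space. c *\<^sub>C x)"
proof (rule bounded_linear_intro[where K = "cmod c"])
  show "c *\<^sub>C (r *\<^sub>R x) = r *\<^sub>R (c *\<^sub>C x)" for r and x :: 'a
    by (simp add: scaleR_scaleC scaleC_scaleC mult.commute)
qed (simp_all add: scaleC_add_right norm_scaleC mult.commute)

section \<open>Existence of a countable orthonormal basis\<close>

definition orthonormal :: "'a :: chilbert_space set \<Rightarrow> bool" where
  "orthonormal E \<longleftrightarrow> (\<forall>e\<in>E. norm e = 1) \<and> pairwise (\<lambda>e e'. cinner e e' = 0) E"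

lemma orthonormal_cinner:
  assumes "orthonormal E" "e \<in> E" "e' \<in> E"
  shows "cinner e e' = (if e = e' then 1 else 0)"
  using assms unfolding orthonormal_def pairwise_def by (auto simp: cinner_self)

definition finite_projection :: "'a :: chilbert_space set \<Rightarrow> 'a \<Rightarrow> 'a" where
  "finite_projection F x = (\<Sum>e\<in>F. cinner x e *\<^sub>C e)"

lemma finite_projection_in_span: "finite_projection F x \<in> complex_vector.span F"
  unfolding finite_projection_def
  by (intro complex_vector.span_sum complex_vector.span_scale complex_vector.span_base)

lemma finite_projection_orthogonal:
  assumes "orthonormal F" "finite F" "e \<in> F"
  shows "cinner (x - finite_projection F x) e = 0"
proof -
  have "cinner (finite_projection F x) e = (\<Sum>e'\<in>F. if e' = e then cinner x e else 0)"
    unfolding finite_projection_def cinner_sum_left cinner_scaleC_left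
    using assms by (intro sum.cong refl) (auto simp: orthonormal_cinner)
  then show ?thesis
    using assms by (simp add: cinner_diff_left)
qed

lemma finite_projection_fixes_span:
  assumes "orthonormal F" "finite F" "x \<in> complex_vector.span F"
  shows "finite_projection F x = x"
  using assms(3)
proof (induction rule: complex_vector.span_induct_alt)
  case base
  show ?case by (simp add: finite_projection_def)
next
  case (step c e y)
  have "finite_projection F e = (\<Sum>e'\<in>F. if e' = e then e else 0)"
    unfolding finite_projection_def using assms(1) step(1)
    by (intro sum.cong refl) (auto simp: orthonormal_cinner scaleC_one)
  also have "\<dots> = e"
    using assms step by simp
  finally have "finite_projection F e = e" .
  moreover have "finite_projection F (c *\<^sub>C e + y) = c *\<^sub>C finite_projection F e + finite_projection F y"
    unfolding finite_projection_def
    by (simp add: cinner_add_left cinner_scaleC_left scaleC_add_left sum.distrib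
        complex_vector.scale_sum_right scaleC_scaleC)
  ultimately show ?case
    using step by simp
qed

text \<open>The span is the fixed point set of a continuous projection.\<close>

lemma closed_span_finite_orthonormal:
  assumes "orthonormal F" "finite F"
  shows "closed (complex_vector.span F)"
proof -
  have "complex_vector.span F = {x. finite_projection F x = x}"
    using finite_projection_fixes_span[OF assms] by auto (metis finite_projection_in_span)
  moreover have "continuous_on UNIV (\<lambda>x. finite_projection F x)"
  proof -
    have "continuous_on UNIV (\<lambda>x. cinner x e *\<^sub>C e)" for e :: 'a
    proof (rule linear_continuous_on)
      have "bounded_linear (\<lambda>c :: complex. c *\<^sub>C e)"
        by (rule bounded_linear_intro[where K = "norm e"])
           (simp_all add: scaleC_add_left norm_scaleC scaleR_scaleC scaleC_scaleC scaleR_conv_of_real)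
      from bounded_linear_compose[OF this bounded_linear_cinner_left[of e]]
      show "bounded_linear (\<lambda>x. cinner x e *\<^sub>C e)" .
    qed
    then show ?thesis
      unfolding finite_projection_def by (intro continuous_on_sum)
  qed
  ultimately show ?thesis
    by (simp add: closed_Collect_eq)
qed

text \<open>One step of the Gram-Schmidt process: the new direction is the normalized residue of \<open>x\<close>.\<close>

lemma orthonormal_extend_to_span:
  assumes "orthonormal F" "finite F"
  shows "\<exists>G. finite G \<and> orthonormal G \<and> F \<subseteq> G \<and> x \<in> complex_vector.span G"
proof (cases "x \<in> complex_vector.span F")
  case False
  define r where "r = x - finite_projection F x"
  define u where "u = complex_of_real (1 / norm r) *\<^sub>C r"
  have "r \<noteq> 0"
    using False finite_projection_in_span[of F x] by (auto simp: r_def)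
  then have u: "norm u = 1" "r = complex_of_real (norm r) *\<^sub>C u"
    by (simp_all add: u_def norm_scaleC norm_divide scaleC_scaleC scaleC_one)
  have "cinner u e = 0" "cinner e u = 0" if "e \<in> F" for e
  proof -
    show *: "cinner u e = 0"
      using finite_projection_orthogonal[OF assms that, of x]
      by (simp add: u_def r_def[symmetric] cinner_scaleC_left)
    show "cinner e u = 0"
      by (metis * cinner_commute complex_cnj_zero)
  qed
  then have "orthonormal (insert u F)"
    using assms(1) u(1) unfolding orthonormal_def by (auto simp: pairwise_insert)
  moreover have "x \<in> complex_vector.span (insert u F)"
  proof -
    have "x = finite_projection F x + complex_of_real (norm r) *\<^sub>C u"
      by (simp add: u(2)[symmetric]) (simp add: r_def)
    moreover have "finite_projection F x \<in> complex_vector.span (insert u F)"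
      using finite_projection_in_span complex_vector.span_mono[of F "insert u F"] by blast
    ultimately show ?thesis
      by (metis complex_vector.span_add complex_vector.span_base complex_vector.span_scale insertI1)
  qed
  ultimately show ?thesis
    using assms(2) by blast
qed (use assms in blast)

text \<open>Gram-Schmidt along a countable dense set. A finite result would have a closed and dense span,
contradicting infinite dimension, so the basis can be enumerated by the natural numbers.\<close>

lemma exists_orthonormal_basis_sequence:
  assumes "separable_space (euclidean :: 'a :: chilbert_space topology)"
    and "infinite_dimensional TYPE('a)"
  shows "\<exists>e :: nat \<Rightarrow> 'a. inj e \<and> orthonormal_basis (range e)"
proof -
  obtain D :: "'a set" where D: "countable D" "closure D = UNIV"
    using assms(1) unfolding separable_space_def by auto
  then have "D \<noteq> {}" by auto
  define d where "d = from_nat_into D"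
  have range_d: "range d = D"
    using D \<open>D \<noteq> {}\<close> by (simp add: d_def)
  have "\<exists>G. \<forall>n. (finite (G n) \<and> orthonormal (G n)) \<and>
      (G n \<subseteq> G (Suc n) \<and> d n \<in> complex_vector.span (G (Suc n)))"
  proof (rule dependent_nat_choice)
    show "\<exists>x :: 'a set. finite x \<and> orthonormal x"
      by (rule exI[of _ "{}"]) (simp add: orthonormal_def)
    show "\<exists>y. (finite y \<and> orthonormal y) \<and> x \<subseteq> y \<and> d n \<in> complex_vector.span y"
      if "finite x \<and> orthonormal x" for x n
      using orthonormal_extend_to_span[of x "d n"] that by blast
  qed
  then obtain G where fin: "\<And>n. finite (G n)" and on: "\<And>n. orthonormal (G n)"
    and inc: "\<And>n. G n \<subseteq> G (Suc n)" and dG: "\<And>n. d n \<in> complex_vector.span (G (Suc n))"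
    by auto
  define E where "E = (\<Union>n. G n)"
  have mono: "G m \<subseteq> G n" if "m \<le> n" for m n
    using that inc by (rule lift_Suc_mono_le[of G, rotated])
  have "orthonormal E"
    unfolding orthonormal_def
  proof (intro conjI ballI pairwiseI)
    show "norm e = 1" if "e \<in> E" for e
      using that on unfolding E_def orthonormal_def by auto
    show "cinner e e' = 0" if ee': "e \<in> E" "e' \<in> E" "e \<noteq> e'" for e e'
    proof -
      obtain m n where "e \<in> G m" "e' \<in> G n"
        using ee' by (auto simp: E_def)
      then have "e \<in> G (max m n)" "e' \<in> G (max m n)"
        using mono[of m "max m n"] mono[of n "max m n"] by auto
      then show ?thesis
        using on[of "max m n"] ee'(3) by (simp add: orthonormal_cinner)
    qed
  qed
  have "D \<subseteq> complex_vector.span E"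
    using dG complex_vector.span_mono[of "G _" E] unfolding range_d[symmetric] E_def by blast
  then have dense: "closure (complex_vector.span E) = UNIV"
    using D(2) closure_mono by blast
  have "infinite E"
  proof
    assume "finite E"
    then have "complex_vector.span E = UNIV"
      using closed_span_finite_orthonormal[OF \<open>orthonormal E\<close>] dense by simp
    with \<open>finite E\<close> assms(2) show False
      unfolding infinite_dimensional_def by blast
  qed
  moreover have "countable E"
    unfolding E_def using fin by (simp add: countable_finite)
  ultimately obtain e :: "nat \<Rightarrow> 'a" where "bij_betw e UNIV E"
    using bij_betw_from_nat_into by blast
  then have "inj e" "range e = E"
    by (auto simp: bij_betw_def)
  with \<open>orthonormal E\<close> dense show ?thesis
    unfolding orthonormal_basis_def orthonormal_def by blast
qed

section \<open>Diagonal operators with respect to an orthonormal sequence\<close>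

lemma Bseq_constant: "Bseq (\<lambda>n. z :: 'b :: real_normed_vector)"
  by (rule BseqI'[of _ "norm z"]) simp

lemma Bseq_plus:
  fixes x y :: "nat \<Rightarrow> 'b :: real_normed_vector"
  assumes "Bseq x" "Bseq y"
  shows "Bseq (\<lambda>n. x n + y n)"
proof -
  obtain K L where "\<And>n. norm (x n) \<le> K" "\<And>n. norm (y n) \<le> L"
    using assms by (meson BseqE)
  then show ?thesis
    by (intro BseqI'[of _ "K + L"] norm_triangle_mono)
qed

lemma Bseq_minus:
  fixes x y :: "nat \<Rightarrow> 'b :: real_normed_vector"
  shows "Bseq x \<Longrightarrow> Bseq y \<Longrightarrow> Bseq (\<lambda>n. x n - y n)"
  using Bseq_plus[of x "\<lambda>n. - y n"] by (simp add: Bseq_minus_iff)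

locale orthonormal_basis_sequence =
  fixes e :: "nat \<Rightarrow> 'a :: chilbert_space"
  assumes inj_e: "inj e" and basis_e: "orthonormal_basis (range e)"
begin

text \<open>Vectors are compared and estimated through their Fourier coefficients, and operators through
their action on coefficients; see \<open>coef_eqI\<close>, \<open>norm_le_coefI\<close> and \<open>coef_diag\<close>.\<close>

definition coef :: "'a \<Rightarrow> nat \<Rightarrow> complex" where
  "coef x n = cinner x (e n)"

lemma cinner_basis: "cinner (e m) (e n) = (if m = n then 1 else 0)"
  using basis_e inj_e unfolding orthonormal_basis_def pairwise_def
  by (auto simp: cinner_self inj_eq)

lemma norm_basis [simp]: "norm (e n) = 1"
  using basis_e by (auto simp: orthonormal_basis_def)

lemma coef_basis: "coef (e m) n = (if m = n then 1 else 0)"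
  by (simp add: coef_def cinner_basis)

lemma coef_add [simp]: "coef (x + y) n = coef x n + coef y n"
  and coef_diff [simp]: "coef (x - y) n = coef x n - coef y n"
  and coef_scaleC [simp]: "coef (c *\<^sub>C x) n = c * coef x n"
  and coef_zero [simp]: "coef 0 n = 0"
  and coef_sum: "coef (\<Sum>i\<in>F. f i) n = (\<Sum>i\<in>F. coef (f i) n)"
  by (simp_all add: coef_def cinner_add_left cinner_diff_left cinner_scaleC_left cinner_sum_left)

lemma bounded_linear_coef: "bounded_linear (\<lambda>x. coef x n)"
  unfolding coef_def by (rule bounded_linear_cinner_left)

lemma coef_combination:
  assumes "finite F"
  shows "coef (\<Sum>n\<in>F. a n *\<^sub>C e n) k = (if k \<in> F then a k else 0)"
proof -
  have "coef (\<Sum>n\<in>F. a n *\<^sub>C e n) k = (\<Sum>n\<in>F. if n = k then a k else 0)"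
    unfolding coef_sum by (intro sum.cong refl) (auto simp: coef_basis)
  then show ?thesis using assms by simp
qed

lemma norm_sq_combination:
  assumes "finite F"
  shows "(norm (\<Sum>n\<in>F. a n *\<^sub>C e n))\<^sup>2 = (\<Sum>n\<in>F. (cmod (a n))\<^sup>2)"
proof -
  let ?s = "\<Sum>n\<in>F. a n *\<^sub>C e n"
  have "cinner ?s ?s = (\<Sum>n\<in>F. cnj (a n) * coef ?s n)"
    by (simp add: cinner_sum_right cinner_scaleC_right coef_def)
  also have "\<dots> = (\<Sum>n\<in>F. complex_of_real ((cmod (a n))\<^sup>2))"
    using assms by (intro sum.cong refl)
      (simp only: coef_combination if_True complex_norm_square mult.commute)
  finally show ?thesis
    by (simp only: cinner_self of_real_sum[symmetric] of_real_eq_iff)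
qed

lemma norm_sq_minus_projection:
  assumes "finite F"
  shows "(norm x)\<^sup>2 = (norm (x - (\<Sum>n\<in>F. coef x n *\<^sub>C e n)))\<^sup>2 + (\<Sum>n\<in>F. (cmod (coef x n))\<^sup>2)"
proof -
  let ?s = "\<Sum>n\<in>F. coef x n *\<^sub>C e n"
  have "cinner (x - ?s) ?s = (\<Sum>n\<in>F. cnj (coef x n) * coef (x - ?s) n)"
    by (simp only: cinner_sum_right cinner_scaleC_right coef_def)
  also have "\<dots> = 0"
    using assms by (intro sum.neutral) (auto simp: coef_combination)
  finally have "(norm x)\<^sup>2 = (norm (x - ?s))\<^sup>2 + (norm ?s)\<^sup>2"
    by (rule norm_diff_orthogonal_component)
  then show ?thesis
    using norm_sq_combination[OF assms] by simp
qed

lemma projection_le_norm: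
  assumes "finite F"
  shows "norm (x - (\<Sum>n\<in>F. coef x n *\<^sub>C e n)) \<le> norm x"
proof -
  have "0 \<le> (\<Sum>n\<in>F. (cmod (coef x n))\<^sup>2)"
    by (rule sum_nonneg) (rule zero_le_power2)
  then have "(norm (x - (\<Sum>n\<in>F. coef x n *\<^sub>C e n)))\<^sup>2 \<le> (norm x)\<^sup>2"
    unfolding norm_sq_minus_projection[OF assms, of x] by linarith
  then show ?thesis
    by (rule power2_le_imp_le) (rule norm_ge_zero)
qed

text \<open>Each partial sum of the Fourier series is a contraction that fixes every element of the span of
sufficiently few basis vectors. Hence the series of \<open>x\<close> is eventually at least as close to \<open>x\<close> as
any given element of the span, and these elements are dense.\<close>

lemma expansion_sums: "(\<lambda>n. coef x n *\<^sub>C e n) sums x"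
  unfolding sums_def
proof (rule LIMSEQ_I)
  fix r :: real assume "r > 0"
  let ?P = "\<lambda>N y. \<Sum>n<N. coef y n *\<^sub>C e n"
  have "x \<in> closure (complex_vector.span (range e))"
    using basis_e by (simp add: orthonormal_basis_def)
  then obtain y where "y \<in> complex_vector.span (range e)" "dist y x < r"
    using \<open>r > 0\<close> unfolding closure_approachable by blast
  then have y: "y \<in> complex_vector.span (range e)" "norm (x - y) < r"
    by (simp_all add: dist_norm norm_minus_commute)
  have "\<exists>N. \<forall>M\<ge>N. ?P M y = y"
    using y(1)
  proof (induction rule: complex_vector.span_induct_alt)
    case base
    show ?case by simp
  next
    case (step c b z)
    then obtain k N where k: "b = e k" and N: "\<forall>M\<ge>N. ?P M z = z"
      by auto
    have *: "?P M (c *\<^sub>C b + z) = c *\<^sub>C ?P M b + ?P M z" for M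
      by (simp add: scaleC_add_left sum.distrib complex_vector.scale_sum_right scaleC_scaleC)
    have "?P M b = b" if "M \<ge> Suc k" for M
    proof -
      have "?P M b = (\<Sum>n<M. if n = k then e k else 0)"
        unfolding k by (intro sum.cong refl) (auto simp: coef_basis scaleC_one)
      then show ?thesis using that by (simp add: k)
    qed
    then have "?P M (c *\<^sub>C b + z) = c *\<^sub>C b + z" if "M \<ge> max N (Suc k)" for M
      unfolding * using N that by simp
    then show ?case by blast
  qed
  then obtain N where N: "\<forall>M\<ge>N. ?P M y = y" by blast
  have "norm (?P M x - x) < r" if "M \<ge> N" for M
  proof -
    have eq: "x - ?P M x = (x - y) - ?P M (x - y)"
      using N that by (simp add: complex_vector.scale_left_diff_distrib sum_subtractf)
    have "norm (x - ?P M x) \<le> norm (x - y)"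
      unfolding eq by (rule projection_le_norm) simp
    then show ?thesis
      using y(2) by (simp add: norm_minus_commute)
  qed
  then show "\<exists>no. \<forall>n\<ge>no. norm (?P n x - x) < r" by blast
qed

lemma cinner_sums: "(\<lambda>n. coef x n * cnj (coef y n)) sums cinner x y"
proof -
  have "(\<lambda>n. cinner x (coef y n *\<^sub>C e n)) sums cinner x y"
    by (rule bounded_linear.sums[OF bounded_linear_cinner_right expansion_sums])
  then show ?thesis
    by (simp add: cinner_scaleC_right coef_def mult.commute)
qed

lemma norm_sq_sums: "(\<lambda>n. (cmod (coef x n))\<^sup>2) sums (norm x)\<^sup>2"
proof -
  have "(\<lambda>n. coef x n * cnj (coef x n)) = (\<lambda>n. complex_of_real ((cmod (coef x n))\<^sup>2))"
    by (rule ext) (rule complex_norm_square[symmetric])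
  then have "(\<lambda>n. complex_of_real ((cmod (coef x n))\<^sup>2)) sums complex_of_real ((norm x)\<^sup>2)"
    using cinner_sums[of x x] by (simp only: cinner_self)
  then show ?thesis
    unfolding sums_of_real_iff .
qed

lemma coef_eqI:
  assumes "\<And>n. coef x n = coef y n"
  shows "x = y"
  using expansion_sums[of x] expansion_sums[of y] unfolding assms by (rule sums_unique2)

lemma norm_le_coefI:
  assumes "\<And>n. cmod (coef y n) \<le> C * cmod (coef x n)" "C \<ge> 0"
  shows "norm y \<le> C * norm x"
proof -
  have "(norm y)\<^sup>2 \<le> C\<^sup>2 * (norm x)\<^sup>2"
  proof (rule sums_le[OF _ norm_sq_sums sums_mult[OF norm_sq_sums]])
    show "(cmod (coef y n))\<^sup>2 \<le> C\<^sup>2 * (cmod (coef x n))\<^sup>2" for n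
      using assms(1)[of n] by (metis norm_ge_zero power_mono power_mult_distrib)
  qed
  then show ?thesis
    using assms(2) by (metis mult_nonneg_nonneg norm_ge_zero power2_le_imp_le power_mult_distrib)
qed

lemma norm_ge_coefI:
  assumes "\<And>n. C * cmod (coef x n) \<le> cmod (coef y n)" "C \<ge> 0"
  shows "C * norm x \<le> norm y"
proof -
  have "C\<^sup>2 * (norm x)\<^sup>2 \<le> (norm y)\<^sup>2"
  proof (rule sums_le[OF _ sums_mult[OF norm_sq_sums] norm_sq_sums])
    show "C\<^sup>2 * (cmod (coef x n))\<^sup>2 \<le> (cmod (coef y n))\<^sup>2" for n
      using power_mono[OF assms(1)[of n], of 2] assms(2) by (simp add: power_mult_distrib)
  qed
  then show ?thesis
    by (metis norm_ge_zero power2_le_imp_le power_mult_distrib)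
qed

lemma summable_square_summable_combination:
  assumes "summable (\<lambda>n. (cmod (a n))\<^sup>2)"
  shows "summable (\<lambda>n. a n *\<^sub>C e n)"
  unfolding summable_Cauchy
proof (intro allI impI)
  fix r :: real assume "r > 0"
  then obtain N where N: "\<forall>m\<ge>N. \<forall>n. norm (\<Sum>k=m..<n. (cmod (a k))\<^sup>2) < r\<^sup>2"
    using assms unfolding summable_Cauchy by (meson zero_less_power)
  have "norm (\<Sum>k=m..<n. a k *\<^sub>C e k) < r" if "m \<ge> N" for m n
  proof -
    have "(norm (\<Sum>k=m..<n. a k *\<^sub>C e k))\<^sup>2 < r\<^sup>2"
      using N that by (auto simp: norm_sq_combination abs_less_iff)
    then show ?thesis
      using \<open>r > 0\<close> by (meson less_imp_le power_less_imp_less_base)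
  qed
  then show "\<exists>N. \<forall>m\<ge>N. \<forall>n. norm (\<Sum>k=m..<n. a k *\<^sub>C e k) < r" by blast
qed

lemma coef_square_summable_combination:
  assumes "summable (\<lambda>n. (cmod (a n))\<^sup>2)"
  shows "coef (\<Sum>n. a n *\<^sub>C e n) k = a k"
proof -
  have "(\<lambda>n. coef (a n *\<^sub>C e n) k) sums coef (\<Sum>n. a n *\<^sub>C e n) k"
    by (intro bounded_linear.sums[OF bounded_linear_coef] summable_sums
        summable_square_summable_combination assms)
  moreover have "(\<lambda>n. coef (a n *\<^sub>C e n) k) = (\<lambda>n. if n = k then a n else 0)"
    by (auto simp: coef_basis)
  ultimately show ?thesis
    using sums_single[of k a] sums_unique2 by metis
qed

text \<open>For unbounded \<open>c\<close> this is a junk value, hence the assumption \<open>Bseq c\<close> in the lemmas below.\<close>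

definition diag :: "(nat \<Rightarrow> complex) \<Rightarrow> ('a \<Rightarrow>\<^sub>L 'a)" where
  "diag c = Blinfun (\<lambda>x. \<Sum>n. (c n * coef x n) *\<^sub>C e n)"

lemma coef_diag [simp]:
  assumes "Bseq c"
  shows "coef (blinfun_apply (diag c) x) n = c n * coef x n"
proof -
  obtain C where C: "C > 0" "\<And>n. cmod (c n) \<le> C"
    using assms by (meson BseqE)
  define f where "f x = (\<Sum>n. (c n * coef x n) *\<^sub>C e n)" for x
  have coef: "coef (f x) n = c n * coef x n" for x n
    unfolding f_def
  proof (rule coef_square_summable_combination)
    have "summable (\<lambda>n. C\<^sup>2 * (cmod (coef x n))\<^sup>2)"
      using norm_sq_sums by (intro summable_mult) (rule sums_summable)
    then show "summable (\<lambda>n. (cmod (c n * coef x n))\<^sup>2)"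
    proof (rule summable_comparison_test')
      show "norm ((cmod (c n * coef x n))\<^sup>2) \<le> C\<^sup>2 * (cmod (coef x n))\<^sup>2" for n
        using C by (simp add: norm_mult power_mult_distrib mult_right_mono power_mono)
    qed
  qed
  have "bounded_linear f"
  proof (rule bounded_linear_intro[where K = C])
    show "f (x + y) = f x + f y" for x y
      by (rule coef_eqI) (simp only: coef coef_add ring_distribs)
    show "f (r *\<^sub>R x) = r *\<^sub>R f x" for r x
      by (rule coef_eqI) (simp only: coef scaleR_scaleC coef_scaleC mult.left_commute)
    show "norm (f x) \<le> norm x * C" for x
      using norm_le_coefI[of "f x" C x] C
      by (simp add: coef norm_mult mult_right_mono mult.commute)
  qed
  then show ?thesis
    unfolding diag_def f_def[symmetric] by (simp add: bounded_linear_Blinfun_apply coef)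
qed

lemma operator_eqI:
  fixes A B :: "'a \<Rightarrow>\<^sub>L 'a"
  assumes "\<And>x n. coef (blinfun_apply A x) n = coef (blinfun_apply B x) n"
  shows "A = B"
  using assms by (intro blinfun_eqI coef_eqI)

lemma norm_diag_le:
  assumes "\<And>n. cmod (c n) \<le> C"
  shows "norm (diag c) \<le> C"
proof -
  have "C \<ge> 0"
    using assms[of 0] norm_ge_zero order_trans by blast
  moreover have "Bseq c"
    using assms by (rule BseqI')
  ultimately show ?thesis
    by (intro norm_blinfun_bound norm_le_coefI) (simp_all add: norm_mult assms mult_right_mono)
qed

lemma diag_bounded_operator: "Bseq c \<Longrightarrow> diag c \<in> bounded_operators"
  unfolding bounded_operators_def by (auto intro!: coef_eqI)

lemma diag_basis: "Bseq c \<Longrightarrow> blinfun_apply (diag c) (e n) = c n *\<^sub>C e n"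
  by (rule coef_eqI) (auto simp: coef_basis)

lemma diagonal_wrt_diag: "Bseq c \<Longrightarrow> diagonal_wrt (range e) (diag c)"
  unfolding diagonal_wrt_def using diag_basis by blast

lemma diag_add: "Bseq c \<Longrightarrow> Bseq d \<Longrightarrow> diag c + diag d = diag (\<lambda>n. c n + d n)"
  by (rule operator_eqI) (simp add: blinfun.add_left Bseq_plus algebra_simps)

lemma diag_diff: "Bseq c \<Longrightarrow> Bseq d \<Longrightarrow> diag c - diag d = diag (\<lambda>n. c n - d n)"
  by (rule operator_eqI) (simp add: blinfun.diff_left Bseq_minus algebra_simps)

lemma diag_compose: "Bseq c \<Longrightarrow> Bseq d \<Longrightarrow> diag c o\<^sub>L diag d = diag (\<lambda>n. c n * d n)"
  by (rule operator_eqI) (simp add: Bseq_mult)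

lemma op_scaleC_apply: "blinfun_apply (op_scaleC z A) x = z *\<^sub>C blinfun_apply A x"
  unfolding op_scaleC_def
  by (simp add: bounded_linear_Blinfun_apply
      bounded_linear_compose[OF bounded_linear_scaleC blinfun.bounded_linear_right])

lemma op_scaleC_diag: "Bseq c \<Longrightarrow> op_scaleC z (diag c) = diag (\<lambda>n. z * c n)"
  by (rule operator_eqI) (simp add: op_scaleC_apply Bseq_mult)

lemma diag_one: "diag (\<lambda>n. 1) = id_blinfun"
  by (rule operator_eqI) (simp add: Bseq_constant)

lemma self_adjoint_diag:
  assumes "Bseq c" "\<And>n. c n \<in> \<real>"
  shows "self_adjoint (diag c)"
  unfolding self_adjoint_def
proof (intro allI)
  fix x y
  have "(\<lambda>n. c n * coef x n * cnj (coef y n)) sums cinner (blinfun_apply (diag c) x) y"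
    using cinner_sums[of "blinfun_apply (diag c) x" y] assms by simp
  moreover have "(\<lambda>n. c n * coef x n * cnj (coef y n)) sums cinner x (blinfun_apply (diag c) y)"
    using cinner_sums[of x "blinfun_apply (diag c) y"] assms
    by (simp add: Reals_cnj_iff mult.assoc mult.left_commute)
  ultimately show "cinner (blinfun_apply (diag c) x) y = cinner x (blinfun_apply (diag c) y)"
    by (rule sums_unique2)
qed

lemma positive_op_diag:
  assumes "Bseq c" "\<And>n. c n \<ge> 0"
  shows "positive_op (diag (\<lambda>n. complex_of_real (c n)))"
  unfolding positive_op_def
proof
  fix x
  have B: "Bseq (\<lambda>n. complex_of_real (c n))"
    using assms(1) by (simp add: Bseq_def)
  define z where "z = cinner (blinfun_apply (diag (\<lambda>n. complex_of_real (c n))) x) x"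
  have "(\<lambda>n. complex_of_real (c n) * coef x n * cnj (coef x n)) sums z"
    unfolding z_def using cinner_sums[of "blinfun_apply (diag (\<lambda>n. complex_of_real (c n))) x" x]
    by (simp only: coef_diag[OF B])
  moreover have "complex_of_real (c n) * coef x n * cnj (coef x n) =
      complex_of_real (c n * (cmod (coef x n))\<^sup>2)" for n
    unfolding of_real_mult mult.assoc complex_norm_square ..
  ultimately have S: "(\<lambda>n. complex_of_real (c n * (cmod (coef x n))\<^sup>2)) sums z"
    by (simp only:)
  have Re: "(\<lambda>n. c n * (cmod (coef x n))\<^sup>2) sums Re z" and Im: "(\<lambda>n. 0) sums Im z"
    using sums_Re[OF S] sums_Im[OF S] by (simp_all only: Re_complex_of_real Im_complex_of_real)
  have "0 \<le> Re z"
    by (rule sums_le[OF _ sums_zero Re]) (simp add: assms(2))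
  moreover have "Im z = 0"
    by (rule sums_unique2[OF Im sums_zero])
  ultimately show "cinner (blinfun_apply (diag (\<lambda>n. complex_of_real (c n))) x) x \<in> \<real>\<^sub>\<ge>\<^sub>0"
    unfolding z_def[symmetric] by (simp add: complex_nonneg_Reals_iff)
qed

subsection \<open>Spectrum and functional calculus\<close>

text \<open>Off the closure of the eigenvalues the inverse is the diagonal operator of the reciprocals, which
are bounded. On the closure an inverse \<open>R\<close> would have to send some vector \<open>(c n - z) e n\<close> of norm less than
\<open>1 / \<parallel>R\<parallel>\<close> to the unit vector \<open>e n\<close>.\<close>

lemma spectrum_diag:
  assumes "Bseq c"
  shows "spectrum (diag c) = closure (range c)"
proof -
  have shift: "diag c - op_scaleC z id_blinfun = diag (\<lambda>n. c n - z)" for z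
    using assms by (simp add: diag_one[symmetric] op_scaleC_diag diag_diff Bseq_constant)
  have B: "Bseq (\<lambda>n. c n - z)" for z
    using assms by (simp add: Bseq_minus Bseq_constant)
  have "z \<in> spectrum (diag c)" if z: "z \<in> closure (range c)" for z
  proof (rule ccontr)
    assume "z \<notin> spectrum (diag c)"
    then obtain R where R: "R o\<^sub>L diag (\<lambda>n. c n - z) = id_blinfun"
      unfolding spectrum_def shift by auto
    have "1 / (norm R + 1) > 0"
      by (simp add: add_nonneg_pos)
    then obtain n where n: "dist (c n) z < 1 / (norm R + 1)"
      using z unfolding closure_approachable by blast
    have "e n = blinfun_apply R (blinfun_apply (diag (\<lambda>n. c n - z)) (e n))"
      by (metis R blinfun_apply_blinfun_compose blinfun_apply_id_blinfun)
    then have "1 = norm (blinfun_apply R ((c n - z) *\<^sub>C e n))"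
      using norm_basis[of n] diag_basis[OF B, of z n] by simp
    also have "\<dots> \<le> norm R * cmod (c n - z)"
      using norm_blinfun[of R "(c n - z) *\<^sub>C e n"] by (simp add: norm_scaleC)
    also have "norm R * cmod (c n - z) \<le> norm R * (1 / (norm R + 1))"
      using n by (intro mult_left_mono) (auto simp: dist_norm)
    also have "\<dots> < 1"
      using \<open>1 / (norm R + 1) > 0\<close> by (simp add: divide_less_eq)
    finally show False by simp
  qed
  moreover have "z \<notin> spectrum (diag c)" if z: "z \<notin> closure (range c)" for z
  proof -
    obtain r where r: "r > 0" "\<And>n. r \<le> cmod (c n - z)"
      using z unfolding closure_approachable by (auto simp: not_less dist_norm)
    have nz: "c n - z \<noteq> 0" for n
      using r(1) r(2)[of n] by auto
    define d where "d = (\<lambda>n. inverse (c n - z))"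
    have d: "Bseq d"
    proof (rule BseqI')
      show "norm (d n) \<le> inverse r" for n
        unfolding d_def norm_inverse using r by (intro le_imp_inverse_le)
    qed
    have "diag (\<lambda>n. c n - z) o\<^sub>L diag d = id_blinfun" "diag d o\<^sub>L diag (\<lambda>n. c n - z) = id_blinfun"
      using nz by (simp_all add: diag_compose B d diag_one[symmetric]) (simp_all add: d_def)
    then show ?thesis
      unfolding spectrum_def shift using diag_bounded_operator[OF d] by blast
  qed
  ultimately show ?thesis by blast
qed

lemma Bseq_poly:
  assumes "Bseq c"
  shows "Bseq (\<lambda>n. poly p (c n :: complex))"
proof (induction p)
  case 0
  show ?case by (simp add: Bseq_constant)
next
  case (pCons a p)
  then show ?case
    by (simp add: Bseq_plus Bseq_constant Bseq_mult assms)
qed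

text \<open>Polynomials act on the eigenvalues, since a power of the operator multiplies each coefficient by
the same power of the eigenvalue.\<close>

lemma op_poly_diag:
  assumes "Bseq c"
  shows "op_poly p (diag c) = diag (\<lambda>n. poly p (c n))"
proof -
  have power: "coef ((blinfun_apply (diag c) ^^ i) x) n = c n ^ i * coef x n" for i x n
    using assms by (induction i) auto
  have "(\<lambda>x. \<Sum>i\<le>degree p. coeff p i *\<^sub>C (blinfun_apply (diag c) ^^ i) x) =
      blinfun_apply (diag (\<lambda>n. poly p (c n)))"
  proof (intro ext coef_eqI)
    fix x n
    show "coef (\<Sum>i\<le>degree p. coeff p i *\<^sub>C (blinfun_apply (diag c) ^^ i) x) n =
        coef (blinfun_apply (diag (\<lambda>n. poly p (c n))) x) n"
      unfolding coef_diag[OF Bseq_poly[OF assms]]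
      by (simp add: coef_sum power poly_altdef sum_distrib_right mult.assoc)
  qed
  then show ?thesis
    unfolding op_poly_def by (simp add: blinfun_apply_inverse)
qed

end

lemma Weierstrass_real_poly:
  fixes g :: "real \<Rightarrow> real"
  assumes "compact S" "continuous_on S g" "\<epsilon> > 0"
  shows "\<exists>p. \<forall>t\<in>S. \<bar>g t - poly p t\<bar> < \<epsilon>"
proof -
  obtain h where h: "real_polynomial_function h" "\<And>t. t \<in> S \<Longrightarrow> \<bar>g t - h t\<bar> < \<epsilon>"
    using Stone_Weierstrass_real_polynomial_function[OF assms] by auto
  then obtain a n where "h = (\<lambda>x. \<Sum>i\<le>n. a i * x ^ i)"
    unfolding real_polynomial_function_iff_sum by blast
  then have "h = poly (\<Sum>i\<le>n. monom (a i) i)"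
    by (auto simp: poly_sum poly_monom)
  with h(2) show ?thesis by blast
qed

lemma Weierstrass_complex_poly:
  fixes f :: "real \<Rightarrow> complex"
  assumes "compact S" "continuous_on S f" "\<epsilon> > 0"
  shows "\<exists>p. \<forall>t\<in>S. cmod (poly p (complex_of_real t) - f t) < \<epsilon>"
proof -
  obtain p q :: "real poly" where p: "\<And>t. t \<in> S \<Longrightarrow> \<bar>Re (f t) - poly p t\<bar> < \<epsilon> / 2"
    and q: "\<And>t. t \<in> S \<Longrightarrow> \<bar>Im (f t) - poly q t\<bar> < \<epsilon> / 2"
    using Weierstrass_real_poly[of S "\<lambda>t. Re (f t)" "\<epsilon> / 2"]
      Weierstrass_real_poly[of S "\<lambda>t. Im (f t)" "\<epsilon> / 2"] assms continuous_on_Re continuous_on_Im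
    by (metis half_gt_zero)
  have poly_of_real: "poly (map_poly complex_of_real p) (complex_of_real t) = complex_of_real (poly p t)"
    for p t
    by (simp add: poly_altdef degree_map_poly coeff_map_poly)
  define P where "P = map_poly complex_of_real p + smult \<i> (map_poly complex_of_real q)"
  have "cmod (poly P (complex_of_real t) - f t) < \<epsilon>" if "t \<in> S" for t
  proof -
    have "poly P (complex_of_real t) = Complex (poly p t) (poly q t)"
      by (simp add: P_def poly_of_real complex_eq_iff)
    then have "cmod (poly P (complex_of_real t) - f t) \<le> \<bar>poly p t - Re (f t)\<bar> + \<bar>poly q t - Im (f t)\<bar>"
      using cmod_le[of "poly P (complex_of_real t) - f t"] by simp
    also have "\<dots> < \<epsilon>"
      using p[OF that] q[OF that] by (simp add: abs_minus_commute)
    finally show ?thesis .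
  qed
  then show ?thesis by blast
qed

context orthonormal_basis_sequence
begin

text \<open>If \<open>p\<close> is uniformly close to \<open>f\<close> on the spectrum, then \<open>p\<close> of the operator is close in norm
to the diagonal operator with entries \<open>f (a n)\<close>, because the eigenvalues belong to the spectrum.
Weierstrass approximation provides such \<open>p\<close>, and closeness for all \<open>\<epsilon>\<close> leaves no other limit.\<close>

lemma fun_calc_diag:
  fixes a :: "nat \<Rightarrow> real"
  assumes a: "\<And>n. \<bar>a n\<bar> \<le> r" and f: "continuous_on UNIV f"
  shows "fun_calc f (diag (\<lambda>n. complex_of_real (a n))) = diag (\<lambda>n. f (a n))"
proof -
  let ?A = "diag (\<lambda>n. complex_of_real (a n))"
  have B: "Bseq (\<lambda>n. complex_of_real (a n))"
    using a by (intro BseqI'[of _ r]) simp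
  have spec: "spectrum ?A = closure (range (\<lambda>n. complex_of_real (a n)))"
    by (rule spectrum_diag[OF B])
  have spec_a: "complex_of_real (a n) \<in> spectrum ?A" for n
    unfolding spec by (rule subsetD[OF closure_subset]) (rule rangeI)
  have spec_r: "\<bar>t\<bar> \<le> r" if "complex_of_real t \<in> spectrum ?A" for t
  proof -
    have "closure (range (\<lambda>n. complex_of_real (a n))) \<subseteq> cball 0 r"
      using a by (intro closure_minimal) auto
    then have "complex_of_real t \<in> cball 0 r"
      using that unfolding spec by (rule subsetD)
    then show ?thesis by simp
  qed
  have fB: "Bseq (\<lambda>n. f (a n))"
  proof -
    have "bounded (f ` {-r..r})"
      by (intro compact_imp_bounded compact_continuous_image continuous_on_subset[OF f]) simp_all
    then obtain K where "\<And>t. t \<in> {-r..r} \<Longrightarrow> norm (f t) \<le> K"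
      unfolding bounded_iff by blast
    moreover have "a n \<in> {-r..r}" for n
      using a[of n] by (simp add: abs_le_iff)
    ultimately show ?thesis by (intro BseqI'[of _ K]) simp
  qed
  define L where "L B = (\<forall>\<epsilon>>0. \<exists>p.
      (\<forall>t. complex_of_real t \<in> spectrum ?A \<longrightarrow> norm (poly p (complex_of_real t) - f t) < \<epsilon>) \<and>
      norm (op_poly p ?A - B) < \<epsilon>)" for B
  have close: "norm (op_poly p ?A - diag (\<lambda>n. f (a n))) \<le> \<epsilon>"
    if "\<And>t. complex_of_real t \<in> spectrum ?A \<Longrightarrow> norm (poly p (complex_of_real t) - f t) < \<epsilon>" for p \<epsilon>
  proof -
    have "op_poly p ?A - diag (\<lambda>n. f (a n)) = diag (\<lambda>n. poly p (complex_of_real (a n)) - f (a n))"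
      by (simp add: op_poly_diag[OF B] diag_diff Bseq_poly[OF B] fB)
    moreover have "cmod (poly p (complex_of_real (a n)) - f (a n)) \<le> \<epsilon>" for n
      using that[OF spec_a[of n]] by (rule less_imp_le)
    ultimately show ?thesis
      by (simp only: norm_diag_le)
  qed
  have "L (diag (\<lambda>n. f (a n)))"
    unfolding L_def
  proof (intro allI impI)
    fix \<epsilon> :: real assume "\<epsilon> > 0"
    then have "\<epsilon> / 2 > 0" by simp
    then obtain p where p: "\<forall>t\<in>{-r..r}. cmod (poly p (complex_of_real t) - f t) < \<epsilon> / 2"
      using Weierstrass_complex_poly[OF compact_Icc continuous_on_subset[OF f subset_UNIV]] by blast
    then have p': "cmod (poly p (complex_of_real t) - f t) < \<epsilon> / 2"
      if "complex_of_real t \<in> spectrum ?A" for t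
      using p spec_r[OF that] by (simp add: abs_le_iff)
    have "norm (op_poly p ?A - diag (\<lambda>n. f (a n))) < \<epsilon>"
      using close[OF p'] \<open>\<epsilon> > 0\<close> by simp
    moreover have "cmod (poly p (complex_of_real t) - f t) < \<epsilon>"
      if "complex_of_real t \<in> spectrum ?A" for t
      using p'[OF that] \<open>\<epsilon> > 0\<close> by simp
    ultimately show "\<exists>p. (\<forall>t. complex_of_real t \<in> spectrum ?A \<longrightarrow>
        norm (poly p (complex_of_real t) - f t) < \<epsilon>) \<and> norm (op_poly p ?A - diag (\<lambda>n. f (a n))) < \<epsilon>"
      by blast
  qed
  moreover have "B = diag (\<lambda>n. f (a n))" if LB: "L B" for B
  proof (rule ccontr)
    assume "B \<noteq> diag (\<lambda>n. f (a n))"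
    then have pos: "norm (B - diag (\<lambda>n. f (a n))) / 2 > 0" by simp
    then obtain p where
      p: "\<And>t. complex_of_real t \<in> spectrum ?A \<Longrightarrow>
        norm (poly p (complex_of_real t) - f t) < norm (B - diag (\<lambda>n. f (a n))) / 2"
      and "norm (op_poly p ?A - B) < norm (B - diag (\<lambda>n. f (a n))) / 2"
      using LB unfolding L_def by blast
    moreover have "norm (B - diag (\<lambda>n. f (a n))) \<le>
        norm (op_poly p ?A - B) + norm (op_poly p ?A - diag (\<lambda>n. f (a n)))"
      using norm_triangle_ineq4[of "op_poly p ?A - diag (\<lambda>n. f (a n))" "op_poly p ?A - B"]
      by simp
    ultimately show False
      using close[OF p] by simp
  qed
  ultimately show ?thesis
    unfolding fun_calc_def L_def[symmetric] by (rule the_equality)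
qed

end

section \<open>Singular numbers and Dixmier traces of diagonal operators\<close>

lemma singular_number_le:
  assumes "F \<in> bounded_operators" "rank_less F k"
  shows "singular_number A k \<le> norm (A - F)"
  unfolding singular_number_def
  by (rule cInf_lower) (use assms in \<open>auto intro: bdd_belowI[of _ 0]\<close>)

lemma sum_le_sum_same_card:
  fixes f :: "'b \<Rightarrow> real"
  assumes "finite A" "finite B" "card A = card B" "\<And>a b. a \<in> A \<Longrightarrow> b \<in> B \<Longrightarrow> f a \<le> f b"
  shows "sum f A \<le> sum f B"
proof -
  obtain h where "bij_betw h A B"
    using assms(1-3) finite_same_card_bij by blast
  then have "sum f B = (\<Sum>a\<in>A. f (h a))"
    by (rule sum.reindex_bij_betw[symmetric])
  moreover have "f a \<le> f (h a)" if "a \<in> A" for a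
    using \<open>bij_betw h A B\<close> that by (intro assms(4)) (auto simp: bij_betw_def)
  ultimately show ?thesis
    by (simp add: sum_mono)
qed

text \<open>This is what makes a greedy choice of the largest remaining entry possible.\<close>

lemma null_sequence_attains_max_off_finite:
  fixes c :: "nat \<Rightarrow> real"
  assumes "\<And>n. c n \<ge> 0" "c \<longlonglongrightarrow> 0" "finite T"
  shows "\<exists>m. m \<notin> T \<and> (\<forall>j. j \<notin> T \<longrightarrow> c j \<le> c m)"
proof (cases "\<exists>j. j \<notin> T \<and> c j > 0")
  case True
  then obtain j where j: "j \<notin> T" "c j > 0" by blast
  have "eventually (\<lambda>i. c i < c j) sequentially"
    using order_tendstoD(2)[OF assms(2) j(2)] .
  then obtain N where N: "\<And>i. i \<ge> N \<Longrightarrow> c i < c j"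
    by (auto simp: eventually_sequentially)
  define S where "S = {i. i \<notin> T \<and> c j \<le> c i}"
  have "S \<subseteq> {..<N}"
    using N by (force simp: S_def not_le[symmetric])
  then have "finite S"
    by (rule finite_subset) simp
  moreover have "j \<in> S"
    using j by (simp add: S_def)
  ultimately have "Max (c ` S) \<in> c ` S"
    by (intro Max_in) auto
  then obtain m where m: "m \<in> S" "c m = Max (c ` S)" by auto
  have "c i \<le> c m" if "i \<notin> T" for i
  proof (cases "i \<in> S")
    case True
    then show ?thesis
      using \<open>finite S\<close> by (simp add: m(2))
  next
    case False
    then have "c i < c j"
      using that by (simp add: S_def)
    also have "c j \<le> c m"
      using m(1) by (simp add: S_def)
    finally show ?thesis by simp
  qed
  then show ?thesis
    using m(1) by (auto simp: S_def)
next
  case False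
  obtain m where "m \<notin> T"
    using ex_new_if_finite[OF infinite_UNIV_nat assms(3)] by blast
  moreover have "c j \<le> c m" if "j \<notin> T" for j
    using False that assms(1)[of m] by force
  ultimately show ?thesis by blast
qed

text \<open>The harmonic numbers are the partial sums of the comparison sequence \<open>1 / (n + 1)\<close>.\<close>

lemma harm_minus_ln_bounds: "ln (real n + 1) \<le> harm n" "harm n \<le> ln (real n + 1) + 1"
proof -
  show "ln (real n + 1) \<le> harm n"
    by (rule ln_le_harm)
  show "harm n \<le> ln (real n + 1) + 1"
  proof (cases "n = 0")
    case False
    then have "harm n - ln (real n) \<le> harm 1 - ln (real 1)"
      by (intro euler_mascheroni_sequence_decreasing) auto
    moreover have "ln (real n) \<le> ln (real n + 1)"
      using False by simp
    ultimately show ?thesis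
      by (simp add: harm_def)
  qed (simp add: harm_def)
qed

text \<open>A convergent sequence is a constant sequence plus a null sequence. So a trace is known without
reference to the particular \<open>\<omega>\<close> as soon as the logarithmic averages converge.\<close>

lemma state_of_convergent:
  assumes \<omega>: "dilation_invariant_state \<omega>" "vanishes_on_null_sequences \<omega>"
    and x: "x \<longlonglongrightarrow> l"
  shows "\<omega> x = l"
proof -
  have null: "(\<lambda>i. x i - l) \<longlonglongrightarrow> 0"
    using x by (simp add: LIM_zero)
  have add: "\<omega> (\<lambda>i. u i + v i) = \<omega> u + \<omega> v" if "Bseq u" "Bseq v" for u v
    using \<omega>(1) that unfolding dilation_invariant_state_def by blast
  have scale: "\<omega> (\<lambda>i. c * u i) = c * \<omega> u" if "Bseq u" for c u
    using \<omega>(1) that unfolding dilation_invariant_state_def by blast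
  have one: "\<omega> (\<lambda>i. 1) = 1"
    using \<omega>(1) unfolding dilation_invariant_state_def by blast
  have "\<omega> (\<lambda>i. (x i - l) + l) = \<omega> (\<lambda>i. x i - l) + \<omega> (\<lambda>i. l)"
    using convergent_imp_Bseq[OF convergentI[OF null]] by (rule add) (rule Bseq_constant)
  moreover have "\<omega> (\<lambda>i. l) = l"
    using scale[OF Bseq_constant[of 1], of l] one by simp
  moreover have "\<omega> (\<lambda>i. x i - l) = 0"
    using \<omega>(2) null unfolding vanishes_on_null_sequences_def by blast
  ultimately show ?thesis by simp
qed

lemma log_average_limit:
  fixes a :: "nat \<Rightarrow> real"
  assumes "\<And>n. \<bar>a n - L * ln (real n + 1)\<bar> \<le> K"
  shows "(\<lambda>n. a n / ln (real n + 1)) \<longlonglongrightarrow> L"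
proof -
  have at_top: "filterlim (\<lambda>n. ln (real n + 1)) at_top sequentially"
  proof (rule filterlim_compose[OF ln_at_top])
    show "filterlim (\<lambda>n. real n + 1) at_top sequentially"
      using filterlim_compose[OF filterlim_real_sequentially filterlim_Suc] by (simp add: add.commute)
  qed
  have "(\<lambda>n. (a n - L * ln (real n + 1)) / ln (real n + 1)) \<longlonglongrightarrow> 0"
  proof (rule Lim_null_comparison)
    show "(\<lambda>n. K / ln (real n + 1)) \<longlonglongrightarrow> 0"
      by (rule real_tendsto_divide_at_top[OF tendsto_const at_top])
    show "eventually (\<lambda>n. norm ((a n - L * ln (real n + 1)) / ln (real n + 1)) \<le> K / ln (real n + 1))
        sequentially"
      using assms by (auto intro!: always_eventually divide_right_mono simp: abs_of_nonneg)
  qed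
  then have "(\<lambda>n. (a n - L * ln (real n + 1)) / ln (real n + 1) + L) \<longlonglongrightarrow> 0 + L"
    by (intro tendsto_add tendsto_const)
  moreover have "eventually (\<lambda>n. (a n - L * ln (real n + 1)) / ln (real n + 1) + L =
      a n / ln (real n + 1)) sequentially"
    using eventually_gt_at_top[of 0] by eventually_elim (simp add: field_simps)
  ultimately show ?thesis
    by (simp add: tendsto_cong)
qed

context orthonormal_basis_sequence
begin

lemma rank_less_diag:
  assumes "Bseq c" "finite T" "card T < k" "\<And>n. n \<notin> T \<Longrightarrow> c n = 0"
  shows "rank_less (diag c) k"
  unfolding rank_less_def
proof (intro exI[of _ "e ` T"] conjI subsetI)
  show "finite (e ` T)" "card (e ` T) < k"
    using assms inj_e by (simp_all add: card_image inj_on_subset[of e UNIV])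
  fix y assume "y \<in> range (blinfun_apply (diag c))"
  then obtain x where y: "y = blinfun_apply (diag c) x" by blast
  have y_sum: "y = (\<Sum>n\<in>T. (c n * coef x n) *\<^sub>C e n)"
    unfolding y using assms by (intro coef_eqI) (simp add: coef_combination)
  show "y \<in> complex_vector.span (e ` T)"
    unfolding y_sum by (intro complex_vector.span_sum complex_vector.span_scale complex_vector.span_base imageI)
qed

lemma singular_number_diag_le:
  assumes "Bseq c" "finite T" "card T < k" "\<And>n. n \<notin> T \<Longrightarrow> cmod (c n) \<le> t"
  shows "singular_number (diag c) k \<le> t"
proof -
  obtain K where K: "\<And>n. cmod (c n) \<le> K" "K > 0"
    using assms(1) by (meson BseqE)
  define d where "d n = (if n \<in> T then c n else 0)" for n
  have d: "Bseq d"
    using K by (intro BseqI'[of _ K]) (simp add: d_def)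
  obtain m where "m \<notin> T"
    using ex_new_if_finite[OF infinite_UNIV_nat assms(2)] by blast
  then have "t \<ge> 0"
    using assms(4)[of m] norm_ge_zero[of "c m"] by linarith
  have "singular_number (diag c) k \<le> norm (diag c - diag d)"
    using assms(2,3) by (intro singular_number_le diag_bounded_operator d rank_less_diag[of _ T]) (auto simp: d_def)
  also have "diag c - diag d = diag (\<lambda>n. c n - d n)"
    by (rule diag_diff[OF assms(1) d])
  also have "norm \<dots> \<le> t"
    using assms(4) \<open>t \<ge> 0\<close> by (intro norm_diag_le) (simp add: d_def)
  finally show ?thesis .
qed

text \<open>An operator of rank less than \<open>k\<close> cannot be injective on the span of \<open>k\<close> basis vectors. The
images of these vectors need not be distinct, and then the difference of two of them is in the
kernel; otherwise too many distinct vectors lie in a small span and are linearly dependent.\<close>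

lemma low_rank_kernel_meets_span:
  assumes F: "F \<in> bounded_operators" "rank_less F k" and T: "finite T" "card T \<ge> k"
  shows "\<exists>a. (\<exists>n\<in>T. a n \<noteq> 0) \<and> blinfun_apply F (\<Sum>n\<in>T. a n *\<^sub>C e n) = 0"
proof -
  let ?f = "\<lambda>n. blinfun_apply F (e n)"
  have F_sum: "blinfun_apply F (\<Sum>n\<in>T. a n *\<^sub>C e n) = (\<Sum>n\<in>T. a n *\<^sub>C ?f n)" for a
    using F(1) by (simp add: blinfun.sum_right bounded_operators_def)
  show ?thesis
  proof (cases "inj_on ?f T")
    case True
    obtain B where B: "finite B" "card B < k" "range (blinfun_apply F) \<subseteq> complex_vector.span B"
      using F(2) unfolding rank_less_def by blast
    have "complex_vector.dependent (?f ` T)"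
    proof (rule ccontr)
      assume "\<not> complex_vector.dependent (?f ` T)"
      then have "card (?f ` T) \<le> card B"
        using B complex_vector.independent_span_bound[of B "?f ` T"] by blast
      then show False
        using True B(2) T(2) by (simp add: card_image)
    qed
    then obtain u where u: "\<exists>v\<in>?f ` T. u v \<noteq> 0" "(\<Sum>v\<in>?f ` T. u v *\<^sub>C v) = 0"
      using complex_vector.dependent_finite[of "?f ` T"] T(1) by auto
    have "(\<Sum>n\<in>T. u (?f n) *\<^sub>C ?f n) = 0"
      using u(2) sum.reindex[OF True, of "\<lambda>v. u v *\<^sub>C v"] by simp
    then show ?thesis
      using u(1) by (intro exI[of _ "\<lambda>n. u (?f n)"]) (auto simp: F_sum)
  next
    case False
    then obtain m n where mn: "m \<in> T" "n \<in> T" "m \<noteq> n" "?f m = ?f n"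
      by (auto simp: inj_on_def)
    define a :: "nat \<Rightarrow> complex" where "a i = (if i = m then 1 else if i = n then -1 else 0)" for i
    have "(\<Sum>i\<in>T. a i *\<^sub>C ?f i) = (\<Sum>i\<in>{m, n}. a i *\<^sub>C ?f i)"
      using mn T(1) by (intro sum.mono_neutral_right) (auto simp: a_def)
    also have "\<dots> = 0"
      using mn by (simp add: a_def scaleC_one)
    finally show ?thesis
      using mn by (intro exI[of _ a]) (auto simp: F_sum a_def)
  qed
qed

text \<open>The lower half of the min-max principle: an approximating operator of low rank annihilates a vector
in the span of the given \<open>k\<close> basis vectors, which the diagonal operator stretches by at least \<open>t\<close>.\<close>

lemma singular_number_diag_ge:
  assumes "Bseq c" "finite T" "card T \<ge> k" "k > 0" "t \<ge> 0" "\<And>n. n \<in> T \<Longrightarrow> t \<le> cmod (c n)"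
  shows "t \<le> singular_number (diag c) k"
  unfolding singular_number_def
proof (rule cInf_greatest)
  have "0 \<in> (bounded_operators :: ('a \<Rightarrow>\<^sub>L 'a) set)" "rank_less (0 :: 'a \<Rightarrow>\<^sub>L 'a) k"
    using assms(4) by (auto simp: bounded_operators_def rank_less_def intro!: exI[of _ "{}"])
  then show "{norm (diag c - F) |F. F \<in> bounded_operators \<and> rank_less F k} \<noteq> {}"
    by blast
  fix s assume "s \<in> {norm (diag c - F) |F. F \<in> bounded_operators \<and> rank_less F k}"
  then obtain F where F: "F \<in> bounded_operators" "rank_less F k" and s: "s = norm (diag c - F)"
    by blast
  obtain a n where n: "n \<in> T" "a n \<noteq> 0" and ker: "blinfun_apply F (\<Sum>n\<in>T. a n *\<^sub>C e n) = 0"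
    using low_rank_kernel_meets_span[OF F assms(2,3)] by blast
  define x where "x = (\<Sum>n\<in>T. a n *\<^sub>C e n)"
  have coef_x: "coef x k = (if k \<in> T then a k else 0)" for k
    unfolding x_def by (rule coef_combination[OF assms(2)])
  have "x \<noteq> 0"
    using coef_x[of n] n by auto
  have "t * norm x \<le> norm (blinfun_apply (diag c) x)"
    using assms(5,6)
    by (intro norm_ge_coefI) (simp_all add: coef_diag[OF assms(1)] coef_x norm_mult mult_right_mono)
  also have "blinfun_apply (diag c) x = blinfun_apply (diag c - F) x"
    using ker by (simp add: blinfun.diff_left x_def)
  also have "norm \<dots> \<le> s * norm x"
    unfolding s by (rule norm_blinfun)
  finally show "t \<le> s"
    using \<open>x \<noteq> 0\<close> by simp
qed

text \<open>The singular numbers are the entries in decreasing order. They are enumerated greedily: if \<open>T\<close>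
holds the \<open>n\<close> largest entries, then the largest entry outside of \<open>T\<close> is the next singular number.
It bounds the norm of what is left after removing \<open>T\<close>, and it is a lower bound on the \<open>n + 1\<close> entries
now selected.\<close>

lemma sum_singular_numbers_diag:
  fixes c :: "nat \<Rightarrow> real"
  assumes "\<And>n. c n \<ge> 0" "c \<longlonglongrightarrow> 0"
  shows "\<exists>T. finite T \<and> card T = n \<and> (\<forall>i\<in>T. \<forall>j. j \<notin> T \<longrightarrow> c j \<le> c i) \<and>
    (\<Sum>k=1..n. singular_number (diag (\<lambda>i. complex_of_real (c i))) k) = (\<Sum>i\<in>T. c i)"
proof (induction n)
  case 0
  show ?case by (rule exI[of _ "{}"]) simp
next
  case (Suc n)
  let ?D = "diag (\<lambda>i. complex_of_real (c i))"
  have B: "Bseq (\<lambda>i. complex_of_real (c i))"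
    using convergent_imp_Bseq[OF convergentI[OF assms(2)]] by (simp add: Bseq_def)
  obtain T where T: "finite T" "card T = n" "\<And>i j. i \<in> T \<Longrightarrow> j \<notin> T \<Longrightarrow> c j \<le> c i"
    and sum: "(\<Sum>k=1..n. singular_number ?D k) = (\<Sum>i\<in>T. c i)"
    using Suc by blast
  obtain m where m: "m \<notin> T" "\<And>j. j \<notin> T \<Longrightarrow> c j \<le> c m"
    using null_sequence_attains_max_off_finite[OF assms T(1)] by blast
  have "singular_number ?D (Suc n) \<le> c m"
  proof (rule singular_number_diag_le[OF B T(1)])
    show "cmod (complex_of_real (c j)) \<le> c m" if "j \<notin> T" for j
      using m(2)[OF that] assms(1)[of j] by simp
  qed (simp add: T(2))
  moreover have "c m \<le> singular_number ?D (Suc n)"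
  proof (rule singular_number_diag_ge[OF B, of "insert m T"])
    show "c m \<le> cmod (complex_of_real (c i))" if "i \<in> insert m T" for i
      using that T(3)[of i m] m(1) assms(1)[of i] by auto
  qed (simp_all add: T(1,2) m(1) assms(1))
  ultimately have "(\<Sum>k=1..Suc n. singular_number ?D k) = (\<Sum>i\<in>insert m T. c i)"
    using sum T(1) m(1) by simp
  moreover have "card (insert m T) = Suc n"
    using T m by simp
  moreover have "\<forall>i\<in>insert m T. \<forall>j. j \<notin> insert m T \<longrightarrow> c j \<le> c i"
    using T(3) m by auto
  ultimately show ?case
    using T(1) by (intro exI[of _ "insert m T"]) simp
qed

lemma tendsto_zero_of_harmonic_bound:
  fixes c :: "nat \<Rightarrow> 'b :: real_normed_vector"
  assumes "\<And>n. norm (c n) \<le> C / (real n + 1)"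
  shows "c \<longlonglongrightarrow> 0"
proof (rule Lim_null_comparison)
  show "(\<lambda>n. C / (real n + 1)) \<longlonglongrightarrow> 0"
    using tendsto_mult_right_zero[OF LIMSEQ_inverse_real_of_nat, of C]
    by (simp add: divide_inverse add.commute)
qed (use assms in simp)

text \<open>Both sides add up \<open>n\<close> entries. The singular numbers pick the largest ones, so their sum is not
smaller. The selected entries with index at least \<open>n\<close> are at most \<open>n\<close> in number and each is at most
\<open>C / (n + 1)\<close>, so the gain is at most \<open>C\<close>.\<close>

lemma sum_singular_numbers_diag_approx:
  fixes c :: "nat \<Rightarrow> real"
  assumes "\<And>n. c n \<ge> 0" "\<And>n. c n \<le> C / (real n + 1)"
  shows "\<bar>(\<Sum>k=1..n. singular_number (diag (\<lambda>i. complex_of_real (c i))) k) - (\<Sum>i<n. c i)\<bar> \<le> C"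
proof -
  have "norm (c n) \<le> C / (real n + 1)" for n
    using assms(1)[of n] assms(2)[of n] by simp
  from tendsto_zero_of_harmonic_bound[OF this] have c0: "c \<longlonglongrightarrow> 0" .
  obtain T where T: "finite T" "card T = n" "\<And>i j. i \<in> T \<Longrightarrow> j \<notin> T \<Longrightarrow> c j \<le> c i"
    and sum: "(\<Sum>k=1..n. singular_number (diag (\<lambda>i. complex_of_real (c i))) k) = (\<Sum>i\<in>T. c i)"
    using sum_singular_numbers_diag[OF assms(1) c0, of n] by blast
  have "C \<ge> 0"
    using order_trans[OF assms(1)[of 0] assms(2)[of 0]] by simp
  have splitT: "(\<Sum>i\<in>T. c i) = (\<Sum>i\<in>T \<inter> {..<n}. c i) + (\<Sum>i\<in>T - {..<n}. c i)"
    by (rule sum.Int_Diff[OF T(1)])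
  have splitn: "(\<Sum>i<n. c i) = (\<Sum>i\<in>T \<inter> {..<n}. c i) + (\<Sum>i\<in>{..<n} - T. c i)"
    using sum.Int_Diff[of "{..<n}" c T] by (simp add: Int_commute)
  have "card (T - {..<n}) = card ({..<n} - T)"
    using T(1,2) by (simp add: card_Diff_subset_Int Int_commute)
  then have "(\<Sum>i\<in>{..<n} - T. c i) \<le> (\<Sum>i\<in>T - {..<n}. c i)"
  proof (intro sum_le_sum_same_card)
    show "c j \<le> c i" if "j \<in> {..<n} - T" "i \<in> T - {..<n}" for i j
      using T(3)[of i j] that by simp
  qed (simp_all add: T(1))
  moreover have "(\<Sum>i\<in>T - {..<n}. c i) \<le> C"
  proof -
    have "(\<Sum>i\<in>T - {..<n}. c i) \<le> real (card (T - {..<n})) * (C / (real n + 1))"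
    proof (rule sum_bounded_above)
      fix i assume "i \<in> T - {..<n}"
      then have "C / (real i + 1) \<le> C / (real n + 1)"
        using \<open>C \<ge> 0\<close> by (intro divide_left_mono) auto
      with assms(2)[of i] show "c i \<le> C / (real n + 1)" by linarith
    qed
    also have "\<dots> \<le> (real n + 1) * (C / (real n + 1))"
    proof (rule mult_right_mono)
      have "card (T - {..<n}) \<le> n"
        using card_mono[of T "T - {..<n}"] T by auto
      then show "real (card (T - {..<n})) \<le> real n + 1" by simp
    qed (use \<open>C \<ge> 0\<close> in simp)
    finally show ?thesis by simp
  qed
  moreover have "(\<Sum>i\<in>{..<n} - T. c i) \<ge> 0"
    using assms(1) by (intro sum_nonneg) auto
  ultimately show ?thesis
    unfolding sum splitT splitn by linarith
qed

text \<open>Cutting off the first \<open>k - 1\<close> entries shows that the \<open>k\<close>-th singular number is at most \<open>C / k\<close>,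
so the sums grow at most like the harmonic numbers.\<close>

lemma diag_in_dual_macaev_ideal:
  assumes "\<And>n. cmod (c n) \<le> C / (real n + 1)"
  shows "diag c \<in> dual_macaev_ideal"
proof -
  have "C \<ge> 0"
    using order_trans[OF norm_ge_zero assms[of 0]] by simp
  have B: "Bseq c"
    using tendsto_zero_of_harmonic_bound[OF assms] by (intro convergent_imp_Bseq convergentI)
  have s_le: "singular_number (diag c) k \<le> C / real k" if "k \<ge> 1" for k
  proof (rule singular_number_diag_le[OF B, of "{..<k - 1}"])
    fix n assume "n \<notin> {..<k - 1}"
    then have "C / (real n + 1) \<le> C / real k"
      using \<open>C \<ge> 0\<close> that by (intro divide_left_mono) auto
    with assms[of n] show "cmod (c n) \<le> C / real k" by linarith
  qed (use that in auto)
  have "log_average (diag c) n \<le> C * (1 + 1 / ln 2)" if "n \<ge> 1" for n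
  proof -
    have ln: "ln 2 \<le> ln (real n + 1)" "0 < ln (real n + 1)"
      using that by auto
    have "(\<Sum>k=1..n. singular_number (diag c) k) \<le> (\<Sum>k=1..n. C / real k)"
      by (intro sum_mono s_le) simp
    also have "\<dots> = C * harm n"
      by (simp add: harm_def sum_distrib_left divide_inverse)
    also have "\<dots> \<le> C * (ln (real n + 1) + 1)"
      using \<open>C \<ge> 0\<close> harm_minus_ln_bounds(2) by (intro mult_left_mono)
    finally have "log_average (diag c) n \<le> C * (ln (real n + 1) + 1) / ln (real n + 1)"
      unfolding log_average_def using ln(2) by (intro divide_right_mono) auto
    also have "\<dots> = C * (1 + 1 / ln (real n + 1))"
      using ln(2) by (simp add: field_simps)
    also have "\<dots> \<le> C * (1 + 1 / ln 2)"
      using \<open>C \<ge> 0\<close> ln by (intro mult_left_mono add_left_mono divide_left_mono) auto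
    finally show ?thesis .
  qed
  then have "bdd_above (log_average (diag c) ` {1..})"
    by (intro bdd_aboveI2) auto
  then show ?thesis
    using diag_bounded_operator[OF B] by (simp add: dual_macaev_ideal_def)
qed

lemma dixmier_trace_diag_nonneg:
  fixes c :: "nat \<Rightarrow> real"
  assumes \<omega>: "dilation_invariant_state \<omega>" "vanishes_on_null_sequences \<omega>"
    and Tr: "is_dixmier_trace \<omega> Tr"
    and c: "\<And>n. c n \<ge> 0" "\<And>n. c n \<le> C / (real n + 1)"
    and L: "\<And>n. \<bar>(\<Sum>i<n. c i) - L * ln (real n + 1)\<bar> \<le> K"
  shows "Tr (diag (\<lambda>n. complex_of_real (c n))) = complex_of_real L"
proof -
  let ?D = "diag (\<lambda>n. complex_of_real (c n))"
  have bound: "cmod (complex_of_real (c n)) \<le> C / (real n + 1)" for n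
    using c by simp
  have B: "Bseq c"
  proof (rule convergent_imp_Bseq[OF convergentI])
    show "c \<longlonglongrightarrow> 0"
      by (rule tendsto_zero_of_harmonic_bound[of c C]) (simp add: c)
  qed
  have "\<bar>(\<Sum>k=1..n. singular_number ?D k) - L * ln (real n + 1)\<bar> \<le> C + K" for n
    using sum_singular_numbers_diag_approx[OF c, of n] L[of n] by linarith
  then have "log_average ?D \<longlonglongrightarrow> L"
    unfolding log_average_def by (rule log_average_limit)
  then have "(\<lambda>i. complex_of_real (log_average ?D (Suc i))) \<longlonglongrightarrow> complex_of_real L"
    by (intro tendsto_of_real LIMSEQ_Suc)
  then have "\<omega> (\<lambda>i. complex_of_real (log_average ?D (Suc i))) = complex_of_real L"
    by (rule state_of_convergent[OF \<omega>])
  moreover have "Tr ?D = \<omega> (\<lambda>i. complex_of_real (log_average ?D (Suc i)))"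
    using Tr diag_in_dual_macaev_ideal[OF bound] positive_op_diag[OF B c(1)]
    unfolding is_dixmier_trace_def by blast
  ultimately show ?thesis by simp
qed

text \<open>Adding \<open>C / (n + 1)\<close>, an operator of trace \<open>C\<close>, reduces the claim to nonnegative entries.\<close>

lemma dixmier_trace_diag_real:
  fixes c :: "nat \<Rightarrow> real"
  assumes \<omega>: "dilation_invariant_state \<omega>" "vanishes_on_null_sequences \<omega>"
    and Tr: "is_dixmier_trace \<omega> Tr"
    and c: "\<And>n. \<bar>c n\<bar> \<le> C / (real n + 1)"
    and L: "\<And>n. \<bar>(\<Sum>i<n. c i) - L * ln (real n + 1)\<bar> \<le> K"
  shows "Tr (diag (\<lambda>n. complex_of_real (c n))) = complex_of_real L"
proof -
  define w where "w n = C / (real n + 1)" for n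
  have "C \<ge> 0"
    using c[of 0] by simp
  have w: "w n \<ge> 0" for n
    using \<open>C \<ge> 0\<close> by (simp add: w_def)
  have sum_w: "\<bar>(\<Sum>i<n. w i) - C * ln (real n + 1)\<bar> \<le> C" for n
  proof -
    have "(\<Sum>i<n. w i) - C * ln (real n + 1) = C * (harm n - ln (real n + 1))"
      by (simp add: w_def harm_altdef sum_distrib_left divide_inverse algebra_simps)
    moreover have "\<bar>harm n - ln (real n + 1)\<bar> \<le> 1"
      using harm_minus_ln_bounds[of n] by simp
    ultimately show ?thesis
      using \<open>C \<ge> 0\<close> mult_left_mono[of "\<bar>harm n - ln (real n + 1)\<bar>" 1 C] by (simp add: abs_mult)
  qed
  have bounds: "c n \<le> w n" "- w n \<le> c n" for n
    using c[of n] unfolding w_def by linarith+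
  have "Tr (diag (\<lambda>n. complex_of_real (w n))) = complex_of_real C"
    using w sum_w by (intro dixmier_trace_diag_nonneg[OF \<omega> Tr, of _ C _ C]) (simp_all add: w_def)
  moreover have "Tr (diag (\<lambda>n. complex_of_real (c n + w n))) = complex_of_real (L + C)"
  proof (rule dixmier_trace_diag_nonneg[OF \<omega> Tr, of _ "2 * C" _ "K + C"])
    show "0 \<le> c n + w n" for n
      using bounds[of n] by linarith
    have "2 * C / (real n + 1) = 2 * w n" for n
      by (simp add: w_def)
    then show "c n + w n \<le> 2 * C / (real n + 1)" for n
      using bounds[of n] by (simp add: w_def)
    show "\<bar>(\<Sum>i<n. c i + w i) - (L + C) * ln (real n + 1)\<bar> \<le> K + C" for n
      using L[of n] sum_w[of n] by (simp add: sum.distrib algebra_simps abs_le_iff)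
  qed
  moreover have "Tr (diag (\<lambda>n. complex_of_real (c n + w n))) =
      Tr (diag (\<lambda>n. complex_of_real (c n))) + Tr (diag (\<lambda>n. complex_of_real (w n)))"
  proof -
    have cb: "cmod (complex_of_real (c n)) \<le> C / (real n + 1)" for n
      using c by simp
    have wb: "cmod (complex_of_real (w n)) \<le> C / (real n + 1)" for n
      using w[of n] by (simp only: norm_of_real abs_of_nonneg) (simp add: w_def)
    have "diag (\<lambda>n. complex_of_real (c n + w n)) =
        diag (\<lambda>n. complex_of_real (c n)) + diag (\<lambda>n. complex_of_real (w n))"
      using tendsto_zero_of_harmonic_bound[OF cb] tendsto_zero_of_harmonic_bound[OF wb]
      by (simp add: diag_add convergent_imp_Bseq convergentI)
    then show ?thesis
      using Tr diag_in_dual_macaev_ideal[OF cb] diag_in_dual_macaev_ideal[OF wb]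
      unfolding is_dixmier_trace_def by simp
  qed
  ultimately show ?thesis by simp
qed

lemma dixmier_trace_diag:
  fixes c :: "nat \<Rightarrow> complex"
  assumes \<omega>: "dilation_invariant_state \<omega>" "vanishes_on_null_sequences \<omega>"
    and Tr: "is_dixmier_trace \<omega> Tr"
    and c: "\<And>n. cmod (c n) \<le> C / (real n + 1)"
    and L: "\<And>n. cmod ((\<Sum>i<n. c i) - L * complex_of_real (ln (real n + 1))) \<le> K"
  shows "Tr (diag c) = L"
proof -
  have Re: "\<bar>Re (c n)\<bar> \<le> C / (real n + 1)" and Im: "\<bar>Im (c n)\<bar> \<le> C / (real n + 1)" for n
    using c[of n] abs_Re_le_cmod[of "c n"] abs_Im_le_cmod[of "c n"] by linarith+
  have sum_Re: "\<bar>(\<Sum>i<n. Re (c i)) - Re L * ln (real n + 1)\<bar> \<le> K" for n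
    using order_trans[OF abs_Re_le_cmod L[of n]] by simp
  have sum_Im: "\<bar>(\<Sum>i<n. Im (c i)) - Im L * ln (real n + 1)\<bar> \<le> K" for n
    using order_trans[OF abs_Im_le_cmod L[of n]] by simp
  have Rb: "cmod (complex_of_real (Re (c n))) \<le> C / (real n + 1)"
    and Ib: "cmod (complex_of_real (Im (c n))) \<le> C / (real n + 1)"
    and iIb: "cmod (\<i> * complex_of_real (Im (c n))) \<le> C / (real n + 1)" for n
    using Re[of n] Im[of n] by (simp_all add: norm_mult)
  have B: "Bseq (\<lambda>n. complex_of_real (Re (c n)))" "Bseq (\<lambda>n. complex_of_real (Im (c n)))"
    using tendsto_zero_of_harmonic_bound[OF Rb] tendsto_zero_of_harmonic_bound[OF Ib]
    by (simp_all add: convergent_imp_Bseq convergentI)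
  have "diag (\<lambda>n. complex_of_real (Re (c n))) + op_scaleC \<i> (diag (\<lambda>n. complex_of_real (Im (c n)))) =
      diag c"
    using B by (simp add: op_scaleC_diag diag_add Bseq_mult Bseq_constant complex_eq[symmetric])
  moreover have "Tr (diag (\<lambda>n. complex_of_real (Re (c n))) +
      op_scaleC \<i> (diag (\<lambda>n. complex_of_real (Im (c n))))) =
      Tr (diag (\<lambda>n. complex_of_real (Re (c n)))) + \<i> * Tr (diag (\<lambda>n. complex_of_real (Im (c n))))"
  proof -
    have "op_scaleC \<i> (diag (\<lambda>n. complex_of_real (Im (c n)))) \<in> dual_macaev_ideal"
      unfolding op_scaleC_diag[OF B(2)] by (rule diag_in_dual_macaev_ideal[OF iIb])
    then show ?thesis
      using Tr diag_in_dual_macaev_ideal[OF Rb] diag_in_dual_macaev_ideal[OF Ib]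
      unfolding is_dixmier_trace_def by simp
  qed
  ultimately show ?thesis
    using dixmier_trace_diag_real[OF \<omega> Tr Re sum_Re] dixmier_trace_diag_real[OF \<omega> Tr Im sum_Im]
    by (simp add: complex_eq[symmetric])
qed

end

section \<open>Jordan decomposition of a real signed Borel measure\<close>

locale signed_borel_measure =
  fixes \<rho> :: "real set \<Rightarrow> real"
  assumes sums_disjoint:
    "\<And>A :: nat \<Rightarrow> real set. range A \<subseteq> sets borel \<Longrightarrow> disjoint_family A \<Longrightarrow> (\<lambda>i. \<rho> (A i)) sums \<rho> (\<Union>i. A i)"
begin

lemma charge_empty: "\<rho> {} = 0"
proof -
  have "(\<lambda>i :: nat. \<rho> {}) sums \<rho> (\<Union>i :: nat. {})"
    by (rule sums_disjoint) (auto simp: disjoint_family_on_def)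
  then have "(\<lambda>i :: nat. \<rho> {}) \<longlonglongrightarrow> 0"
    using summable_LIMSEQ_zero sums_summable by blast
  then show ?thesis
    by (simp add: LIMSEQ_const_iff)
qed

lemma charge_Un:
  assumes "A \<in> sets borel" "B \<in> sets borel" "A \<inter> B = {}"
  shows "\<rho> (A \<union> B) = \<rho> A + \<rho> B"
proof -
  have "(\<lambda>i. \<rho> (binaryset A B i)) sums \<rho> (\<Union>i. binaryset A B i)"
    using assms by (intro sums_disjoint) (auto simp: range_binaryset_eq disjoint_family_on_def binaryset_def)
  moreover have "(\<lambda>i. \<rho> (binaryset A B i)) sums (\<rho> A + \<rho> B)"
    by (rule binaryset_sums) (rule charge_empty)
  ultimately show ?thesis
    unfolding UN_binaryset_eq by (rule sums_unique2)
qed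

lemma charge_Diff:
  assumes "A \<in> sets borel" "B \<in> sets borel" "B \<subseteq> A"
  shows "\<rho> (A - B) = \<rho> A - \<rho> B"
  using charge_Un[of "A - B" B] assms by (simp add: Un_absorb2 Int_commute)

text \<open>The set function underlying \<open>pos_variation\<close>, before it is known to be a measure.\<close>

definition pos_var :: "real set \<Rightarrow> ennreal" where
  "pos_var B = (SUP C\<in>{C \<in> sets borel. C \<subseteq> B}. ennreal (\<rho> C))"

lemma pos_var_upper: "C \<in> sets borel \<Longrightarrow> C \<subseteq> B \<Longrightarrow> ennreal (\<rho> C) \<le> pos_var B"
  unfolding pos_var_def by (rule SUP_upper) simp

lemma pos_var_least: "(\<And>C. C \<in> sets borel \<Longrightarrow> C \<subseteq> B \<Longrightarrow> ennreal (\<rho> C) \<le> t) \<Longrightarrow> pos_var B \<le> t"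
  unfolding pos_var_def by (rule SUP_least) simp

lemma pos_var_mono: "A \<subseteq> B \<Longrightarrow> pos_var A \<le> pos_var B"
  unfolding pos_var_def by (rule SUP_subset_mono) auto

text \<open>Subsets of \<open>A\<close> and of \<open>B\<close> combine to a subset of the union. Since \<open>ennreal\<close> cuts off at \<open>0\<close>, a part
of negative charge contributes nothing and is left out.\<close>

lemma pos_var_superadditive:
  assumes "A \<inter> B = {}"
  shows "pos_var A + pos_var B \<le> pos_var (A \<union> B)"
proof -
  let ?S = "\<lambda>B. {C \<in> sets borel. C \<subseteq> B}"
  have ne: "?S B \<noteq> {}" for B :: "real set"
    by auto
  have "ennreal (\<rho> C) + ennreal (\<rho> D) \<le> pos_var (A \<union> B)" if "C \<in> ?S A" "D \<in> ?S B" for C D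
  proof -
    have sub: "C \<subseteq> A \<union> B" "D \<subseteq> A \<union> B" "C \<union> D \<subseteq> A \<union> B"
      using that by auto
    consider "\<rho> C \<le> 0" | "\<rho> D \<le> 0" | "\<rho> C \<ge> 0" "\<rho> D \<ge> 0" by linarith
    then show ?thesis
    proof cases
      case 1
      then show ?thesis
        using that sub pos_var_upper[of D "A \<union> B"] by (simp add: ennreal_neg)
    next
      case 2
      then show ?thesis
        using that sub pos_var_upper[of C "A \<union> B"] by (simp add: ennreal_neg)
    next
      case 3
      have "C \<inter> D = {}"
        using assms that by auto
      then have "ennreal (\<rho> C) + ennreal (\<rho> D) = ennreal (\<rho> (C \<union> D))"
        using 3 that by (simp add: charge_Un)
      moreover have "C \<union> D \<in> sets borel"
        using that by blast
      ultimately show ?thesis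
        using sub pos_var_upper[of "C \<union> D" "A \<union> B"] by simp
    qed
  qed
  then have "(SUP C\<in>?S A. SUP D\<in>?S B. ennreal (\<rho> C) + ennreal (\<rho> D)) \<le> pos_var (A \<union> B)"
    by (intro SUP_least)
  moreover have "pos_var A + pos_var B = (SUP C\<in>?S A. SUP D\<in>?S B. ennreal (\<rho> C) + ennreal (\<rho> D))"
    unfolding pos_var_def
    by (simp only: ennreal_SUP_add_left[OF ne, symmetric]) (simp only: ennreal_SUP_add_right[OF ne])
  ultimately show ?thesis by simp
qed

lemma pos_var_empty: "pos_var {} = 0"
proof -
  have "{C \<in> sets borel. C \<subseteq> ({} :: real set)} = {{}}"
    by auto
  then show ?thesis
    unfolding pos_var_def by (simp add: charge_empty)
qed

text \<open>One inequality is finite superadditivity and monotonicity. For the other one, a subset of the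
union is cut into its parts in the \<open>A i\<close>, whose charges add up to its charge.\<close>

lemma pos_var_countably_additive: "countably_additive (sets borel) pos_var"
proof (rule countably_additiveI)
  fix A :: "nat \<Rightarrow> real set"
  assume A: "range A \<subseteq> sets borel" "disjoint_family A" "(\<Union>i. A i) \<in> sets borel"
  show "(\<Sum>i. pos_var (A i)) = pos_var (\<Union>i. A i)"
  proof (rule antisym)
    have "(\<Sum>i<n. pos_var (A i)) \<le> pos_var (\<Union>i<n. A i)" for n
    proof (induction n)
      case (Suc n)
      have disj: "(\<Union>i<n. A i) \<inter> A n = {}"
        using disjoint_family_onD[OF A(2)] by (auto dest: less_imp_neq)
      have "(\<Sum>i<Suc n. pos_var (A i)) \<le> pos_var (\<Union>i<n. A i) + pos_var (A n)"
        using Suc by (simp add: add_right_mono)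
      also have "\<dots> \<le> pos_var ((\<Union>i<n. A i) \<union> A n)"
        by (rule pos_var_superadditive[OF disj])
      also have "(\<Union>i<n. A i) \<union> A n = (\<Union>i<Suc n. A i)"
        by (auto simp: less_Suc_eq)
      finally show ?case .
    qed simp
    moreover have "pos_var (\<Union>i<n. A i) \<le> pos_var (\<Union>i. A i)" for n
      by (rule pos_var_mono) blast
    ultimately have "(\<Sum>i<n. pos_var (A i)) \<le> pos_var (\<Union>i. A i)" for n
      by (rule order_trans)
    then show "(\<Sum>i. pos_var (A i)) \<le> pos_var (\<Union>i. A i)"
      by (intro suminf_le_const summableI)
  next
    show "pos_var (\<Union>i. A i) \<le> (\<Sum>i. pos_var (A i))"
    proof (rule pos_var_least)
      fix C :: "real set" assume C: "C \<in> sets borel" "C \<subseteq> (\<Union>i. A i)"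
      have "(\<lambda>i. \<rho> (C \<inter> A i)) sums \<rho> (\<Union>i. C \<inter> A i)"
        using A C by (intro sums_disjoint) (auto simp: disjoint_family_on_def)
      moreover have "(\<Union>i. C \<inter> A i) = C"
        using C(2) by blast
      ultimately have "(\<lambda>n. \<Sum>i<n. \<rho> (C \<inter> A i)) \<longlonglongrightarrow> \<rho> C"
        by (simp add: sums_def)
      then have lim: "(\<lambda>n. ennreal (\<Sum>i<n. \<rho> (C \<inter> A i))) \<longlonglongrightarrow> ennreal (\<rho> C)"
        by (rule tendsto_ennrealI)
      have "ennreal (\<Sum>i<n. \<rho> (C \<inter> A i)) \<le> (\<Sum>i. pos_var (A i))" for n
      proof -
        have "ennreal (\<Sum>i<n. \<rho> (C \<inter> A i)) \<le> ennreal (\<Sum>i<n. max 0 (\<rho> (C \<inter> A i)))"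
          by (intro ennreal_leI sum_mono) simp
        also have "\<dots> = (\<Sum>i<n. ennreal (max 0 (\<rho> (C \<inter> A i))))"
          by (rule sum_ennreal[symmetric]) simp
        also have "\<dots> \<le> (\<Sum>i<n. pos_var (A i))"
        proof (rule sum_mono)
          fix i
          have "ennreal (max 0 (\<rho> (C \<inter> A i))) = ennreal (\<rho> (C \<inter> A i))"
            by (simp add: max_def ennreal_neg)
          also have "\<dots> \<le> pos_var (A i)"
            using A(1) C(1) by (intro pos_var_upper) auto
          finally show "ennreal (max 0 (\<rho> (C \<inter> A i))) \<le> pos_var (A i)" .
        qed
        also have "\<dots> \<le> (\<Sum>i. pos_var (A i))"
          by (rule sum_le_suminf) auto
        finally show ?thesis .
      qed
      then show "ennreal (\<rho> C) \<le> (\<Sum>i. pos_var (A i))"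
        by (intro LIMSEQ_le_const2[OF lim]) blast
    qed
  qed
qed

lemma pos_variation_eq: "pos_variation \<rho> = measure_of UNIV (sets borel) pos_var"
  unfolding pos_variation_def pos_var_def ..

lemma sets_pos_variation [simp]: "sets (pos_variation \<rho>) = sets borel"
  unfolding pos_variation_eq using sets.sigma_sets_eq[of "borel :: real measure"] by simp

lemma space_pos_variation [simp]: "space (pos_variation \<rho>) = UNIV"
  unfolding pos_variation_eq by simp

lemma emeasure_pos_variation:
  assumes "B \<in> sets borel"
  shows "emeasure (pos_variation \<rho>) B = pos_var B"
  unfolding pos_variation_eq
proof (rule emeasure_measure_of_sigma)
  show "sigma_algebra UNIV (sets (borel :: real measure))"
    using sets.sigma_algebra_axioms[of "borel :: real measure"] by simp
qed (use assms in \<open>simp_all add: positive_def pos_var_empty pos_var_countably_additive\<close>)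

lemma pos_var_Un:
  assumes "A \<in> sets borel" "B \<in> sets borel" "A \<inter> B = {}"
  shows "pos_var (A \<union> B) = pos_var A + pos_var B"
  using plus_emeasure[of A "pos_variation \<rho>" B] assms by (simp add: emeasure_pos_variation)

text \<open>Some \<open>C\<close> in \<open>E\<close> has a charge exceeding \<open>\<bar>\<rho> E\<bar> + 1\<close>, and then both \<open>C\<close> and \<open>E - C\<close> have charges
of modulus at least \<open>1\<close>. One of the two still has infinite variation; the other one is split off.\<close>

lemma split_off_large_charge:
  assumes E: "E \<in> sets borel" "pos_var E = \<infinity>"
  shows "\<exists>F\<in>sets borel. F \<subseteq> E \<and> pos_var F = \<infinity> \<and> \<bar>\<rho> (E - F)\<bar> \<ge> 1"
proof -
  have "ennreal (\<bar>\<rho> E\<bar> + 1) < pos_var E"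
    using E(2) by simp
  then obtain C where C: "C \<in> sets borel" "C \<subseteq> E" "ennreal (\<bar>\<rho> E\<bar> + 1) < ennreal (\<rho> C)"
    unfolding pos_var_def less_SUP_iff by auto
  then have large: "\<bar>\<rho> E\<bar> + 1 < \<rho> C"
    by (subst (asm) ennreal_less_iff) simp_all
  have "pos_var E = pos_var C + pos_var (E - C)"
    using pos_var_Un[of C "E - C"] C E by (simp add: Un_absorb1)
  then consider "pos_var C = \<infinity>" | "pos_var (E - C) = \<infinity>"
    using E(2) by (metis ennreal_add_eq_top infinity_ennreal_def)
  then show ?thesis
  proof cases
    case 1
    have "\<rho> (E - C) = \<rho> E - \<rho> C"
      using C E by (intro charge_Diff)
    then show ?thesis
      using 1 C large by (intro bexI[of _ C]) auto
  next
    case 2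
    have "E - (E - C) = C"
      using C by auto
    then show ?thesis
      using 2 C E large by (intro bexI[of _ "E - C"]) auto
  qed
qed

text \<open>Otherwise charges of modulus at least \<open>1\<close> can be split off forever. The pieces are disjoint, so
their charges form a convergent series, a contradiction.\<close>

lemma pos_var_finite: "pos_var UNIV < \<infinity>"
proof (rule ccontr)
  assume "\<not> pos_var UNIV < \<infinity>"
  then have inf: "pos_var UNIV = \<infinity>"
    by (metis infinity_ennreal_def top.not_eq_extremum)
  have "\<exists>E. \<forall>n. (E n \<in> sets borel \<and> pos_var (E n) = \<infinity>) \<and>
      (E (Suc n) \<subseteq> E n \<and> \<bar>\<rho> (E n - E (Suc n))\<bar> \<ge> 1)"
  proof (rule dependent_nat_choice)
    show "\<exists>x. x \<in> sets borel \<and> pos_var x = \<infinity>"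
      using inf by (intro exI[of _ UNIV]) simp
    show "\<exists>y. (y \<in> sets borel \<and> pos_var y = \<infinity>) \<and> y \<subseteq> x \<and> \<bar>\<rho> (x - y)\<bar> \<ge> 1"
      if "x \<in> sets borel \<and> pos_var x = \<infinity>" for x and n :: nat
      using split_off_large_charge[of x] that by blast
  qed
  then obtain E where E: "\<And>n. E n \<in> sets borel" "\<And>n. E (Suc n) \<subseteq> E n" "\<And>n. \<bar>\<rho> (E n - E (Suc n))\<bar> \<ge> 1"
    by blast
  have anti: "E n \<subseteq> E m" if "m \<le> n" for m n
    using that E(2) by (rule lift_Suc_antimono_le[of E, rotated])
  have "disjoint_family (\<lambda>n. E n - E (Suc n))"
    unfolding disjoint_family_on_def
  proof (intro ballI impI)
    fix m n :: nat assume "m \<noteq> n"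
    then consider "Suc m \<le> n" | "Suc n \<le> m" by linarith
    then show "(E m - E (Suc m)) \<inter> (E n - E (Suc n)) = {}"
    proof cases
      case 1
      then show ?thesis using anti[of "Suc m" n] by blast
    next
      case 2
      then show ?thesis using anti[of "Suc n" m] by blast
    qed
  qed
  then have "(\<lambda>n. \<rho> (E n - E (Suc n))) sums \<rho> (\<Union>n. E n - E (Suc n))"
    using E(1) by (intro sums_disjoint) auto
  then have null: "(\<lambda>n. \<rho> (E n - E (Suc n))) \<longlonglongrightarrow> 0"
    using summable_LIMSEQ_zero sums_summable by blast
  have "eventually (\<lambda>n. \<bar>\<rho> (E n - E (Suc n))\<bar> < 1) sequentially"
    using tendstoD[OF null, of 1] by simp
  then show False
    using E(3) by (auto simp: eventually_sequentially not_less[symmetric])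
qed

lemma finite_measure_pos_variation: "finite_measure (pos_variation \<rho>)"
  using pos_var_finite by (intro finite_measureI) (simp add: emeasure_pos_variation)

lemma charge_le_pos_variation:
  assumes "C \<in> sets borel" "B \<in> sets borel" "C \<subseteq> B"
  shows "\<rho> C \<le> measure (pos_variation \<rho>) B"
proof -
  interpret finite_measure "pos_variation \<rho>"
    by (rule finite_measure_pos_variation)
  have "ennreal (\<rho> C) \<le> ennreal (measure (pos_variation \<rho>) B)"
    using pos_var_upper[of C B] assms
    by (simp add: emeasure_pos_variation[symmetric] emeasure_eq_measure)
  then show ?thesis
    by (simp add: ennreal_le_iff)
qed

lemma pos_variation_le:
  assumes "B \<in> sets borel" "\<And>C. C \<in> sets borel \<Longrightarrow> C \<subseteq> B \<Longrightarrow> \<rho> C \<le> t"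
  shows "measure (pos_variation \<rho>) B \<le> t"
proof -
  interpret finite_measure "pos_variation \<rho>"
    by (rule finite_measure_pos_variation)
  have "0 \<le> t"
    using assms(2)[of "{}"] by (simp add: charge_empty)
  have "emeasure (pos_variation \<rho>) B \<le> ennreal t"
    unfolding emeasure_pos_variation[OF assms(1)]
    by (rule pos_var_least) (simp add: assms(2) ennreal_leI)
  then show ?thesis
    using \<open>0 \<le> t\<close> by (simp add: emeasure_eq_measure ennreal_le_iff)
qed

end

lemma signed_borel_measure_uminus:
  assumes "signed_borel_measure \<rho>"
  shows "signed_borel_measure (\<lambda>B. - \<rho> B)"
  using assms unfolding signed_borel_measure_def by (simp add: sums_minus)

text \<open>The subsets of \<open>B\<close> come in complementary pairs: a large charge of \<open>C\<close> is a small charge of \<open>B - C\<close>.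
Finiteness of the variations permits the subtraction.\<close>

lemma Jordan_decomposition:
  assumes "signed_borel_measure \<rho>" and B: "B \<in> sets borel"
  shows "\<rho> B = measure (pos_variation \<rho>) B - measure (pos_variation (\<lambda>B. - \<rho> B)) B"
proof -
  interpret pos: signed_borel_measure \<rho> by fact
  interpret neg: signed_borel_measure "\<lambda>B. - \<rho> B"
    using assms(1) by (rule signed_borel_measure_uminus)
  have "measure (pos_variation \<rho>) B \<le> measure (pos_variation (\<lambda>B. - \<rho> B)) B + \<rho> B"
  proof (rule pos.pos_variation_le[OF B])
    fix C :: "real set" assume C: "C \<in> sets borel" "C \<subseteq> B"
    have "- \<rho> (B - C) \<le> measure (pos_variation (\<lambda>B. - \<rho> B)) B"
      using B C by (intro neg.charge_le_pos_variation) auto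
    then show "\<rho> C \<le> measure (pos_variation (\<lambda>B. - \<rho> B)) B + \<rho> B"
      using pos.charge_Diff[OF B C] by simp
  qed
  moreover have "measure (pos_variation (\<lambda>B. - \<rho> B)) B \<le> measure (pos_variation \<rho>) B - \<rho> B"
  proof (rule neg.pos_variation_le[OF B])
    fix C :: "real set" assume C: "C \<in> sets borel" "C \<subseteq> B"
    have "\<rho> (B - C) \<le> measure (pos_variation \<rho>) B"
      using B C by (intro pos.charge_le_pos_variation) auto
    then show "- \<rho> C \<le> measure (pos_variation \<rho>) B - \<rho> B"
      using pos.charge_Diff[OF B C] by simp
  qed
  ultimately show ?thesis by simp
qed

section \<open>A signed measure on a compact set is determined by its moments\<close>

lemma set_integrable_bounded:
  fixes g :: "real \<Rightarrow> 'b :: euclidean_space"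
  assumes "finite_measure M" "sets M = sets borel" "S \<in> sets borel" "g \<in> borel_measurable borel"
    and "\<And>x. x \<in> S \<Longrightarrow> norm (g x) \<le> K"
  shows "set_integrable M S g"
  unfolding set_integrable_def
proof (rule finite_measure.integrable_const_bound[OF assms(1), of _ "max 0 K"])
  show "AE x in M. norm (indicat_real S x *\<^sub>R g x) \<le> max 0 K"
    using assms(5) by (intro AE_I2) (auto simp: indicator_def le_max_iff_disj)
  have "(\<lambda>x. indicat_real S x *\<^sub>R g x) \<in> borel_measurable borel"
    using assms(3,4) by measurable
  then show "(\<lambda>x. indicat_real S x *\<^sub>R g x) \<in> borel_measurable M"
    by (simp add: measurable_cong_sets[OF assms(2) refl])
qed

lemma set_integrable_continuous_compact:
  fixes g :: "real \<Rightarrow> 'b :: euclidean_space"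
  assumes "finite_measure M" "sets M = sets borel" "compact S" "continuous_on UNIV g"
  shows "set_integrable M S g"
proof -
  have "bounded (g ` S)"
    using assms(3) continuous_on_subset[OF assms(4)] by (intro compact_imp_bounded compact_continuous_image) auto
  then obtain K where "\<And>x. x \<in> S \<Longrightarrow> norm (g x) \<le> K"
    unfolding bounded_iff by blast
  then show ?thesis
    using assms by (intro set_integrable_bounded[of M S g K] borel_measurable_continuous_onI borel_compact)
qed

lemma set_integral_uniformly_close:
  fixes g h :: "real \<Rightarrow> real"
  assumes M: "finite_measure M" "sets M = sets borel" and S: "compact S"
    and g: "continuous_on UNIV g" and h: "continuous_on UNIV h"
    and close: "\<And>x. x \<in> S \<Longrightarrow> \<bar>g x - h x\<bar> \<le> \<epsilon>"
  shows "\<bar>(LINT x:S|M. g x) - (LINT x:S|M. h x)\<bar> \<le> \<epsilon> * measure M S"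
proof -
  interpret finite_measure M by fact
  have S_M: "S \<in> sets M"
    using M(2) S by (simp add: borel_compact)
  have "(LINT x:S|M. g x) - (LINT x:S|M. h x) = (LINT x:S|M. g x - h x)"
    by (intro set_integral_diff(2)[symmetric] set_integrable_continuous_compact[OF M S] g h)
  also have "\<bar>\<dots>\<bar> \<le> (LINT x|M. \<epsilon> * indicator S x)"
    unfolding set_lebesgue_integral_def real_norm_def[symmetric]
  proof (rule Bochner_Integration.integral_norm_bound_integral)
    show "integrable M (\<lambda>x. indicat_real S x *\<^sub>R (g x - h x))"
      using set_integrable_continuous_compact[OF M S continuous_on_diff[OF g h]]
      by (simp add: set_integrable_def)
    show "integrable M (\<lambda>x. \<epsilon> * indicat_real S x)"
      using S_M by (intro integrable_mult_right integrable_real_indicator) (simp_all add: less_top[symmetric])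
    show "norm (indicat_real S x *\<^sub>R (g x - h x)) \<le> \<epsilon> * indicat_real S x" for x
      using close[of x] by (auto simp: indicator_def)
  qed
  also have "\<dots> = \<epsilon> * measure M S"
    using S_M by simp
  finally show ?thesis .
qed

text \<open>Indicators of half-lines are pointwise limits of continuous piecewise linear functions.\<close>

lemma set_integral_indicator_atMost_limit:
  fixes a :: real
  assumes M: "finite_measure M" "sets M = sets borel" and S: "compact S"
  shows "(\<lambda>n. LINT x:S|M. max 0 (min 1 (1 - real n * (x - a)))) \<longlonglongrightarrow> measure M (S \<inter> {..a})"
proof -
  interpret finite_measure M by fact
  let ?g = "\<lambda>n x. max 0 (min 1 (1 - real n * (x - a)))"
  have S_M: "S \<in> sets M" "S \<inter> {..a} \<in> sets M"
    using M(2) borel_compact[OF S] by auto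
  have meas: "(\<lambda>x. indicat_real S x *\<^sub>R ?g n x) \<in> borel_measurable M" for n
  proof -
    have "integrable M (\<lambda>x. indicat_real S x *\<^sub>R ?g n x)"
      unfolding set_integrable_def[symmetric]
      by (intro set_integrable_continuous_compact[OF M S] continuous_intros)
    then show ?thesis by (rule borel_measurable_integrable)
  qed
  have "(\<lambda>n. LINT x|M. indicat_real S x *\<^sub>R ?g n x) \<longlonglongrightarrow> (LINT x|M. indicator (S \<inter> {..a}) x)"
  proof (rule integral_dominated_convergence[where w = "\<lambda>x. 1"])
    show "AE x in M. (\<lambda>n. indicat_real S x *\<^sub>R ?g n x) \<longlonglongrightarrow> indicator (S \<inter> {..a}) x"
    proof (rule AE_I2)
      fix x
      have "(\<lambda>n. ?g n x) \<longlonglongrightarrow> indicator {..a} x"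
      proof (cases "x \<le> a")
        case True
        then have "?g n x = 1" for n
          by (simp add: mult_nonneg_nonpos min_def max_def)
        then show ?thesis using True by simp
      next
        case False
        then obtain N where N: "1 < real N * (x - a)"
          using reals_Archimedean3[of "x - a"] by auto
        have "?g n x = 0" if "n \<ge> N" for n
        proof -
          have "real N * (x - a) \<le> real n * (x - a)"
            using that False by (intro mult_right_mono) auto
          with N show ?thesis by simp
        qed
        then have "eventually (\<lambda>n. ?g n x = 0) sequentially"
          by (auto simp: eventually_sequentially)
        then show ?thesis
          using False by (simp add: tendsto_eventually)
      qed
      then have "(\<lambda>n. indicat_real S x *\<^sub>R ?g n x) \<longlonglongrightarrow> indicat_real S x *\<^sub>R indicator {..a} x"
        by (intro tendsto_scaleR tendsto_const)
      then show "(\<lambda>n. indicat_real S x *\<^sub>R ?g n x) \<longlonglongrightarrow> indicator (S \<inter> {..a}) x"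
        by (simp add: indicator_inter_arith)
    qed
    show "indicator (S \<inter> {..a}) \<in> borel_measurable M"
      using S_M(2) by (rule borel_measurable_indicator)
    show "AE x in M. norm (indicat_real S x *\<^sub>R ?g n x) \<le> 1" for n
      by (auto simp: indicator_def)
  qed (rule meas, simp)
  then show ?thesis
    using S_M by (simp add: set_lebesgue_integral_def)
qed

lemma continuous_integrals_from_moments:
  fixes g :: "real \<Rightarrow> real"
  assumes P: "finite_measure P" "sets P = sets borel"
    and N: "finite_measure N" "sets N = sets borel"
    and \<sigma>: "finite_measure \<sigma>" "sets \<sigma> = sets borel"
    and S: "compact S"
    and moments: "\<And>p :: real poly.
      (LINT x:S|P. poly p x) - (LINT x:S|N. poly p x) = (LINT x:S|\<sigma>. poly p x)"
    and g: "continuous_on UNIV g"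
  shows "(LINT x:S|P. g x) - (LINT x:S|N. g x) = (LINT x:S|\<sigma>. g x)"
proof -
  define D where "D = \<bar>(LINT x:S|P. g x) - (LINT x:S|N. g x) - (LINT x:S|\<sigma>. g x)\<bar>"
  define K where "K = measure P S + measure N S + measure \<sigma> S"
  have "K \<ge> 0"
    by (simp add: K_def)
  have bound: "D \<le> \<epsilon> * K" if "\<epsilon> > 0" for \<epsilon>
  proof -
    obtain p :: "real poly" where p: "\<forall>t\<in>S. \<bar>g t - poly p t\<bar> < \<epsilon>"
      using Weierstrass_real_poly[OF S continuous_on_subset[OF g subset_UNIV] \<open>\<epsilon> > 0\<close>] by blast
    have close: "\<bar>g t - poly p t\<bar> \<le> \<epsilon>" if "t \<in> S" for t
      using p that by (simp add: less_imp_le)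
    have poly_cont: "continuous_on UNIV (poly p)"
      by (intro continuous_intros)
    have "\<bar>(LINT x:S|P. g x) - (LINT x:S|P. poly p x)\<bar> \<le> \<epsilon> * measure P S"
      "\<bar>(LINT x:S|N. g x) - (LINT x:S|N. poly p x)\<bar> \<le> \<epsilon> * measure N S"
      "\<bar>(LINT x:S|\<sigma>. g x) - (LINT x:S|\<sigma>. poly p x)\<bar> \<le> \<epsilon> * measure \<sigma> S"
      by (rule set_integral_uniformly_close[OF P S g poly_cont close]
          set_integral_uniformly_close[OF N S g poly_cont close]
          set_integral_uniformly_close[OF \<sigma> S g poly_cont close], assumption)+
    then show ?thesis
      using moments[of p] unfolding D_def K_def distrib_left by linarith
  qed
  have "D \<le> 0"
  proof (rule field_le_epsilon)
    fix r :: real assume "r > 0"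
    then have "D \<le> r / (K + 1) * K"
      using \<open>K \<ge> 0\<close> by (intro bound) simp
    also have "\<dots> \<le> r"
      using \<open>K \<ge> 0\<close> \<open>r > 0\<close> by (simp add: field_simps)
    finally show "D \<le> 0 + r" by simp
  qed
  then show ?thesis
    by (simp add: D_def)
qed

text \<open>Equal moments give equal integrals of continuous functions, hence equal values on half-lines. The
remaining Borel sets are reached by Dynkin's theorem, where the constant polynomial accounts
for complements. Comparing the two variations with \<open>\<sigma>\<close> directly spares the construction of sums of
measures.\<close>

lemma signed_measure_eq_from_moments:
  assumes \<rho>: "signed_borel_measure \<rho>"
    and \<sigma>: "finite_measure \<sigma>" "sets \<sigma> = sets borel"
    and S: "compact S"
    and moments: "\<And>p :: real poly. (LINT x:S|pos_variation \<rho>. poly p x) -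
      (LINT x:S|pos_variation (\<lambda>B. - \<rho> B). poly p x) = (LINT x:S|\<sigma>. poly p x)"
    and B: "B \<in> sets borel"
  shows "\<rho> (B \<inter> S) = measure \<sigma> (B \<inter> S)"
proof -
  interpret signed_borel_measure \<rho> by fact
  interpret neg: signed_borel_measure "\<lambda>B. - \<rho> B"
    using \<rho> by (rule signed_borel_measure_uminus)
  interpret \<sigma>: finite_measure \<sigma> by fact
  note P = finite_measure_pos_variation sets_pos_variation
  note N = neg.finite_measure_pos_variation neg.sets_pos_variation
  have S_borel: "S \<in> sets borel"
    using S by (rule borel_compact)
  have atMost: "\<rho> ({..a} \<inter> S) = measure \<sigma> ({..a} \<inter> S)" for a
  proof -
    let ?g = "\<lambda>n x. max 0 (min 1 (1 - real n * (x - a)))"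
    have eq: "(LINT x:S|pos_variation \<rho>. ?g n x) - (LINT x:S|pos_variation (\<lambda>B. - \<rho> B). ?g n x) =
        (LINT x:S|\<sigma>. ?g n x)" for n
      by (intro continuous_integrals_from_moments[OF P N \<sigma> S moments] continuous_intros)
    have "(\<lambda>n. (LINT x:S|pos_variation \<rho>. ?g n x) -
        (LINT x:S|pos_variation (\<lambda>B. - \<rho> B). ?g n x)) \<longlonglongrightarrow>
        measure (pos_variation \<rho>) (S \<inter> {..a}) - measure (pos_variation (\<lambda>B. - \<rho> B)) (S \<inter> {..a})"
      by (intro tendsto_diff set_integral_indicator_atMost_limit P N S)
    from LIMSEQ_unique[OF this[unfolded eq] set_integral_indicator_atMost_limit[OF \<sigma> S]]
    have "measure (pos_variation \<rho>) (S \<inter> {..a}) -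
        measure (pos_variation (\<lambda>B. - \<rho> B)) (S \<inter> {..a}) = measure \<sigma> (S \<inter> {..a})" .
    then show ?thesis
      using Jordan_decomposition[OF \<rho>, of "S \<inter> {..a}"] S_borel by (simp add: Int_commute)
  qed
  have whole: "\<rho> S = measure \<sigma> S"
    using moments[of 1] Jordan_decomposition[OF \<rho> S_borel] S_borel \<sigma>(2)
    by (simp add: set_lebesgue_integral_def)
  have "B \<in> sigma_sets UNIV (range (\<lambda>a. {..a}))"
    using B by (simp add: borel_eq_atMost)
  then show ?thesis
  proof (induction rule: sigma_sets_induct_disjoint[rotated 2, consumes 1, case_names basic empty compl union Int Pow])
    case Int
    then show ?case by (auto simp: Int_stable_def)
  next
    case Pow
    then show ?case by simp
  next
    case (basic A)
    then show ?case using atMost by auto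
  next
    case empty
    then show ?case by (simp add: charge_empty)
  next
    case (compl A)
    then have A: "A \<in> sets borel"
      by (simp add: borel_eq_atMost)
    have eq: "(UNIV - A) \<inter> S = S - A \<inter> S" by auto
    have "\<rho> (S - A \<inter> S) = \<rho> S - \<rho> (A \<inter> S)"
      using A S_borel by (intro charge_Diff) auto
    moreover have "measure \<sigma> (S - A \<inter> S) = measure \<sigma> S - measure \<sigma> (A \<inter> S)"
      using A S_borel \<sigma>(2) by (intro \<sigma>.finite_measure_Diff) auto
    ultimately show ?case
      unfolding eq using whole compl by simp
  next
    case (union A)
    then have A: "range A \<subseteq> sets borel"
      by (simp add: borel_eq_atMost)
    have eq: "(\<Union>i. A i) \<inter> S = (\<Union>i. A i \<inter> S)" by auto
    have disj: "disjoint_family (\<lambda>i. A i \<inter> S)"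
      using union(1) by (auto simp: disjoint_family_on_def)
    have "(\<lambda>i. \<rho> (A i \<inter> S)) sums \<rho> (\<Union>i. A i \<inter> S)"
      using A S_borel by (intro sums_disjoint disj) auto
    moreover have "(\<lambda>i. measure \<sigma> (A i \<inter> S)) sums measure \<sigma> (\<Union>i. A i \<inter> S)"
      using A S_borel \<sigma>(2) by (intro \<sigma>.finite_measure_UNION disj) auto
    ultimately show ?case
      unfolding eq using union(3) sums_unique2 by fastforce
  qed
qed

section \<open>Quantile functions\<close>

text \<open>The complement of the support is a union of open null sets, and countably many of them suffice by
Lindelof's theorem.\<close>

lemma null_outside_support:
  assumes "sets \<sigma> = sets borel" "measure_support \<sigma> \<subseteq> S" "S \<in> sets borel"
  shows "emeasure \<sigma> (- S) = 0"
proof -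
  define \<U> where "\<U> = {U. open U \<and> emeasure \<sigma> U = 0}"
  have \<U>: "U \<in> \<U> \<longleftrightarrow> open U \<and> emeasure \<sigma> U = 0" for U
    by (simp add: \<U>_def)
  obtain \<V> where \<V>: "\<V> \<subseteq> \<U>" "countable \<V>" "\<Union>\<V> = \<Union>\<U>"
    using Lindelof[of \<U>] \<U> by metis
  have "- S \<subseteq> \<Union>\<V>"
    unfolding \<V>(3)
  proof (rule subsetI, rule ccontr)
    fix x assume x: "x \<in> - S" "x \<notin> \<Union>\<U>"
    have "emeasure \<sigma> U > 0" if "open U" "x \<in> U" for U
    proof (rule ccontr)
      assume "\<not> emeasure \<sigma> U > 0"
      then have "U \<in> \<U>"
        using that(1) by (simp add: \<U>)
      then show False
        using x(2) that(2) by blast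
    qed
    then have "x \<in> measure_support \<sigma>"
      by (simp add: measure_support_def)
    then show False
      using x(1) assms(2) by blast
  qed
  moreover have "\<Union>\<V> \<in> null_sets \<sigma>"
  proof -
    have "U \<in> null_sets \<sigma>" if "U \<in> \<V>" for U
    proof (rule null_setsI)
      have "U \<in> \<U>"
        using \<V>(1) that by blast
      then show "emeasure \<sigma> U = 0" "U \<in> sets \<sigma>"
        by (simp_all add: \<U> assms(1))
    qed
    then show ?thesis
      using null_sets_UN'[OF \<V>(2), of "\<lambda>U. U" \<sigma>] by simp
  qed
  ultimately have "- S \<in> null_sets \<sigma>"
    using null_sets_subset[of "\<Union>\<V>" \<sigma> "- S"] assms(1,3) by auto
  then show ?thesis
    by (rule null_setsD1)
qed

lemma quantile_function_of_distribution:
  assumes M: "real_distribution M" and M_ab: "emeasure M (- {a..b}) = 0"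
    and g: "continuous_on UNIV (g :: real \<Rightarrow> complex)"
  shows "(LINT x|M. g x) = (LINT u:{0<..<1}|lborel. g (Inf {x. u \<le> cdf M x}))"
proof -
  interpret cdf_distribution M
    unfolding cdf_distribution_def by (rule M)
  have g_meas: "g \<in> borel_measurable borel"
    using g by (rule borel_measurable_continuous_onI)
  have "(LINT x|M. g x) = (LINT x|distr (restrict_space lborel {0<..<1}) borel I. g x)"
    by (simp add: distr_I_eq_M)
  also have "\<dots> = (LINT u|restrict_space lborel {0<..<1}. g (I u))"
    using g_meas by (intro integral_distr) (simp_all add: measurable_cong_sets[OF sets_restrict_space_cong[OF sets_lborel] refl])
  also have "\<dots> = (LINT u:{0<..<1}|lborel. g (I u))"
    by (simp add: integral_restrict_space set_lebesgue_integral_def)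
  finally show ?thesis .
qed

text \<open>The open unit interval carries the generalized inverse of the distribution function of the
normalized measure. Its values at the end points are set by hand: \<open>Q 0 = a\<close> because the value at
\<open>0\<close> is used as an eigenvalue, which places \<open>a\<close> in the spectrum. A measure of mass \<open>0\<close> has no
normalization, and the constant \<open>a\<close> serves as \<open>Q\<close>.\<close>

lemma quantile_function:
  fixes \<sigma> :: "real measure"
  assumes \<sigma>: "finite_measure \<sigma>" "sets \<sigma> = sets borel"
    and null: "emeasure \<sigma> (- {a..b}) = 0" and "a \<le> b"
  shows "\<exists>Q :: real \<Rightarrow> real. mono_on {0..1} Q \<and> (\<forall>u\<in>{0..1}. Q u \<in> {a..b}) \<and> Q 0 = a \<and>
    (\<forall>g :: real \<Rightarrow> complex. continuous_on UNIV g \<longrightarrow> (\<lambda>u. g (Q u)) integrable_on {0..1} \<and>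
      (LINT x|\<sigma>. g x) = measure \<sigma> UNIV *\<^sub>R integral {0..1} (\<lambda>u. g (Q u)))"
proof (cases "measure \<sigma> UNIV = 0")
  case True
  interpret finite_measure \<sigma> by fact
  have "space \<sigma> = UNIV"
    using \<sigma>(2) by (metis sets_eq_imp_space_eq space_borel)
  then have "emeasure \<sigma> (space \<sigma>) = 0"
    using True by (simp add: emeasure_eq_measure)
  then have "(LINT x|\<sigma>. g x) = 0" for g :: "real \<Rightarrow> complex"
    by (rule integral_eq_zero_AE[OF emeasure_0_AE])
  moreover have "(\<lambda>u :: real. z) integrable_on {0..1}" for z :: complex
    by (intro integrable_continuous_interval continuous_on_const)
  ultimately show ?thesis
    using \<open>a \<le> b\<close> True by (intro exI[of _ "\<lambda>_. a"]) (simp add: mono_on_def)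
next
  case False
  interpret \<sigma>: finite_measure \<sigma> by fact
  define m where "m = measure \<sigma> UNIV"
  have "m > 0"
    using False measure_nonneg[of \<sigma> UNIV] by (simp add: m_def less_le)
  have space_\<sigma>: "space \<sigma> = UNIV"
    using \<sigma>(2) by (metis sets_eq_imp_space_eq space_borel)
  define M where "M = density \<sigma> (\<lambda>_. ennreal (1 / m))"
  have emeasure_M: "emeasure M A = ennreal (1 / m) * emeasure \<sigma> A" if "A \<in> sets borel" for A
    unfolding M_def using that \<sigma>(2) by (simp add: emeasure_density_const)
  have "emeasure \<sigma> UNIV = ennreal m"
    by (simp add: \<sigma>.emeasure_eq_measure m_def)
  then have "emeasure M UNIV = ennreal (1 / m) * ennreal m"
    using emeasure_M[of UNIV] by simp
  also have "\<dots> = 1"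
    using \<open>m > 0\<close> by (subst ennreal_mult[symmetric]) simp_all
  finally have M_UNIV: "emeasure M UNIV = 1" .
  have "real_distribution M"
  proof (intro real_distribution.intro real_distribution_axioms.intro prob_spaceI)
    have "space M = UNIV"
      by (simp add: M_def space_\<sigma>)
    then show "emeasure M (space M) = 1"
      using M_UNIV by simp
    show "sets M = sets borel"
      by (simp add: M_def \<sigma>(2))
  qed
  then interpret cdf_distribution M
    unfolding cdf_distribution_def .
  have null_M: "emeasure M (- {a..b}) = 0"
    using emeasure_M[of "- {a..b}"] null by simp
  have C_b: "C b = 1"
  proof -
    have "1 = prob UNIV"
      using prob_space by simp
    also have "\<dots> \<le> prob ({..b} \<union> - {a..b})"
      by (rule finite_measure_mono) auto
    also have "\<dots> \<le> prob {..b} + prob (- {a..b})"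
      by (rule measure_Un_le) auto
    also have "prob (- {a..b}) = 0"
      unfolding measure_def null_M by simp
    finally show ?thesis
      unfolding cdf_def by (intro antisym prob_le_1) simp
  qed
  have C_below: "C x = 0" if "x < a" for x
  proof -
    have "prob {..x} \<le> prob (- {a..b})"
      using that by (intro finite_measure_mono) auto
    also have "\<dots> = 0"
      unfolding measure_def null_M by simp
    finally show ?thesis
      using measure_nonneg[of M "{..x}"] by (simp add: cdf_def)
  qed
  have I_range: "I u \<in> {a..b}" if "u \<in> {0<..<1}" for u
  proof -
    have "I u \<le> b"
      using pseudoinverse[of u b] that C_b by simp
    moreover have "\<not> I u < a"
    proof
      assume "I u < a"
      moreover have "u \<le> C (I u)"
        using pseudoinverse[of u "I u"] that by simp
      ultimately show False
        using C_below that by simp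
    qed
    ultimately show ?thesis by simp
  qed
  define Q where "Q u = (if u \<le> 0 then a else if u \<ge> 1 then b else I u)" for u
  have Q_range: "Q u \<in> {a..b}" if "u \<in> {0..1}" for u
  proof -
    consider "u \<le> 0" | "u \<ge> 1" | "u \<in> {0<..<1}"
      by fastforce
    then show ?thesis
      by cases (use that I_range[of u] \<open>a \<le> b\<close> in \<open>simp_all add: Q_def\<close>)
  qed
  have "mono_on {0..1} Q"
  proof (rule mono_onI)
    fix u v :: real assume uv: "u \<in> {0..1}" "v \<in> {0..1}" "u \<le> v"
    show "Q u \<le> Q v"
    proof (cases "u \<le> 0 \<or> v \<ge> 1")
      case True
      then show ?thesis
        using Q_range[OF uv(1)] Q_range[OF uv(2)] by (auto simp: Q_def split: if_splits)
    next
      case False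
      then have "I u \<le> I v"
        using uv by (intro mono_onD[OF mono_I]) auto
      then show ?thesis
        using False uv by (simp add: Q_def)
    qed
  qed
  moreover have "\<forall>u\<in>{0..1}. Q u \<in> {a..b}"
    using Q_range by blast
  moreover have "(\<lambda>u. g (Q u)) integrable_on {0..1} \<and>
      (LINT x|\<sigma>. g x) = m *\<^sub>R integral {0..1} (\<lambda>u. g (Q u))"
    if g: "continuous_on UNIV g" for g :: "real \<Rightarrow> complex"
  proof -
    let ?R = "restrict_space lborel {0<..<1::real}"
    have g_meas: "g \<in> borel_measurable borel"
      using g by (rule borel_measurable_continuous_onI)
    interpret R: prob_space ?R
      by (auto simp: space_restrict_space emeasure_restrict_space intro!: prob_spaceI)
    have "bounded (g ` {a..b})"
      by (intro compact_imp_bounded compact_continuous_image continuous_on_subset[OF g]) simp_all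
    then obtain K where K: "\<And>x. x \<in> {a..b} \<Longrightarrow> norm (g x) \<le> K"
      unfolding bounded_iff by blast
    have I_meas: "I \<in> borel_measurable ?R"
      using measurable_CI by (simp add: measurable_cong_sets[OF sets_restrict_space_cong[OF sets_lborel] refl])
    have "integrable ?R (\<lambda>u. g (I u))"
    proof (rule R.integrable_const_bound[of _ K])
      show "AE u in ?R. norm (g (I u)) \<le> K"
        by (rule AE_I2) (use K I_range in \<open>auto simp: space_restrict_space\<close>)
      show "(\<lambda>u. g (I u)) \<in> borel_measurable ?R"
        using measurable_compose[OF I_meas g_meas] .
    qed
    then have int: "set_integrable lborel {0<..<1} (\<lambda>u. g (I u))"
      by (simp add: integrable_restrict_space set_integrable_def)
    have eq: "g (I u) = g (Q u)" if "u \<in> {0<..<1}" for u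
      using that by (simp add: Q_def)
    have "(\<lambda>u. g (Q u)) integrable_on {0<..<1}"
      using set_borel_integral_eq_integral(1)[OF int] eq by (rule integrable_eq)
    moreover have "(LINT x|M. g x) = integral {0..1} (\<lambda>u. g (Q u))"
    proof -
      have "(LINT x|M. g x) = integral {0<..<1} (\<lambda>u. g (I u))"
        unfolding quantile_function_of_distribution[OF real_distribution_axioms null_M g]
        using set_borel_integral_eq_integral(2)[OF int] .
      also have "\<dots> = integral {0<..<1} (\<lambda>u. g (Q u))"
        using eq by (rule integral_cong)
      finally show ?thesis
        by (simp only: integral_open_interval_real)
    qed
    moreover have "(LINT x|\<sigma>. g x) = m *\<^sub>R (LINT x|M. g x)"
    proof -
      have "(LINT x|M. g x) = (1 / m) *\<^sub>R (LINT x|\<sigma>. g x)"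
        unfolding M_def using \<open>m > 0\<close> g_meas \<sigma>(2)
        by (subst integral_density) (simp_all add: measurable_cong_sets[OF \<sigma>(2) refl])
      then show ?thesis
        using \<open>m > 0\<close> by simp
    qed
    ultimately show ?thesis
      by (simp add: integrable_on_open_interval_real)
  qed
  ultimately show ?thesis
    unfolding m_def[symmetric] by (intro exI[of _ Q] conjI allI impI) (simp_all add: Q_def)
qed

section \<open>Riemann sums and logarithmic asymptotics\<close>

text \<open>On a subinterval the integrand differs from its value at the left end point by at most \<open>L\<close> times
the increment of \<open>Q\<close>, even where \<open>Q\<close> jumps. These increments add up to \<open>Q\<close> at the right end minus \<open>Q 0\<close>.\<close>

lemma Riemann_sum_error_telescopes:
  fixes g :: "real \<Rightarrow> 'b :: banach"
  assumes mono: "mono_on {0..1} Q" and range: "\<And>u. u \<in> {0..1} \<Longrightarrow> Q u \<in> {a..b}"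
    and Lip: "\<And>x y. x \<in> {a..b} \<Longrightarrow> y \<in> {a..b} \<Longrightarrow> norm (g x - g y) \<le> L * \<bar>x - y\<bar>" and "L \<ge> 0"
    and int: "(\<lambda>u. g (Q u)) integrable_on {0..1}" and "N > 0" and "m \<le> N"
  shows "norm ((\<Sum>j<m. (1 / real N) *\<^sub>R g (Q (real j / real N))) - integral {0..real m / real N} (\<lambda>u. g (Q u)))
    \<le> L / real N * (Q (real m / real N) - Q 0)"
  using \<open>m \<le> N\<close>
proof (induction m)
  case (Suc m)
  define s where "s = real m / real N"
  define t where "t = real (Suc m) / real N"
  have st: "0 \<le> s" "s \<le> t" "t \<le> 1" "t - s = 1 / real N"
    using \<open>N > 0\<close> Suc.prems by (auto simp: s_def t_def divide_simps)
  let ?f = "\<lambda>u. g (Q u)"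
  have int_t: "?f integrable_on {0..t}" and int_st: "?f integrable_on {s..t}"
    using st by (auto intro!: integrable_subinterval_real[OF int])
  have split: "integral {0..t} ?f = integral {0..s} ?f + integral {s..t} ?f"
    using st int_t by (simp add: Henstock_Kurzweil_Integration.integral_combine)
  have "((\<lambda>u. ?f s - ?f u) has_integral (t - s) *\<^sub>R ?f s - integral {s..t} ?f) {s..t}"
    using st int_st has_integral_const_real[of "?f s" s t]
    by (intro has_integral_diff) (auto simp: integrable_integral)
  then have "norm ((t - s) *\<^sub>R ?f s - integral {s..t} ?f) \<le> L * (Q t - Q s) * measure lborel (cbox s t)"
    unfolding box_real(2)[symmetric]
  proof (rule has_integral_bound[rotated])
    have mono': "Q u \<le> Q v" if "0 \<le> u" "u \<le> v" "v \<le> 1" for u v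
      using mono_onD[OF mono, of u v] that by simp
    show "0 \<le> L * (Q t - Q s)"
      using \<open>L \<ge> 0\<close> mono'[of s t] st by simp
    show "norm (?f s - ?f u) \<le> L * (Q t - Q s)" if "u \<in> cbox s t" for u
    proof -
      have u: "s \<le> u" "u \<le> t"
        using that by auto
      have "norm (?f s - ?f u) \<le> L * \<bar>Q s - Q u\<bar>"
        using u st by (intro Lip range) auto
      also have "\<bar>Q s - Q u\<bar> \<le> Q t - Q s"
        using mono'[of s u] mono'[of u t] u st by simp
      then have "L * \<bar>Q s - Q u\<bar> \<le> L * (Q t - Q s)"
        using \<open>L \<ge> 0\<close> by (rule mult_left_mono)
      finally show ?thesis .
    qed
  qed
  then have "norm ((1 / real N) *\<^sub>R ?f s - integral {s..t} ?f) \<le> L / real N * (Q t - Q s)"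
    using st by (simp add: mult.commute)
  moreover have "norm ((\<Sum>j<m. (1 / real N) *\<^sub>R g (Q (real j / real N))) - integral {0..s} ?f) \<le>
      L / real N * (Q s - Q 0)"
    using Suc unfolding s_def by simp
  ultimately have "norm (((\<Sum>j<m. (1 / real N) *\<^sub>R g (Q (real j / real N))) - integral {0..s} ?f) +
      ((1 / real N) *\<^sub>R ?f s - integral {s..t} ?f)) \<le> L / real N * (Q s - Q 0) + L / real N * (Q t - Q s)"
    by (intro norm_triangle_mono)
  then show ?case
    unfolding t_def[symmetric] split by (simp add: s_def algebra_simps)
qed simp

lemma Riemann_sum_error:
  fixes g :: "real \<Rightarrow> 'b :: banach"
  assumes "mono_on {0..1} Q" and range: "\<And>u. u \<in> {0..1} \<Longrightarrow> Q u \<in> {a..b}"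
    and "\<And>x y. x \<in> {a..b} \<Longrightarrow> y \<in> {a..b} \<Longrightarrow> norm (g x - g y) \<le> L * \<bar>x - y\<bar>" and "L \<ge> 0"
    and "(\<lambda>u. g (Q u)) integrable_on {0..1}" and "N > 0"
  shows "norm ((\<Sum>j<N. (1 / real N) *\<^sub>R g (Q (real j / real N))) - integral {0..1} (\<lambda>u. g (Q u)))
    \<le> L * (b - a) / real N"
proof -
  have "norm ((\<Sum>j<N. (1 / real N) *\<^sub>R g (Q (real j / real N))) - integral {0..1} (\<lambda>u. g (Q u)))
      \<le> L / real N * (Q 1 - Q 0)"
    using Riemann_sum_error_telescopes[OF assms order_refl] \<open>N > 0\<close> by simp
  also have "\<dots> \<le> L / real N * (b - a)"
    using range[of 0] range[of 1] \<open>L \<ge> 0\<close> by (intro mult_left_mono) auto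
  finally show ?thesis by simp
qed

lemma sum_lessThan_add:
  fixes d :: "nat \<Rightarrow> 'b :: comm_monoid_add"
  shows "(\<Sum>i<m + n. d i) = (\<Sum>i<m. d i) + (\<Sum>j<n. d (m + j))"
  by (induction n) (simp_all add: add.assoc)

text \<open>The block errors form a geometric series, so \<open>M\<close> complete blocks add up to \<open>M l + O(1)\<close>. The
incomplete last block has at most \<open>2\<^sup>M\<close> terms of size at most \<open>C / 2\<^sup>M\<close>, and \<open>M\<close> differs from
\<open>ln (n + 1) / ln 2\<close> by at most \<open>1\<close>.\<close>

lemma dyadic_blocks_logarithmic:
  fixes d :: "nat \<Rightarrow> complex"
  assumes block: "\<And>m. cmod ((\<Sum>j<2 ^ m. d (2 ^ m + j)) - l) \<le> K / 2 ^ m"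
    and bound: "\<And>n. cmod (d n) \<le> C / (real n + 1)"
  shows "cmod ((\<Sum>i<n. d i) - l / complex_of_real (ln 2) * complex_of_real (ln (real n + 1))) \<le> 2 * C + 2 * K + cmod l"
proof -
  have "C \<ge> 0"
    using order_trans[OF norm_ge_zero bound[of 0]] by simp
  have "K \<ge> 0"
    using order_trans[OF norm_ge_zero block[of 0]] by simp
  have dyadic: "cmod ((\<Sum>i<2 ^ M. d i) - of_nat M * l) \<le> C + 2 * K * (1 - 1 / 2 ^ M)" for M
  proof (induction M)
    case 0
    then show ?case using bound[of 0] by simp
  next
    case (Suc M)
    have "(\<Sum>i<2 ^ Suc M. d i) - of_nat (Suc M) * l =
        ((\<Sum>i<2 ^ M. d i) - of_nat M * l) + ((\<Sum>j<2 ^ M. d (2 ^ M + j)) - l)"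
      using sum_lessThan_add[of d "2 ^ M" "2 ^ M"] by (simp add: mult_2 algebra_simps)
    also have "cmod \<dots> \<le> (C + 2 * K * (1 - 1 / 2 ^ M)) + K / 2 ^ M"
      by (rule norm_triangle_mono[OF Suc block])
    also have "\<dots> = C + 2 * K * (1 - 1 / 2 ^ Suc M)"
      by (simp add: algebra_simps)
    finally show ?case .
  qed
  show ?thesis
  proof (cases "n = 0")
    case True
    then show ?thesis using \<open>C \<ge> 0\<close> \<open>K \<ge> 0\<close> by simp
  next
    case False
    define M where "M = floor_log n"
    have M: "2 ^ M \<le> n" "n < 2 ^ Suc M"
      using False floor_log_exp2_le[of n] floor_log_exp2_gt[of n] by (auto simp: M_def)
    define r where "r = n - 2 ^ M"
    have n: "n = 2 ^ M + r" and r: "r \<le> 2 ^ M"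
      using M by (auto simp: r_def)
    have "cmod (\<Sum>j<r. d (2 ^ M + j)) \<le> (\<Sum>j<r. C / 2 ^ M)"
    proof (rule sum_norm_le)
      fix j
      have "C / (real (2 ^ M + j) + 1) \<le> C / 2 ^ M"
      proof (intro divide_left_mono mult_pos_pos)
        show "0 < real (2 ^ M + j) + 1"
          by (rule add_nonneg_pos) simp_all
      qed (use \<open>C \<ge> 0\<close> in simp_all)
      then show "cmod (d (2 ^ M + j)) \<le> C / 2 ^ M"
        using bound[of "2 ^ M + j"] by linarith
    qed
    also have "\<dots> = real r * (C / 2 ^ M)"
      by simp
    also have "\<dots> \<le> 2 ^ M * (C / 2 ^ M)"
    proof (rule mult_right_mono)
      show "real r \<le> 2 ^ M"
        using of_nat_mono[OF r, where 'a = real] by simp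
    qed (use \<open>C \<ge> 0\<close> in simp)
    finally have rest: "cmod (\<Sum>j<r. d (2 ^ M + j)) \<le> C" by simp
    have main: "cmod ((\<Sum>i<2 ^ M. d i) - of_nat M * l) \<le> C + 2 * K"
    proof -
      have "2 * K * (1 - 1 / 2 ^ M) \<le> 2 * K * 1"
        using \<open>K \<ge> 0\<close> by (intro mult_left_mono) auto
      with dyadic[of M] show ?thesis by linarith
    qed
    have ln: "\<bar>real M - ln (real n + 1) / ln 2\<bar> \<le> 1"
    proof -
      have "(2 :: real) ^ M \<le> real n"
        using of_nat_mono[OF M(1), where 'a = real] by (simp only: of_nat_power of_nat_numeral)
      then have pow: "(2 :: real) ^ M \<le> real n + 1"
        by linarith
      have "real M * ln 2 = ln (2 ^ M)"
        by (simp add: ln_realpow)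
      also have "\<dots> \<le> ln (real n + 1)"
        using pow by (intro ln_mono) auto
      finally have lower: "real M * ln 2 \<le> ln (real n + 1)" .
      have "real (n + 1) \<le> real (2 ^ Suc M)"
        using M(2) by (intro of_nat_mono) simp
      then have "ln (real n + 1) \<le> ln (2 ^ Suc M)"
        by (intro ln_mono) auto
      also have "\<dots> = (real M + 1) * ln 2"
        by (subst ln_realpow) auto
      finally have upper: "ln (real n + 1) \<le> (real M + 1) * ln 2" .
      have "real M \<le> ln (real n + 1) / ln 2" "ln (real n + 1) / ln 2 \<le> real M + 1"
        using lower upper by (simp_all add: pos_le_divide_eq pos_divide_le_eq)
      then show ?thesis by linarith
    qed
    have "of_nat M * l - l / complex_of_real (ln 2) * complex_of_real (ln (real n + 1)) =
        complex_of_real (real M - ln (real n + 1) / ln 2) * l"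
      by (simp add: algebra_simps)
    also have "cmod \<dots> = \<bar>real M - ln (real n + 1) / ln 2\<bar> * cmod l"
      by (simp only: norm_mult norm_of_real)
    also have "\<dots> \<le> 1 * cmod l"
      using ln norm_ge_zero by (rule mult_right_mono)
    finally have log: "cmod (of_nat M * l - l / complex_of_real (ln 2) * complex_of_real (ln (real n + 1))) \<le> cmod l"
      by simp
    have "(\<Sum>i<n. d i) - l / complex_of_real (ln 2) * complex_of_real (ln (real n + 1)) =
        (((\<Sum>i<2 ^ M. d i) - of_nat M * l) + (\<Sum>j<r. d (2 ^ M + j))) +
        (of_nat M * l - l / complex_of_real (ln 2) * complex_of_real (ln (real n + 1)))"
      unfolding n sum_lessThan_add by simp
    also have "cmod \<dots> \<le> ((C + 2 * K) + C) + cmod l"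
      by (intro norm_triangle_mono main rest log)
    finally show ?thesis by simp
  qed
qed

section \<open>Functions of class \<open>C\<^sup>3\<close>\<close>

lemma Ck_differentiable:
  assumes "Ck (Suc k) f"
  shows "(f has_vector_derivative vector_derivative f (at x)) (at x)"
  using assms by (simp flip: vector_derivative_works)

lemma Ck_continuous: "Ck k f \<Longrightarrow> continuous_on UNIV f"
proof (cases k)
  case (Suc j)
  moreover assume "Ck k f"
  ultimately have "f differentiable (at x)" for x by simp
  then show ?thesis
    by (simp add: continuous_at_imp_continuous_on differentiable_imp_continuous_within)
qed simp

lemma Ck3_derivative_Lipschitz:
  fixes f :: "real \<Rightarrow> complex"
  assumes "Ck 3 f"
  shows "\<exists>L\<ge>0. (\<forall>x\<in>{a..b}. cmod (vector_derivative f (at x)) \<le> L) \<and>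
    (\<forall>x\<in>{a..b}. \<forall>y\<in>{a..b}. cmod (vector_derivative f (at x) - vector_derivative f (at y)) \<le> L * \<bar>x - y\<bar>)"
proof -
  let ?f' = "\<lambda>x. vector_derivative f (at x)"
  let ?f'' = "\<lambda>x. vector_derivative ?f' (at x)"
  have C: "Ck (Suc 1) ?f'" "Ck 1 ?f''"
    using assms by (simp_all add: eval_nat_numeral)
  have bdd: "\<exists>K. \<forall>x\<in>{a..b}. cmod (g x) \<le> K" if "continuous_on UNIV g" for g :: "real \<Rightarrow> complex"
  proof -
    have "bounded (g ` {a..b})"
      by (intro compact_imp_bounded compact_continuous_image continuous_on_subset[OF that]) simp_all
    then show ?thesis
      unfolding bounded_iff by blast
  qed
  obtain K1 where K1: "\<forall>x\<in>{a..b}. cmod (?f' x) \<le> K1"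
    using bdd[OF Ck_continuous[OF C(1)]] by blast
  obtain K2 where K2: "\<forall>x\<in>{a..b}. cmod (?f'' x) \<le> K2"
    using bdd[OF Ck_continuous[OF C(2)]] by blast
  define L where "L = max 0 (max K1 K2)"
  have "cmod (?f' x - ?f' y) \<le> L * norm (x - y)" if "x \<in> {a..b}" "y \<in> {a..b}" for x y
  proof (rule differentiable_bound[OF convex_closed_interval])
    show "(?f' has_derivative (\<lambda>h. h *\<^sub>R ?f'' z)) (at z within {a..b})" if "z \<in> {a..b}" for z
      using Ck_differentiable[OF C(1), of z] unfolding has_vector_derivative_def
      by (rule has_derivative_at_withinI)
    show "onorm (\<lambda>h. h *\<^sub>R ?f'' z) \<le> L" if "z \<in> {a..b}" for z
    proof (rule onorm_le)
      have "cmod (?f'' z) \<le> L"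
        using K2 that by (auto simp: L_def le_max_iff_disj)
      then show "cmod (h *\<^sub>R ?f'' z) \<le> L * norm h" for h
        by (simp add: mult.commute[of L] mult_left_mono)
    qed
  qed (use that in auto)
  moreover have "\<forall>x\<in>{a..b}. cmod (?f' x) \<le> L"
    using K1 by (auto simp: L_def le_max_iff_disj)
  ultimately show ?thesis
    by (intro exI[of _ L]) (simp add: L_def)
qed

lemma increment_estimates:
  fixes f :: "real \<Rightarrow> complex"
  assumes f': "\<And>x. (f has_vector_derivative f' x) (at x)"
    and bound: "\<And>y. y \<in> {a..b} \<Longrightarrow> cmod (f' y) \<le> L"
    and Lip: "\<And>y z. y \<in> {a..b} \<Longrightarrow> z \<in> {a..b} \<Longrightarrow> cmod (f' y - f' z) \<le> L * \<bar>y - z\<bar>"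
    and "L \<ge> 0" and x: "a \<le> x" "0 \<le> v" "x + v \<le> b"
  shows "cmod (f (x + v) - f x) \<le> L * v" "cmod (f (x + v) - f x - v *\<^sub>R f' x) \<le> L * v\<^sup>2"
proof -
  have "norm (f (x + v) - f x) \<le> L * norm (x + v - x)"
  proof (rule differentiable_bound[OF convex_closed_interval])
    show "(f has_derivative (\<lambda>h. h *\<^sub>R f' z)) (at z within {a..b})" for z
      using f'[of z] unfolding has_vector_derivative_def by (rule has_derivative_at_withinI)
    show "onorm (\<lambda>h. h *\<^sub>R f' z) \<le> L" if "z \<in> {a..b}" for z
      by (rule onorm_le) (use bound[OF that] in \<open>simp add: mult.commute[of L] mult_left_mono\<close>)
  qed (use x in auto)
  then show "cmod (f (x + v) - f x) \<le> L * v"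
    using x by simp
  have "norm (f (x + v) - f x - ((x + v) - x) *\<^sub>R f' x) \<le> norm ((x + v) - x) * (L * v)"
  proof (rule vector_differentiable_bound_linearization[where S = "{x..x + v}"])
    show "(f has_vector_derivative f' z) (at z within {x..x + v})" for z
      using f' by (rule has_vector_derivative_at_within)
    show "closed_segment x (x + v) \<subseteq> {x..x + v}"
      using x by (simp add: closed_segment_eq_real_ivl)
    show "norm (f' z - f' x) \<le> L * v" if "z \<in> {x..x + v}" for z
    proof -
      have "norm (f' z - f' x) \<le> L * \<bar>z - x\<bar>"
        using that x by (intro Lip) auto
      also have "\<dots> \<le> L * v"
        using that \<open>L \<ge> 0\<close> by (intro mult_left_mono) auto
      finally show ?thesis .
    qed
  qed (use x in auto)
  then show "cmod (f (x + v) - f x - v *\<^sub>R f' x) \<le> L * v\<^sup>2"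
    using x by (simp add: power2_eq_square mult.left_commute mult.commute)
qed

section \<open>The eigenvalue sequences\<close>

text \<open>For \<open>n = 2\<^sup>k + j\<close> with \<open>j < 2\<^sup>k\<close> the eigenvalues are \<open>h n = Q(j/2\<^sup>k)\<close> and \<open>v n = c/2\<^sup>k\<close>. The quadratic
Taylor remainders of a block amount to \<open>2\<^sup>k O(1/4\<^sup>k)\<close>, which is of the same order as the error of the
Riemann sum. The index \<open>0\<close>, which belongs to no block, is free to place \<open>b\<close> in the spectrum.\<close>

lemma eigenvalue_sequences:
  fixes \<sigma> :: "real measure"
  assumes \<sigma>: "finite_measure \<sigma>" "sets \<sigma> = sets borel"
    and null: "emeasure \<sigma> (- {a..b}) = 0" and "a \<le> b"
  shows "\<exists>h v :: nat \<Rightarrow> real. \<exists>C. a \<in> range h \<and> b \<in> range h \<and> (\<forall>n. h n \<in> {a..b}) \<and>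
    (\<forall>n. 0 \<le> v n \<and> v n \<le> C / (real n + 1)) \<and>
    (\<forall>f. Ck 3 f \<longrightarrow> (\<exists>D K. \<forall>n. cmod (f (h n + v n) - f (h n)) \<le> D / (real n + 1) \<and>
      cmod ((\<Sum>i<n. f (h i + v i) - f (h i)) -
        (LINT x|\<sigma>. vector_derivative f (at x)) * complex_of_real (ln (real n + 1))) \<le> K))"
proof -
  obtain Q :: "real \<Rightarrow> real" where mono: "mono_on {0..1} Q"
    and range: "\<And>u. u \<in> {0..1} \<Longrightarrow> Q u \<in> {a..b}" and Q0: "Q 0 = a"
    and int: "\<And>g :: real \<Rightarrow> complex. continuous_on UNIV g \<Longrightarrow> (\<lambda>u. g (Q u)) integrable_on {0..1}"
    and push: "\<And>g :: real \<Rightarrow> complex. continuous_on UNIV g \<Longrightarrow>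
      (LINT x|\<sigma>. g x) = measure \<sigma> UNIV *\<^sub>R integral {0..1} (\<lambda>u. g (Q u))"
    using quantile_function[OF \<sigma> null \<open>a \<le> b\<close>] by blast
  \<comment> \<open>The factor \<open>ln 2\<close> compensates for the number \<open>ln n / ln 2\<close> of blocks below \<open>n\<close>.\<close>
  define c where "c = ln 2 * measure \<sigma> UNIV"
  have "c \<ge> 0"
    by (simp add: c_def)
  define h where "h n = (if n = 0 then b else Q (real n / 2 ^ floor_log n - 1))" for n
  define v where "v n = (if n = 0 then 0 else c / 2 ^ floor_log n)" for n
  have pow: "(2 :: real) ^ floor_log n \<le> real n" "real n + 1 \<le> 2 * 2 ^ floor_log n" if "n > 0" for n
  proof -
    have "2 ^ floor_log n \<le> n" "n + 1 \<le> 2 * 2 ^ floor_log n"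
      using floor_log_exp2_le[OF that] floor_log_exp2_gt[of n] by simp_all
    then have "real (2 ^ floor_log n) \<le> real n" "real (n + 1) \<le> real (2 * 2 ^ floor_log n)"
      by (simp_all only: of_nat_le_iff)
    then show "(2 :: real) ^ floor_log n \<le> real n" "real n + 1 \<le> 2 * 2 ^ floor_log n"
      by simp_all
  qed
  have h_range: "h n \<in> {a..b}" for n
  proof (cases "n = 0")
    case False
    then have "real n / 2 ^ floor_log n - 1 \<in> {0..1}"
      using pow[of n] by (simp add: field_simps)
    then show ?thesis
      using False range by (simp add: h_def)
  qed (use \<open>a \<le> b\<close> in \<open>simp add: h_def\<close>)
  have v_bounds: "0 \<le> v n" "v n \<le> c" "v n \<le> 2 * c / (real n + 1)" for n
  proof -
    show "0 \<le> v n"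
      using \<open>c \<ge> 0\<close> by (simp add: v_def)
    show "v n \<le> c"
    proof (cases "n = 0")
      case False
      have "c / 2 ^ floor_log n \<le> c / 1"
        using \<open>c \<ge> 0\<close> by (intro divide_left_mono) auto
      then show ?thesis using False by (simp add: v_def)
    qed (use \<open>c \<ge> 0\<close> in \<open>simp add: v_def\<close>)
    show "v n \<le> 2 * c / (real n + 1)"
    proof (cases "n = 0")
      case False
      have "c / 2 ^ floor_log n = 2 * c / (2 * 2 ^ floor_log n)"
        by simp
      also have "\<dots> \<le> 2 * c / (real n + 1)"
        using \<open>c \<ge> 0\<close> pow(2)[of n] False by (intro divide_left_mono mult_pos_pos) auto
      finally show ?thesis using False by (simp add: v_def)
    qed (use \<open>c \<ge> 0\<close> in \<open>simp add: v_def\<close>)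
  qed
  have "\<exists>D K. \<forall>n. cmod (f (h n + v n) - f (h n)) \<le> D / (real n + 1) \<and>
      cmod ((\<Sum>i<n. f (h i + v i) - f (h i)) -
        (LINT x|\<sigma>. vector_derivative f (at x)) * complex_of_real (ln (real n + 1))) \<le> K"
    if f: "Ck 3 f" for f
  proof -
    let ?f' = "\<lambda>x. vector_derivative f (at x)"
    define d where "d n = f (h n + v n) - f (h n)" for n
    define J where "J = integral {0..1} (\<lambda>u. ?f' (Q u))"
    have f_deriv: "(f has_vector_derivative ?f' x) (at x)" for x
      using f by (intro Ck_differentiable[of 2]) (simp add: eval_nat_numeral)
    have f'_cont: "continuous_on UNIV ?f'"
      using f by (intro Ck_continuous[of 2]) (simp add: eval_nat_numeral)
    obtain L where "L \<ge> 0" and L: "\<And>x. x \<in> {a..b + c} \<Longrightarrow> cmod (?f' x) \<le> L"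
      and Lip: "\<And>x y. x \<in> {a..b + c} \<Longrightarrow> y \<in> {a..b + c} \<Longrightarrow> cmod (?f' x - ?f' y) \<le> L * \<bar>x - y\<bar>"
      using Ck3_derivative_Lipschitz[OF f, of a "b + c"] by blast
    have est: "cmod (d n) \<le> L * v n" "cmod (d n - v n *\<^sub>R ?f' (h n)) \<le> L * (v n)\<^sup>2" for n
      unfolding d_def using h_range[of n] v_bounds[of n]
      by (auto intro!: increment_estimates[OF f_deriv L Lip \<open>L \<ge> 0\<close>])
    have d_bound: "cmod (d n) \<le> 2 * L * c / (real n + 1)" for n
    proof -
      have "L * v n \<le> L * (2 * c / (real n + 1))"
        using v_bounds(3) \<open>L \<ge> 0\<close> by (rule mult_left_mono)
      with est(1)[of n] show ?thesis by (simp add: mult.assoc mult.left_commute)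
    qed
    have block: "cmod ((\<Sum>j<2 ^ m. d (2 ^ m + j)) - complex_of_real c * J) \<le> (L * c\<^sup>2 + c * L * (b - a)) / 2 ^ m"
      for m
    proof -
      have hv: "h (2 ^ m + j) = Q (real j / real (2 ^ m))" "v (2 ^ m + j) = c / 2 ^ m" if "j < 2 ^ m" for j
      proof -
        have "floor_log (2 ^ m + j) = m"
          using that by (intro floor_log_eqI) auto
        then show "h (2 ^ m + j) = Q (real j / real (2 ^ m))" "v (2 ^ m + j) = c / 2 ^ m"
          by (simp_all add: h_def v_def add_divide_distrib)
      qed
      let ?R = "\<Sum>j<2 ^ m. (1 / real (2 ^ m)) *\<^sub>R ?f' (Q (real j / real (2 ^ m)))"
      have main: "(\<Sum>j<2 ^ m. v (2 ^ m + j) *\<^sub>R ?f' (h (2 ^ m + j))) = c *\<^sub>R ?R"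
        unfolding scaleR_sum_right by (intro sum.cong refl) (simp add: hv)
      have insert: "x - y = (x - z) + (z - y)" for x y z :: complex
        by simp
      have "(\<Sum>j<2 ^ m. d (2 ^ m + j)) - complex_of_real c * J =
          (\<Sum>j<2 ^ m. d (2 ^ m + j) - v (2 ^ m + j) *\<^sub>R ?f' (h (2 ^ m + j))) + c *\<^sub>R (?R - J)"
        unfolding sum_subtractf main scaleR_diff_right scaleR_conv_of_real[of c J] by (rule insert)
      also have "cmod \<dots> \<le> L * c\<^sup>2 / 2 ^ m + c * (L * (b - a) / real (2 ^ m))"
      proof (rule norm_triangle_mono)
        have "cmod (\<Sum>j<2 ^ m. d (2 ^ m + j) - v (2 ^ m + j) *\<^sub>R ?f' (h (2 ^ m + j))) \<le>
            (\<Sum>j<(2 :: nat) ^ m. L * (c / 2 ^ m)\<^sup>2)"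
        proof (rule sum_norm_le)
          fix j :: nat assume "j \<in> {..<2 ^ m}"
          then show "cmod (d (2 ^ m + j) - v (2 ^ m + j) *\<^sub>R ?f' (h (2 ^ m + j))) \<le> L * (c / 2 ^ m)\<^sup>2"
            using est(2)[of "2 ^ m + j"] hv(2)[of j] by simp
        qed
        also have "\<dots> = L * c\<^sup>2 / 2 ^ m"
          by (simp add: power2_eq_square)
        finally show "cmod (\<Sum>j<2 ^ m. d (2 ^ m + j) - v (2 ^ m + j) *\<^sub>R ?f' (h (2 ^ m + j))) \<le>
            L * c\<^sup>2 / 2 ^ m" .
        have "cmod (?R - J) \<le> L * (b - a) / real (2 ^ m)"
          unfolding J_def using \<open>c \<ge> 0\<close>
          by (intro Riemann_sum_error[OF mono range _ \<open>L \<ge> 0\<close> int[OF f'_cont]] Lip) auto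
        then show "cmod (c *\<^sub>R (?R - J)) \<le> c * (L * (b - a) / real (2 ^ m))"
          using \<open>c \<ge> 0\<close> by (simp only: norm_scaleR abs_of_nonneg mult_left_mono)
      qed
      also have "\<dots> = (L * c\<^sup>2 + c * L * (b - a)) / 2 ^ m"
        by (simp add: add_divide_distrib mult.assoc)
      finally show ?thesis .
    qed
    have limit: "complex_of_real c * J / complex_of_real (ln 2) = (LINT x|\<sigma>. ?f' x)"
      unfolding push[OF f'_cont] J_def[symmetric] by (simp add: c_def scaleR_conv_of_real)
    show ?thesis
      using dyadic_blocks_logarithmic[OF block d_bound] d_bound unfolding limit d_def by blast
  qed
  moreover have "h 1 = a" "h 0 = b"
    by (simp_all add: h_def Q0)
  ultimately show ?thesis
    using h_range v_bounds by (intro exI[of _ h] exI[of _ v] exI[of _ "2 * c"]) (auto intro: rangeI simp: image_iff)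
qed

section \<open>Finite positive measures as complex measures\<close>

lemma signed_borel_measure_measure:
  assumes "finite_measure \<sigma>" "sets \<sigma> = sets borel"
  shows "signed_borel_measure (measure \<sigma>)"
proof
  interpret finite_measure \<sigma> by fact
  show "(\<lambda>i. measure \<sigma> (A i)) sums measure \<sigma> (\<Union>i. A i)"
    if "range A \<subseteq> sets borel" "disjoint_family A" for A :: "nat \<Rightarrow> real set"
    using that assms(2) by (intro finite_measure_UNION) auto
qed

lemma pos_variation_measure:
  assumes "finite_measure \<sigma>" "sets \<sigma> = sets borel"
  shows "pos_variation (measure \<sigma>) = \<sigma>"
proof (rule measure_eqI)
  interpret finite_measure \<sigma> by fact
  interpret signed_borel_measure "measure \<sigma>"
    using assms by (rule signed_borel_measure_measure)
  show "sets (pos_variation (measure \<sigma>)) = sets \<sigma>"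
    by (simp add: assms(2))
  fix B assume "B \<in> sets (pos_variation (measure \<sigma>))"
  then have B: "B \<in> sets borel" by simp
  have "pos_var B = emeasure \<sigma> B"
  proof (rule antisym)
    show "pos_var B \<le> emeasure \<sigma> B"
    proof (rule pos_var_least)
      fix C :: "real set" assume "C \<in> sets borel" "C \<subseteq> B"
      then show "ennreal (measure \<sigma> C) \<le> emeasure \<sigma> B"
        using B assms(2) by (simp add: emeasure_eq_measure[symmetric] emeasure_mono)
    qed
    show "emeasure \<sigma> B \<le> pos_var B"
      using pos_var_upper[OF B order_refl] by (simp add: emeasure_eq_measure)
  qed
  then show "emeasure (pos_variation (measure \<sigma>)) B = emeasure \<sigma> B"
    using B by (simp add: emeasure_pos_variation)
qed

lemma pos_variation_nonpos:
  assumes "signed_borel_measure \<rho>" "\<And>B. \<rho> B \<le> 0"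
  shows "pos_variation \<rho> = null_measure borel"
proof (rule measure_eqI)
  interpret signed_borel_measure \<rho> by fact
  show "sets (pos_variation \<rho>) = sets (null_measure borel)"
    by simp
  fix B assume "B \<in> sets (pos_variation \<rho>)"
  then have B: "B \<in> sets borel" by simp
  have "pos_var B \<le> 0"
    using assms(2) by (intro pos_var_least) (simp add: ennreal_neg)
  then show "emeasure (pos_variation \<rho>) B = emeasure (null_measure borel) B"
    using B by (simp add: emeasure_pos_variation)
qed

lemma complex_measure_of_finite_measure:
  assumes "finite_measure \<sigma>" "sets \<sigma> = sets borel"
  shows "complex_measure (\<lambda>B. complex_of_real (measure \<sigma> B))"
  using signed_borel_measure.sums_disjoint[OF signed_borel_measure_measure[OF assms]]
  unfolding complex_measure_def by (auto simp: measure_notin_sets assms(2) sums_of_real)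

lemma complex_measure_integral_of_finite_measure:
  assumes "finite_measure \<sigma>" "sets \<sigma> = sets borel"
  shows "complex_measure_integral (\<lambda>B. complex_of_real (measure \<sigma> B)) S g = (LINT x:S|\<sigma>. g x)"
proof -
  have "signed_borel_measure (\<lambda>B. 0)"
    by standard simp
  then have zero: "pos_variation (\<lambda>B. 0) = null_measure borel"
    by (rule pos_variation_nonpos) simp
  have neg: "pos_variation (\<lambda>B. - measure \<sigma> B) = null_measure borel"
    by (intro pos_variation_nonpos signed_borel_measure_uminus signed_borel_measure_measure assms) simp
  show ?thesis
    by (simp add: complex_measure_integral_def pos_variation_measure[OF assms, simplified] zero neg
        set_lebesgue_integral_def)
qed

lemma exists_antiderivative_poly: "\<exists>q :: real poly. pderiv q = p"
proof -
  define q where "q = (\<Sum>i\<le>degree p. monom (coeff p i / real (Suc i)) (Suc i))"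
  have "pderiv q = (\<Sum>i\<le>degree p. monom (coeff p i) i)"
    unfolding q_def using higher_pderiv_sum[of 1 "\<lambda>i. monom (coeff p i / real (Suc i)) (Suc i)"]
    by (simp add: pderiv_monom del: of_nat_Suc)
  then show ?thesis
    using poly_as_sum_of_monoms[of p] by auto
qed

lemma vector_derivative_of_real_poly:
  "((\<lambda>x. complex_of_real (poly q x)) has_vector_derivative complex_of_real (poly (pderiv q) x)) (at x)"
  using has_vector_derivative_of_real[OF poly_DERIV] .

lemma Ck_of_real_poly: "Ck k (\<lambda>x. complex_of_real (poly q x))"
proof (induction k arbitrary: q)
  case 0
  show ?case unfolding Ck.simps by (intro continuous_intros)
next
  case (Suc k)
  have "vector_derivative (\<lambda>x. complex_of_real (poly q x)) (at x) = complex_of_real (poly (pderiv q) x)" for x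
    by (rule vector_derivative_at[OF vector_derivative_of_real_poly])
  moreover have "(\<lambda>x. complex_of_real (poly q x)) differentiable (at x)" for x
    using vector_derivative_of_real_poly by (rule differentiableI_vector)
  ultimately show ?case
    using Suc by simp
qed

text \<open>Polynomials with real coefficients have real values, so the complex identity separates into one
for the real part of \<open>\<nu>\<close>, which is compared with \<open>\<sigma>\<close>, and one for the imaginary part, which is
compared with the null measure.\<close>

lemma complex_measure_determined_by_polynomials:
  assumes \<nu>: "complex_measure \<nu>"
    and \<sigma>: "finite_measure \<sigma>" "sets \<sigma> = sets borel"
    and S: "compact S"
    and \<nu>_S: "\<And>B. B \<in> sets borel \<Longrightarrow> B \<inter> S = {} \<Longrightarrow> \<nu> B = 0"
    and \<sigma>_S: "emeasure \<sigma> (- S) = 0"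
    and eq: "\<And>p :: real poly. complex_measure_integral \<nu> S (\<lambda>x. complex_of_real (poly p x)) =
      (LINT x:S|\<sigma>. complex_of_real (poly p x))"
  shows "\<nu> = (\<lambda>B. complex_of_real (measure \<sigma> B))"
proof
  fix B
  show "\<nu> B = complex_of_real (measure \<sigma> B)"
  proof (cases "B \<in> sets borel")
    case False
    then show ?thesis
      using \<nu> \<sigma>(2) by (simp add: complex_measure_def measure_notin_sets)
  next
    case B: True
    have \<nu>_sums: "(\<lambda>i. \<nu> (A i)) sums \<nu> (\<Union>i. A i)" if "range A \<subseteq> sets borel" "disjoint_family A"
      for A :: "nat \<Rightarrow> real set"
      using \<nu> that unfolding complex_measure_def by blast
    have Re: "signed_borel_measure (\<lambda>B. Re (\<nu> B))"
      by standard (intro sums_Re \<nu>_sums)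
    have Im: "signed_borel_measure (\<lambda>B. Im (\<nu> B))"
      by standard (intro sums_Im \<nu>_sums)
    have S_borel: "S \<in> sets borel"
      using S by (rule borel_compact)
    have integrals: "(LINT x:S|pos_variation (\<lambda>B. Re (\<nu> B)). poly p x) -
        (LINT x:S|pos_variation (\<lambda>B. - Re (\<nu> B)). poly p x) = (LINT x:S|\<sigma>. poly p x)"
      "(LINT x:S|pos_variation (\<lambda>B. Im (\<nu> B)). poly p x) -
        (LINT x:S|pos_variation (\<lambda>B. - Im (\<nu> B)). poly p x) = (LINT x:S|null_measure borel. poly p x)"
      for p :: "real poly"
      using eq[of p] unfolding complex_measure_integral_def set_integral_complex_of_real complex_eq_iff
      by (simp_all add: set_lebesgue_integral_def)
    have "Re (\<nu> (B \<inter> S)) = measure \<sigma> (B \<inter> S)"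
      by (rule signed_measure_eq_from_moments[OF Re \<sigma> S integrals(1) B])
    moreover have "Im (\<nu> (B \<inter> S)) = measure (null_measure borel) (B \<inter> S)"
      by (rule signed_measure_eq_from_moments[OF Im _ _ S integrals(2) B]) (auto intro: finite_measureI)
    moreover have "\<nu> (B - S) = 0"
      using B S_borel by (intro \<nu>_S) auto
    moreover have "\<nu> B = \<nu> (B \<inter> S) + \<nu> (B - S)"
      using signed_borel_measure.charge_Un[OF Re, of "B \<inter> S" "B - S"]
        signed_borel_measure.charge_Un[OF Im, of "B \<inter> S" "B - S"] B S_borel
      by (auto simp: complex_eq_iff Int_Diff_Un)
    moreover have "measure \<sigma> (B \<inter> S) = measure \<sigma> B"
    proof -
      have "- S \<in> null_sets \<sigma>"
        using \<sigma>_S S_borel \<sigma>(2) by (intro null_setsI) auto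
      then have "measure \<sigma> (B - - S) = measure \<sigma> B"
        using B \<sigma>(2) by (intro measure_Diff_null_set) auto
      then show ?thesis by (simp add: Diff_eq)
    qed
    ultimately show ?thesis
      by (simp add: complex_eq_iff)
  qed
qed

section \<open>Realization of an arbitrary measure\<close>

context orthonormal_basis_sequence
begin

text \<open>The hull is the set of real points of a compact convex set of complex numbers that contains all
the eigenvalues.\<close>

lemma spectral_hull_diag:
  assumes "Bseq h" "Bseq v" "h m = complex_of_real a" "h n = complex_of_real b"
  shows "compact (spectral_hull (diag h) (diag v))" "{a..b} \<subseteq> spectral_hull (diag h) (diag v)"
proof -
  define K where "K = convex hull (spectrum (diag h) \<union> spectrum (diag h + diag v))"
  have compact_spectrum: "compact (closure (range c))" if "Bseq c" for c :: "nat \<Rightarrow> complex"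
    using that by (simp add: Elementary_Normed_Spaces.Bseq_eq_bounded)
  have "compact K"
    unfolding K_def using compact_spectrum[OF assms(1)] compact_spectrum[OF Bseq_plus[OF assms(1,2)]]
    by (intro compact_convex_hull compact_Un) (simp_all add: diag_add spectrum_diag Bseq_plus assms(1,2))
  have hull: "spectral_hull (diag h) (diag v) = complex_of_real -` K"
    by (auto simp: spectral_hull_def K_def)
  obtain R where R: "\<And>z. z \<in> K \<Longrightarrow> cmod z \<le> R"
    using compact_imp_bounded[OF \<open>compact K\<close>] unfolding bounded_iff by blast
  have "bounded (complex_of_real -` K)"
    unfolding bounded_iff using R by (intro exI[of _ R]) force
  moreover have "closed (complex_of_real -` K)"
    using \<open>compact K\<close> by (intro closed_vimage compact_imp_closed continuous_intros)
  ultimately show "compact (spectral_hull (diag h) (diag v))"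
    unfolding hull by (simp add: compact_eq_bounded_closed)
  have "h k \<in> K" for k
  proof -
    have "h k \<in> spectrum (diag h)"
      using closure_subset[of "range h"] by (auto simp: spectrum_diag[OF assms(1)])
    then show ?thesis
      unfolding K_def by (simp add: hull_inc)
  qed
  then have "a \<in> complex_of_real -` K" "b \<in> complex_of_real -` K"
    using assms(3,4) by (metis vimageI2)+
  moreover have "convex (complex_of_real -` K)"
    unfolding K_def
    by (intro convex_linear_vimage convex_convex_hull bounded_linear.linear bounded_linear_of_real)
  ultimately have "closed_segment a b \<subseteq> complex_of_real -` K"
    by (simp add: closed_segment_subset)
  then show "{a..b} \<subseteq> spectral_hull (diag h) (diag v)"
    unfolding hull by (auto simp: closed_segment_eq_real_ivl split: if_splits)
qed

end

theorem theorem4p4: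
  fixes \<omega> :: "(nat \<Rightarrow> complex) \<Rightarrow> complex"
    and Tr :: "('a :: chilbert_space \<Rightarrow>\<^sub>L 'a) \<Rightarrow> complex"
    and \<sigma> :: "real measure"
  assumes "separable_space (euclidean :: 'a topology)"
    and "infinite_dimensional TYPE('a)"
    and "dilation_invariant_state \<omega>"
    and "vanishes_on_null_sequences \<omega>"
    and "is_dixmier_trace \<omega> Tr"
    and "sets \<sigma> = sets borel"
    and "finite_measure \<sigma>"
    and "bounded (measure_support \<sigma>)"
  shows "\<exists>H\<^sub>0 V :: 'a \<Rightarrow>\<^sub>L 'a.
           H\<^sub>0 \<in> bounded_operators \<and> self_adjoint H\<^sub>0 \<and>
           V \<in> dual_macaev_ideal \<and> self_adjoint V \<and>
           (\<exists>E. orthonormal_basis E \<and> diagonal_wrt E H\<^sub>0 \<and> diagonal_wrt E V) \<and>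
           H\<^sub>0 o\<^sub>L V = V o\<^sub>L H\<^sub>0 \<and>
           (\<exists>!\<nu>. trace_formula_measure Tr H\<^sub>0 V \<nu>) \<and>
           spectral_shift_measure Tr H\<^sub>0 V = (\<lambda>B. complex_of_real (measure \<sigma> B))"
proof -
  note \<sigma> = assms(7,6)
  obtain e :: "nat \<Rightarrow> 'a" where e: "inj e" "orthonormal_basis (range e)"
    using exists_orthonormal_basis_sequence[OF assms(1,2)] by blast
  interpret orthonormal_basis_sequence e
    using e by unfold_locales
  obtain r0 where r0: "\<And>x. x \<in> measure_support \<sigma> \<Longrightarrow> \<bar>x\<bar> \<le> r0"
    using assms(8) unfolding bounded_iff by auto
  \<comment> \<open>If \<open>\<sigma>\<close> vanishes, its support is empty and \<open>r0\<close> may be negative.\<close>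
  define r where "r = max 0 r0"
  have "- r \<le> r"
    by (simp add: r_def)
  have "measure_support \<sigma> \<subseteq> {-r..r}"
  proof
    fix x assume "x \<in> measure_support \<sigma>"
    then have "\<bar>x\<bar> \<le> r"
      using r0[of x] by (simp add: r_def le_max_iff_disj)
    then show "x \<in> {-r..r}"
      by (simp add: abs_le_iff)
  qed
  then have null: "emeasure \<sigma> (- {-r..r}) = 0"
    by (rule null_outside_support[OF assms(6)]) simp
  obtain h v :: "nat \<Rightarrow> real" and C where ends: "-r \<in> range h" "r \<in> range h"
    and h: "\<And>n. h n \<in> {-r..r}" and v: "\<And>n. 0 \<le> v n" "\<And>n. v n \<le> C / (real n + 1)"
    and increments: "\<And>f. Ck 3 f \<Longrightarrow> \<exists>D K. \<forall>n. cmod (f (h n + v n) - f (h n)) \<le> D / (real n + 1) \<and>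
      cmod ((\<Sum>i<n. f (h i + v i) - f (h i)) -
        (LINT x|\<sigma>. vector_derivative f (at x)) * complex_of_real (ln (real n + 1))) \<le> K"
    using eigenvalue_sequences[OF \<sigma> null \<open>- r \<le> r\<close>] by blast
  let ?h = "\<lambda>n. complex_of_real (h n)" and ?v = "\<lambda>n. complex_of_real (v n)"
  define H\<^sub>0 where "H\<^sub>0 = diag ?h"
  define V where "V = diag ?v"
  define S where "S = spectral_hull H\<^sub>0 V"
  have "C \<ge> 0"
    using order_trans[OF v(1)[of 0] v(2)[of 0]] by simp
  have v_C: "v n \<le> C" for n
  proof -
    have "C / (real n + 1) \<le> C / 1"
      using \<open>C \<ge> 0\<close> by (intro divide_left_mono) auto
    then show ?thesis using v(2)[of n] by simp
  qed
  have h_r: "\<bar>h n\<bar> \<le> r" and hv_r: "\<bar>h n + v n\<bar> \<le> r + C" for n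
    using h[of n] v(1)[of n] v_C[of n] by auto
  have Bh: "Bseq ?h"
    using h_r by (intro BseqI'[of _ r]) simp
  have Bv: "Bseq ?v"
    using v(1) v_C by (intro BseqI'[of _ C]) simp
  have H0V: "H\<^sub>0 + V = diag (\<lambda>n. complex_of_real (h n + v n))"
    unfolding H\<^sub>0_def V_def by (simp add: diag_add[OF Bh Bv])
  obtain i j where "- r = h i" "r = h j"
    using ends by (elim rangeE)
  then have ij: "?h i = complex_of_real (- r)" "?h j = complex_of_real r"
    by simp_all
  have S: "compact S" "{-r..r} \<subseteq> S"
    unfolding S_def H\<^sub>0_def V_def using spectral_hull_diag[OF Bh Bv ij] .
  have S_borel: "S \<in> sets borel"
    using S(1) by (rule borel_compact)
  have \<sigma>_S: "emeasure \<sigma> (- S) = 0"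
  proof -
    have "emeasure \<sigma> (- S) \<le> emeasure \<sigma> (- {-r..r})"
      using S(2) assms(6) by (intro emeasure_mono) auto
    then show ?thesis using null by simp
  qed
  have restrict: "(LINT x|\<sigma>. g x) = (LINT x:S|\<sigma>. g x)" if "continuous_on UNIV g" for g :: "real \<Rightarrow> complex"
    unfolding set_lebesgue_integral_def
  proof (rule integral_cong_AE)
    have "g \<in> borel_measurable borel"
      using that by (rule borel_measurable_continuous_onI)
    then show "g \<in> borel_measurable \<sigma>" "(\<lambda>x. indicat_real S x *\<^sub>R g x) \<in> borel_measurable \<sigma>"
      using S_borel by (simp_all add: measurable_cong_sets[OF assms(6) refl])
    have "AE x in \<sigma>. x \<notin> - S"
      using \<sigma>_S S_borel assms(6) by (intro AE_not_in null_setsI) auto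
    then show "AE x in \<sigma>. g x = indicat_real S x *\<^sub>R g x"
      by eventually_elim simp
  qed
  let ?\<nu> = "\<lambda>B. complex_of_real (measure \<sigma> B)"
  have formula: "fun_calc f (H\<^sub>0 + V) - fun_calc f H\<^sub>0 \<in> dual_macaev_ideal \<and>
      Tr (fun_calc f (H\<^sub>0 + V) - fun_calc f H\<^sub>0) = (LINT x:S|\<sigma>. vector_derivative f (at x))"
    if f: "Ck 3 f" for f
  proof -
    have f_cont: "continuous_on UNIV f"
      using f by (rule Ck_continuous)
    have f'_cont: "continuous_on UNIV (\<lambda>x. vector_derivative f (at x))"
      using f by (intro Ck_continuous[of 2]) (simp add: eval_nat_numeral)
    obtain D K where D: "\<And>n. cmod (f (h n + v n) - f (h n)) \<le> D / (real n + 1)"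
      and K: "\<And>n. cmod ((\<Sum>i<n. f (h i + v i) - f (h i)) -
        (LINT x|\<sigma>. vector_derivative f (at x)) * complex_of_real (ln (real n + 1))) \<le> K"
      using increments[OF f] by blast
    have Bf: "Bseq (\<lambda>n. f (t n))" if "\<And>n. \<bar>t n\<bar> \<le> R" for t :: "nat \<Rightarrow> real" and R
    proof -
      have "bounded (f ` {-R..R})"
        by (intro compact_imp_bounded compact_continuous_image continuous_on_subset[OF f_cont]) simp_all
      then obtain M where "\<And>x. x \<in> {-R..R} \<Longrightarrow> cmod (f x) \<le> M"
        unfolding bounded_iff by blast
      moreover have "t n \<in> {-R..R}" for n
        using that[of n] by (simp add: abs_le_iff)
      ultimately show ?thesis by (intro BseqI'[of _ M]) simp
    qed
    have "fun_calc f (H\<^sub>0 + V) - fun_calc f H\<^sub>0 = diag (\<lambda>n. f (h n + v n) - f (h n))"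
      unfolding H0V unfolding H\<^sub>0_def fun_calc_diag[OF hv_r f_cont] fun_calc_diag[OF h_r f_cont]
      using Bf[OF hv_r] Bf[OF h_r] by (rule diag_diff)
    then show ?thesis
      by (simp only: diag_in_dual_macaev_ideal[OF D] dixmier_trace_diag[OF assms(3-5) D K] restrict[OF f'_cont])
  qed
  have exists: "trace_formula_measure Tr H\<^sub>0 V ?\<nu>"
    unfolding trace_formula_measure_def S_def[symmetric]
  proof (intro conjI ballI allI impI)
    show "complex_measure ?\<nu>"
      using \<sigma> by (rule complex_measure_of_finite_measure)
    show "?\<nu> B = 0" if "B \<in> sets borel" "B \<inter> S = {}" for B
    proof -
      have "emeasure \<sigma> B \<le> emeasure \<sigma> (- S)"
        using that S_borel assms(6) by (intro emeasure_mono) auto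
      then show ?thesis
        using \<sigma>_S by (simp add: measure_def)
    qed
    fix f assume f: "Ck 3 f"
    show "fun_calc f (H\<^sub>0 + V) - fun_calc f H\<^sub>0 \<in> dual_macaev_ideal"
      using formula[OF f] by (rule conjunct1)
    show "Tr (fun_calc f (H\<^sub>0 + V) - fun_calc f H\<^sub>0) =
        complex_measure_integral ?\<nu> S (\<lambda>x. vector_derivative f (at x))"
      unfolding complex_measure_integral_of_finite_measure[OF \<sigma>] using formula[OF f] by (rule conjunct2)
  qed
  have unique: "\<nu> = ?\<nu>" if \<nu>: "trace_formula_measure Tr H\<^sub>0 V \<nu>" for \<nu>
  proof (rule complex_measure_determined_by_polynomials[OF _ \<sigma> S(1) _ \<sigma>_S])
    show "complex_measure \<nu>"
      using \<nu> unfolding trace_formula_measure_def by blast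
    show "\<nu> B = 0" if "B \<in> sets borel" "B \<inter> S = {}" for B
      using \<nu> that unfolding trace_formula_measure_def S_def by blast
    fix p :: "real poly"
    obtain q where q: "pderiv q = p"
      using exists_antiderivative_poly by blast
    let ?f = "\<lambda>x. complex_of_real (poly q x)"
    have deriv: "vector_derivative ?f (at x) = complex_of_real (poly p x)" for x
      unfolding q[symmetric] by (rule vector_derivative_at[OF vector_derivative_of_real_poly])
    have "Ck 3 f \<longrightarrow> Tr (fun_calc f (H\<^sub>0 + V) - fun_calc f H\<^sub>0) =
        complex_measure_integral \<nu> S (\<lambda>x. vector_derivative f (at x))" for f
      using \<nu> unfolding trace_formula_measure_def S_def by blast
    from mp[OF this[of ?f] Ck_of_real_poly] conjunct2[OF formula[OF Ck_of_real_poly[of 3 q]]]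
    show "complex_measure_integral \<nu> S (\<lambda>x. complex_of_real (poly p x)) =
        (LINT x:S|\<sigma>. complex_of_real (poly p x))"
      by (simp only: deriv)
  qed
  have "\<exists>!\<nu>. trace_formula_measure Tr H\<^sub>0 V \<nu>"
    using exists unique by (rule ex1I)
  moreover have "spectral_shift_measure Tr H\<^sub>0 V = ?\<nu>"
    unfolding spectral_shift_measure_def using exists unique by (rule the_equality)
  moreover have "H\<^sub>0 \<in> bounded_operators" "self_adjoint H\<^sub>0" "diagonal_wrt (range e) H\<^sub>0"
    unfolding H\<^sub>0_def using Bh by (simp_all add: diag_bounded_operator self_adjoint_diag diagonal_wrt_diag)
  moreover have "V \<in> dual_macaev_ideal"
    unfolding V_def using v by (intro diag_in_dual_macaev_ideal[of _ C]) simp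
  moreover have "self_adjoint V" "diagonal_wrt (range e) V"
    unfolding V_def using Bv by (simp_all add: self_adjoint_diag diagonal_wrt_diag)
  moreover have "H\<^sub>0 o\<^sub>L V = V o\<^sub>L H\<^sub>0"
    unfolding H\<^sub>0_def V_def using Bh Bv by (simp add: diag_compose mult.commute)
  ultimately show ?thesis
    using e(2) by blast
qed

end
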